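(* Let $(\mathcal{A},G,\alpha)$ be a partial dynamical system with $\mathcal{A}$ abelian, with ideals $(\mathcal{D}_t)_{t\in G}$. Then the following properties are equivalent: (i) $\alpha$ is topologically free; (ii) for every $t\neq e$, $\|\alpha_t|_{\mathcal{K}}-\mathrm{id}|_{\mathcal{K}}\|=2$ for every nonzero $\alpha_t$-invariant ideal $\mathcal{K}$ in $\mathcal{D}_{t^{-1}}$; (iii) for every $t\neq e$, $\inf\{\|x\alpha_t(x)\|:x\in\mathcal{K}_+,\ \|x\|=1\}=0$ for every nonzero ideal $\mathcal{K}$ in $\mathcal{D}_{t^{-1}}$; (iv) for every $t\neq e$, $\inf\{\|x(a\delta_t)x\|:x\in\mathcal{B}_+,\ \|x\|=1\}=0$ for every $a\in\mathcal{D}_t$ and every nonzero hereditary $C^*$-subalgebra $\mathcal{B}$ of $\mathcal{A}$.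
   Context: All ideals of $C^*$-algebras are closed and two-sided. Let $\mathcal{A}$ be a $C^*$-algebra and $G$ a discrete group with identity $e$. A partial action $\alpha$ of $G$ on $\mathcal{A}$ is a collection $(\mathcal{D}_t)_{t\in G}$ of ideals of $\mathcal{A}$ and a collection of $^*$-isomorphisms $\alpha_t:\mathcal{D}_{t^{-1}}\to\mathcal{D}_t$ such that (i) $\mathcal{D}_e=\mathcal{A}$; (ii) $\alpha_s^{-1}(\mathcal{D}_s\cap\mathcal{D}_{t^{-1}})\subseteq\mathcal{D}_{(ts)^{-1}}$; (iii) $\alpha_t\circ\alpha_s(x)=\alpha_{ts}(x)$ for all $x\in\alpha_s^{-1}(\mathcal{D}_s\cap\mathcal{D}_{t^{-1}})$. The triple $(\mathcal{A},G,\alpha)$ is called a partial dynamical system. Reduced crossed product: let $\mathcal{L}$ be the $^*$-algebra of finite formal sums $\sum_{t\in G}a_t\delta_t$, $a_t\in\mathcal{D}_t$, with $(a_t\delta_t)(a_s\delta_s)=\alpha_t(\alpha_{t^{-1}}(a_t)a_s)\delta_{ts}$ and $(a_t\delta_t)^*=\alpha_{t^{-1}}(a_t^* )\delta_{t^{-1}}$. Let $E(\sum a_t\delta_t)=a_e$, and let $\ell_2$ be the right Hilbert $\mathcal{A}$-module obtained by completing $\mathcal{L}$ for the inner product $\langle x,y\rangle=E(x^*y)$. Left multiplication represents $\mathcal{L}$ faithfully by adjointable operators on $\ell_2$, and $\mathcal{A}\rtimes_{\alpha,r}G$ is the norm closure of $\mathcal{L}$ in the adjointable operators. $\mathcal{A}$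 is viewed as a subalgebra via $a\mapsto a\delta_e$; the element $x(a\delta_t)x=\alpha_t(\alpha_{t^{-1}}(xa)x)\delta_t$ is an element of $\mathcal{A}\rtimes_{\alpha,r}G$, and $\|b\delta_t\|=\|b\|$ for $b\in\mathcal{D}_t$. An ideal $\mathcal{K}\subseteq\mathcal{D}_{t^{-1}}$ is $\alpha_t$-invariant if $\alpha_t(\mathcal{K})=\mathcal{K}$. Topological freeness: for $\mathcal{A}=C_0(X)$ with $X$ locally compact Hausdorff, write $\mathcal{D}_t=C_0(U_t)$ with $U_t\subseteq X$ open; then $\alpha_t(f)=f\circ\theta_{t^{-1}}$ for homeomorphisms $\theta_t:U_{t^{-1}}\to U_t$. The partial action $\alpha$ is topologically free if for every finite set $F\subseteq G\setminus\{e\}$ the set $\bigcup_{t\in F}\{x\in U_{t^{-1}}:\theta_t(x)=x\}$ has empty interior in $X$. *)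

theory Defs
  imports "HOL-Analysis.Analysis" "HOL-Library.Poly_Mapping"
begin

section \<open>C*-algebras\<close>

text \<open>Not necessarily unital, possibly zero. The library has complete normed algebras over the reals
  only; the complex scalar multiplication extends the real one.\<close>

class cstar_algebra = banach + real_normed_algebra +
  fixes scaleC :: "complex \<Rightarrow> 'a \<Rightarrow> 'a"  (infixr \<open>*\<^sub>C\<close> 75)
    and star :: "'a \<Rightarrow> 'a"
  assumes scaleC_add_right: "c *\<^sub>C (x + y) = c *\<^sub>C x + c *\<^sub>C y"
    and scaleC_add_left: "(c + d) *\<^sub>C x = c *\<^sub>C x + d *\<^sub>C x"
    and scaleC_scaleC: "c *\<^sub>C (d *\<^sub>C x) = (c * d) *\<^sub>C x"
    and scaleR_scaleC: "r *\<^sub>R x = complex_of_real r *\<^sub>C x"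
    and mult_scaleC_left: "(c *\<^sub>C x) * y = c *\<^sub>C (x * y)"
    and mult_scaleC_right: "x * (c *\<^sub>C y) = c *\<^sub>C (x * y)"
    and norm_scaleC: "norm (c *\<^sub>C x) = cmod c * norm x"
    and star_star: "star (star x) = x"
    and star_add: "star (x + y) = star x + star y"
    and star_scaleC: "star (c *\<^sub>C x) = cnj c *\<^sub>C star x"
    and star_mult: "star (x * y) = star y * star x"
    and cstar_identity: "norm (star x * x) = (norm x)\<^sup>2"

definition complex_subspace :: "'a::cstar_algebra set \<Rightarrow> bool" where
  "complex_subspace S \<longleftrightarrow>
     0 \<in> S \<and> (\<forall>x\<in>S. \<forall>y\<in>S. x + y \<in> S) \<and> (\<forall>c. \<forall>x\<in>S. c *\<^sub>C x \<in> S)"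

definition closed_ideal :: "'a::cstar_algebra set \<Rightarrow> bool" where
  "closed_ideal I \<longleftrightarrow> closed I \<and> complex_subspace I \<and> (\<forall>x\<in>I. \<forall>a. a * x \<in> I \<and> x * a \<in> I)"

definition cstar_subalgebra :: "'a::cstar_algebra set \<Rightarrow> bool" where
  "cstar_subalgebra B \<longleftrightarrow> closed B \<and> complex_subspace B \<and>
     (\<forall>x\<in>B. \<forall>y\<in>B. x * y \<in> B) \<and> (\<forall>x\<in>B. star x \<in> B)"

definition positive_element :: "'a::cstar_algebra \<Rightarrow> bool" where
  "positive_element x \<longleftrightarrow> (\<exists>y. x = star y * y)"

definition hereditary_subalgebra :: "'a::cstar_algebra set \<Rightarrow> bool" where
  "hereditary_subalgebra B \<longleftrightarrow> cstar_subalgebra B \<and>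
     (\<forall>b\<in>B. \<forall>a. positive_element a \<and> positive_element (b - a) \<longrightarrow> a \<in> B)"

definition star_isomorphism ::
    "('a::cstar_algebra \<Rightarrow> 'b::cstar_algebra) \<Rightarrow> 'a set \<Rightarrow> 'b set \<Rightarrow> bool" where
  "star_isomorphism f I J \<longleftrightarrow> bij_betw f I J \<and>
     (\<forall>x\<in>I. \<forall>y\<in>I. f (x + y) = f x + f y \<and> f (x * y) = f x * f y) \<and>
     (\<forall>x\<in>I. (\<forall>c. f (c *\<^sub>C x) = c *\<^sub>C f x) \<and> f (star x) = star (f x))"

definition norm_on :: "'a::real_normed_vector set \<Rightarrow> ('a \<Rightarrow> 'b::real_normed_vector) \<Rightarrow> real" where
  "norm_on K f = (SUP x\<in>{x\<in>K. norm x \<le> 1}. norm (f x))"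

section \<open>Partial actions\<close>

text \<open>Groups are written additively, without being assumed abelian: \<open>t + s\<close>, \<open>- t\<close> and \<open>0\<close> stand
  for the product \<open>ts\<close>, the inverse of \<open>t\<close> and the identity. The values of \<open>\<alpha> t\<close> outside \<open>D (- t)\<close>
  are irrelevant.\<close>

definition partial_action ::
    "('g::group_add \<Rightarrow> 'a::cstar_algebra set) \<Rightarrow> ('g \<Rightarrow> 'a \<Rightarrow> 'a) \<Rightarrow> bool" where
  "partial_action D \<alpha> \<longleftrightarrow>
     (\<forall>t. closed_ideal (D t)) \<and>
     (\<forall>t. star_isomorphism (\<alpha> t) (D (- t)) (D t)) \<and>
     D 0 = UNIV \<and>
     (\<forall>s t. {x \<in> D (- s). \<alpha> s x \<in> D s \<inter> D (- t)} \<subseteq> D (- (t + s))) \<and>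
     (\<forall>s t. \<forall>x \<in> {x \<in> D (- s). \<alpha> s x \<in> D s \<inter> D (- t)}. \<alpha> t (\<alpha> s x) = \<alpha> (t + s) x)"

section \<open>Topological freeness\<close>

text \<open>An abelian algebra is identified with the continuous functions vanishing at infinity on its
  Gelfand spectrum, the set of characters with the topology of pointwise convergence: \<open>f\<close> is the
  function \<open>\<phi> \<mapsto> \<phi> f\<close>. The topology on the type of functions is the product topology.\<close>

definition characters :: "('a::cstar_algebra \<Rightarrow> complex) set" where
  "characters = {\<phi>. (\<exists>x. \<phi> x \<noteq> 0) \<and>
     (\<forall>x y. \<phi> (x + y) = \<phi> x + \<phi> y \<and> \<phi> (x * y) = \<phi> x * \<phi> y) \<and>
     (\<forall>c x. \<phi> (c *\<^sub>C x) = c * \<phi> x)}"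

definition gelfand_spectrum :: "('a::cstar_algebra \<Rightarrow> complex) topology" where
  "gelfand_spectrum = subtopology euclidean characters"

text \<open>The open set \<open>U\<close> for which the ideal \<open>I\<close> consists of the functions vanishing off \<open>U\<close>.\<close>

definition open_support :: "'a::cstar_algebra set \<Rightarrow> ('a \<Rightarrow> complex) set" where
  "open_support I = {\<phi> \<in> characters. \<exists>f\<in>I. \<phi> f \<noteq> 0}"

text \<open>The map from \<open>open_support (D (- t))\<close> to \<open>open_support (D t)\<close> dual to \<open>\<alpha> t\<close>. The equation
  \<open>\<alpha>\<^sub>t(f) = f \<circ> \<theta>\<^sub>t\<inverse>\<close> is evaluated at the point \<open>\<theta>\<^sub>t(\<phi>)\<close>.\<close>

definition dual_map ::
    "('g::group_add \<Rightarrow> 'a::cstar_algebra set) \<Rightarrow> ('g \<Rightarrow> 'a \<Rightarrow> 'a) \<Rightarrow> 'g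
      \<Rightarrow> ('a \<Rightarrow> complex) \<Rightarrow> ('a \<Rightarrow> complex)" where
  "dual_map D \<alpha> t \<phi> = (THE \<psi>. \<psi> \<in> open_support (D t) \<and> (\<forall>f \<in> D (- t). \<psi> (\<alpha> t f) = \<phi> f))"

definition topologically_free ::
    "('g::group_add \<Rightarrow> 'a::{cstar_algebra,comm_ring} set) \<Rightarrow> ('g \<Rightarrow> 'a \<Rightarrow> 'a) \<Rightarrow> bool" where
  "topologically_free D \<alpha> \<longleftrightarrow>
     (\<forall>F. finite F \<and> 0 \<notin> F \<longrightarrow>
        gelfand_spectrum interior_of
          (\<Union>t\<in>F. {\<phi> \<in> open_support (D (- t)). dual_map D \<alpha> t \<phi> = \<phi>}) = {})"

section \<open>The reduced crossed product\<close>

text \<open>Finite formal sums are finitely supported functions; \<open>Poly_Mapping.single t a\<close> is the sum with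
  the only term \<open>a \<delta>\<^sub>t\<close>. The convolution product of the library on this type is not used.\<close>

definition formal_sums ::
    "('g::group_add \<Rightarrow> 'a::cstar_algebra set) \<Rightarrow> ('g \<Rightarrow>\<^sub>0 'a) set" where
  "formal_sums D = {x. \<forall>t. Poly_Mapping.lookup x t \<in> D t}"

definition fs_mult ::
    "('g::group_add \<Rightarrow> 'a::cstar_algebra \<Rightarrow> 'a) \<Rightarrow> ('g \<Rightarrow>\<^sub>0 'a) \<Rightarrow> ('g \<Rightarrow>\<^sub>0 'a) \<Rightarrow> ('g \<Rightarrow>\<^sub>0 'a)" where
  "fs_mult \<alpha> x y = (\<Sum>t\<in>Poly_Mapping.keys x. \<Sum>s\<in>Poly_Mapping.keys y.
     Poly_Mapping.single (t + s) (\<alpha> t (\<alpha> (- t) (Poly_Mapping.lookup x t) * Poly_Mapping.lookup y s)))"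

definition fs_star ::
    "('g::group_add \<Rightarrow> 'a::cstar_algebra \<Rightarrow> 'a) \<Rightarrow> ('g \<Rightarrow>\<^sub>0 'a) \<Rightarrow> ('g \<Rightarrow>\<^sub>0 'a)" where
  "fs_star \<alpha> x = (\<Sum>t\<in>Poly_Mapping.keys x. Poly_Mapping.single (- t) (\<alpha> (- t) (star (Poly_Mapping.lookup x t))))"

definition fs_inner ::
    "('g::group_add \<Rightarrow> 'a::cstar_algebra \<Rightarrow> 'a) \<Rightarrow> ('g \<Rightarrow>\<^sub>0 'a) \<Rightarrow> ('g \<Rightarrow>\<^sub>0 'a) \<Rightarrow> 'a" where
  "fs_inner \<alpha> x y = Poly_Mapping.lookup (fs_mult \<alpha> (fs_star \<alpha> x) y) 0"

definition fs_norm :: "('g::group_add \<Rightarrow> 'a::cstar_algebra \<Rightarrow> 'a) \<Rightarrow> ('g \<Rightarrow>\<^sub>0 'a) \<Rightarrow> real" where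
  "fs_norm \<alpha> x = sqrt (norm (fs_inner \<alpha> x x))"

text \<open>The Hilbert module completing the formal sums: Cauchy sequences modulo null sequences.\<close>

definition l2_cauchy ::
    "('g::group_add \<Rightarrow> 'a::cstar_algebra set) \<Rightarrow> ('g \<Rightarrow> 'a \<Rightarrow> 'a) \<Rightarrow> (nat \<Rightarrow> 'g \<Rightarrow>\<^sub>0 'a) set" where
  "l2_cauchy D \<alpha> = {x. (\<forall>n. x n \<in> formal_sums D) \<and>
     (\<forall>\<epsilon>>0. \<exists>N. \<forall>m\<ge>N. \<forall>n\<ge>N. fs_norm \<alpha> (x m - x n) < \<epsilon>)}"

definition l2_rel ::
    "('g::group_add \<Rightarrow> 'a::cstar_algebra set) \<Rightarrow> ('g \<Rightarrow> 'a \<Rightarrow> 'a) \<Rightarrow> (nat \<Rightarrow> 'g \<Rightarrow>\<^sub>0 'a) rel" where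
  "l2_rel D \<alpha> = {(x, y). x \<in> l2_cauchy D \<alpha> \<and> y \<in> l2_cauchy D \<alpha> \<and>
     (\<lambda>n. fs_norm \<alpha> (x n - y n)) \<longlonglongrightarrow> 0}"

definition l2 ::
    "('g::group_add \<Rightarrow> 'a::cstar_algebra set) \<Rightarrow> ('g \<Rightarrow> 'a \<Rightarrow> 'a) \<Rightarrow> (nat \<Rightarrow> 'g \<Rightarrow>\<^sub>0 'a) set set" where
  "l2 D \<alpha> = l2_cauchy D \<alpha> // l2_rel D \<alpha>"

definition l2_diff ::
    "('g::group_add \<Rightarrow> 'a::cstar_algebra set) \<Rightarrow> ('g \<Rightarrow> 'a \<Rightarrow> 'a)
      \<Rightarrow> (nat \<Rightarrow> 'g \<Rightarrow>\<^sub>0 'a) set \<Rightarrow> (nat \<Rightarrow> 'g \<Rightarrow>\<^sub>0 'a) set \<Rightarrow> (nat \<Rightarrow> 'g \<Rightarrow>\<^sub>0 'a) set" where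
  "l2_diff D \<alpha> \<xi> \<eta> = (\<Union>x\<in>\<xi>. \<Union>y\<in>\<eta>. l2_rel D \<alpha> `` {\<lambda>n. x n - y n})"

definition l2_inner ::
    "('g::group_add \<Rightarrow> 'a::cstar_algebra \<Rightarrow> 'a)
      \<Rightarrow> (nat \<Rightarrow> 'g \<Rightarrow>\<^sub>0 'a) set \<Rightarrow> (nat \<Rightarrow> 'g \<Rightarrow>\<^sub>0 'a) set \<Rightarrow> 'a" where
  "l2_inner \<alpha> \<xi> \<eta> = (THE a. \<forall>x\<in>\<xi>. \<forall>y\<in>\<eta>. (\<lambda>n. fs_inner \<alpha> (x n) (y n)) \<longlonglongrightarrow> a)"

definition l2_norm ::
    "('g::group_add \<Rightarrow> 'a::cstar_algebra \<Rightarrow> 'a) \<Rightarrow> (nat \<Rightarrow> 'g \<Rightarrow>\<^sub>0 'a) set \<Rightarrow> real" where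
  "l2_norm \<alpha> \<xi> = sqrt (norm (l2_inner \<alpha> \<xi> \<xi>))"

definition l2_op_norm ::
    "('g::group_add \<Rightarrow> 'a::cstar_algebra set) \<Rightarrow> ('g \<Rightarrow> 'a \<Rightarrow> 'a)
      \<Rightarrow> ((nat \<Rightarrow> 'g \<Rightarrow>\<^sub>0 'a) set \<Rightarrow> (nat \<Rightarrow> 'g \<Rightarrow>\<^sub>0 'a) set) \<Rightarrow> real" where
  "l2_op_norm D \<alpha> T = (SUP \<xi>\<in>{\<xi> \<in> l2 D \<alpha>. l2_norm \<alpha> \<xi> \<le> 1}. l2_norm \<alpha> (T \<xi>))"

definition adjointable_operators ::
    "('g::group_add \<Rightarrow> 'a::cstar_algebra set) \<Rightarrow> ('g \<Rightarrow> 'a \<Rightarrow> 'a)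
      \<Rightarrow> ((nat \<Rightarrow> 'g \<Rightarrow>\<^sub>0 'a) set \<Rightarrow> (nat \<Rightarrow> 'g \<Rightarrow>\<^sub>0 'a) set) set" where
  "adjointable_operators D \<alpha> = {T \<in> l2 D \<alpha> \<rightarrow>\<^sub>E l2 D \<alpha>.
     \<exists>S \<in> l2 D \<alpha> \<rightarrow>\<^sub>E l2 D \<alpha>. \<forall>\<xi>\<in>l2 D \<alpha>. \<forall>\<eta>\<in>l2 D \<alpha>.
       l2_inner \<alpha> (T \<xi>) \<eta> = l2_inner \<alpha> \<xi> (S \<eta>)}"

definition left_mult ::
    "('g::group_add \<Rightarrow> 'a::cstar_algebra set) \<Rightarrow> ('g \<Rightarrow> 'a \<Rightarrow> 'a) \<Rightarrow> ('g \<Rightarrow>\<^sub>0 'a)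
      \<Rightarrow> (nat \<Rightarrow> 'g \<Rightarrow>\<^sub>0 'a) set \<Rightarrow> (nat \<Rightarrow> 'g \<Rightarrow>\<^sub>0 'a) set" where
  "left_mult D \<alpha> z = (\<lambda>\<xi> \<in> l2 D \<alpha>. \<Union>x\<in>\<xi>. l2_rel D \<alpha> `` {\<lambda>n. fs_mult \<alpha> z (x n)})"

text \<open>The reduced crossed product carries the norm \<open>l2_op_norm\<close>, so \<open>reduced_norm\<close> is the norm in it
  of a formal sum, which it contains as a left multiplication operator.\<close>

definition reduced_crossed_product ::
    "('g::group_add \<Rightarrow> 'a::cstar_algebra set) \<Rightarrow> ('g \<Rightarrow> 'a \<Rightarrow> 'a)
      \<Rightarrow> ((nat \<Rightarrow> 'g \<Rightarrow>\<^sub>0 'a) set \<Rightarrow> (nat \<Rightarrow> 'g \<Rightarrow>\<^sub>0 'a) set) set" where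
  "reduced_crossed_product D \<alpha> = {T \<in> adjointable_operators D \<alpha>.
     \<forall>\<epsilon>>0. \<exists>z\<in>formal_sums D. l2_op_norm D \<alpha> (\<lambda>\<xi>. l2_diff D \<alpha> (T \<xi>) (left_mult D \<alpha> z \<xi>)) < \<epsilon>}"

definition reduced_norm ::
    "('g::group_add \<Rightarrow> 'a::cstar_algebra set) \<Rightarrow> ('g \<Rightarrow> 'a \<Rightarrow> 'a) \<Rightarrow> ('g \<Rightarrow>\<^sub>0 'a) \<Rightarrow> real" where
  "reduced_norm D \<alpha> z = l2_op_norm D \<alpha> (left_mult D \<alpha> z)"

end

theory Submission imports Defs begin

text \<open>Commutative Gelfand theory is obtained without unit and without spectral theory. By Zorn's lemma
  there is a minimal C*-seminorm \<open>p\<close> with \<open>p x = norm x = 1\<close>. Minimality makes \<open>p\<close> multiplicative,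
  and a multiplicative C*-seminorm is the absolute value of a character. Hence the norm is the supremum
  over the characters, and continuous functions vanishing at 0 operate on the self-adjoint elements.

  If \<open>\<theta>\<^sub>t\<close> moves a point \<open>\<phi>\<close> of the support of an ideal, functions supported near \<open>\<phi>\<close> are orthogonal
  to their images under \<open>\<alpha>\<^sub>t\<close>, which gives (iii) and (iv), and a self-adjoint function with values \<open>1\<close>
  at \<open>\<phi>\<close> and \<open>-1\<close> at \<open>\<theta>\<^sub>t(\<phi>)\<close> gives (ii). If \<open>\<alpha>\<close> is not topologically free, a single \<open>\<alpha>\<^sub>t\<close>
  is the identity on a nonzero ideal, and all three properties fail there.\<close>

section \<open>Commutative C*-algebras\<close>

text \<open>The normalization \<open>p x = 1\<close> survives pointwise infima along chains; it
  takes over the role that the unit has in the usual argument with maximal ideals. Without a unit,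
  functions applied to elements must vanish at 0, and an element that acts as a unit on a given
  subalgebra has to be constructed. The suprema and infima in the three conditions are computed
  exactly. Points moved by the action give factors with \<open>p * \<alpha> t r = 0\<close>, so the
  infima 0 are attained; on an ideal where the action is trivial the sets of norms in (iii) and (iv)
  collapse to \<open>{1}\<close>, and the supremum in (ii) is 0. The crossed product enters only
  through the monomial x(a\<delta>_t)x, so it suffices to know the norm of left multiplication by
  one monomial. At a single character this becomes an estimate for finitely supported scalar
  functions on the group.\<close>

lemma scaleC_one [simp]: "1 *\<^sub>C x = (x :: 'a::cstar_algebra)"
  using scaleR_scaleC[of 1 x] by simp

lemma scaleC_zero [simp]: "0 *\<^sub>C x = (0 :: 'a::cstar_algebra)"
  using scaleR_scaleC[of 0 x] by simp

lemma scaleC_zero_right [simp]: "c *\<^sub>C 0 = (0 :: 'a::cstar_algebra)"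
  using scaleC_add_right[of c 0 "0::'a"] by simp

lemma scaleC_minus_left [simp]: "(- c) *\<^sub>C x = - (c *\<^sub>C x :: 'a::cstar_algebra)"
  using scaleC_add_left[of c "- c" x] by (simp add: eq_neg_iff_add_eq_0 add.commute)

lemma scaleC_minus_right [simp]: "c *\<^sub>C (- x) = - (c *\<^sub>C x :: 'a::cstar_algebra)"
  using scaleC_add_right[of c x "- x"] by (simp add: eq_neg_iff_add_eq_0 add.commute)

lemma scaleC_diff_right: "c *\<^sub>C (x - y) = c *\<^sub>C x - (c *\<^sub>C y :: 'a::cstar_algebra)"
  using scaleC_add_right[of c x "- y"] by simp

lemma star_zero [simp]: "star 0 = (0 :: 'a::cstar_algebra)"
  using star_add[of 0 "0::'a"] by simp

lemma star_minus [simp]: "star (- x) = - star (x :: 'a::cstar_algebra)"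
  using star_add[of x "- x"] by (simp add: eq_neg_iff_add_eq_0 add.commute)

lemma star_diff: "star (x - y) = star x - star (y :: 'a::cstar_algebra)"
  using star_add[of x "- y"] by simp

lemma star_scaleR: "star (r *\<^sub>R x) = r *\<^sub>R star (x :: 'a::cstar_algebra)"
  by (simp add: scaleR_scaleC star_scaleC)

lemma norm_star [simp]: "norm (star x) = norm (x :: 'a::cstar_algebra)"
proof -
  have "norm x \<le> norm (star x)" for x :: 'a
    using cstar_identity[of x] norm_mult_ineq[of "star x" x]
    by (cases "x = 0") (auto simp: power2_eq_square)
  from this[of x] this[of "star x"] show ?thesis by (simp add: star_star)
qed

lemma selfadjoint_decomposition:
  obtains h k :: "'a::cstar_algebra" where "star h = h" "star k = k" "x = h + \<i> *\<^sub>C k"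
proof
  define h where "h = (1/2) *\<^sub>C (x + star x)"
  define k where "k = (- \<i>/2) *\<^sub>C (x - star x)"
  show "star h = h" by (simp add: h_def star_scaleC star_add star_star add.commute)
  show "star k = k" by (simp add: k_def star_scaleC star_diff star_star scaleC_diff_right)
  have "\<i> *\<^sub>C k = (1/2) *\<^sub>C (x - star x)"
    by (simp add: k_def scaleC_scaleC scaleC_minus_left[symmetric] del: scaleC_minus_left)
  hence "h + \<i> *\<^sub>C k = (1/2) *\<^sub>C x + (1/2) *\<^sub>C x"
    by (simp add: h_def scaleC_add_right scaleC_diff_right)
  thus "x = h + \<i> *\<^sub>C k" by (simp add: scaleC_add_left[symmetric])
qed

subsection \<open>C*-seminorms\<close>

text \<open>A C*-seminorm stands for the quotient by its kernel, so that quotients can be compared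
  and passed to a limit within one type.\<close>

locale cstar_seminorm =
  fixes p :: "'a::{cstar_algebra,comm_ring} \<Rightarrow> real"
  assumes triangle: "p (a + b) \<le> p a + p b"
    and scale: "p (c *\<^sub>C a) = cmod c * p a"
    and submult: "p (a * b) \<le> p a * p b"
    and cstar: "p (star a * a) = (p a)\<^sup>2"
begin

lemma zero [simp]: "p 0 = 0"
  using scale[of 0 0] by simp

lemma minus [simp]: "p (- a) = p a"
  using scale[of "-1" a] by simp

lemma diff_commute: "p (a - b) = p (b - a)"
  using minus[of "a - b"] by simp

lemma nonneg [simp]: "0 \<le> p a"
  using triangle[of a "- a"] by simp

lemma scaleR: "p (r *\<^sub>R a) = \<bar>r\<bar> * p a"
  by (simp add: scaleR_scaleC scale)

lemma star [simp]: "p (star a) = p a"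
proof -
  have "p a \<le> p (star a)" for a
    using cstar[of a] submult[of "star a" a] nonneg[of a]
    by (cases "p a = 0") (auto simp: power2_eq_square)
  from this[of a] this[of "star a"] show ?thesis by (simp add: star_star)
qed

lemma selfadjoint_square: "star a = a \<Longrightarrow> p (a * a) = (p a)\<^sup>2"
  using cstar[of a] by simp

text \<open>\<open>s\<^sup>2 + t\<^sup>2 = z\<^sup>* z\<close> for \<open>z = s + it\<close>, and \<open>s\<close> is the real part of \<open>z\<close>.\<close>

lemma square_le_sum_squares:
  assumes "star s = s" "star t = t"
  shows "p (s * s) \<le> p (s * s + t * t)"
proof -
  define z where "z = s + \<i> *\<^sub>C t"
  have z': "star z = s - \<i> *\<^sub>C t" by (simp add: z_def star_add star_scaleC assms)
  have "\<i> *\<^sub>C \<i> *\<^sub>C (t * t) = - (t * t)" by (simp add: scaleC_scaleC)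
  hence zz: "star z * z = s * s + t * t"
    unfolding z' unfolding z_def
    by (simp add: algebra_simps mult_scaleC_left mult_scaleC_right)
  have "2 *\<^sub>R s = z + star z" unfolding z' by (simp add: z_def scaleR_2)
  hence "2 * p s = p (z + star z)" using scaleR[of 2 s] by simp
  hence "2 * p s \<le> 2 * p z" using triangle[of z "star z"] by simp
  hence "(p s)\<^sup>2 \<le> (p z)\<^sup>2" by (simp add: power_mono)
  thus ?thesis using cstar[of z] selfadjoint_square[OF assms(1)] by (simp add: zz)
qed

end

lemma cstar_seminorm_norm: "cstar_seminorm (norm :: 'a::{cstar_algebra,comm_ring} \<Rightarrow> real)"
  by unfold_locales (auto simp: norm_triangle_ineq norm_scaleC norm_mult_ineq cstar_identity)

text \<open>A multiplicative C*-seminorm is the absolute value of a character: modulo its kernel every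
  element is a multiple of \<open>x\<close>. The point is that two squares \<open>u\<close>, \<open>v\<close> of seminorm 1 agree modulo the
  kernel, because \<open>(u + v)\<^sup>2 = (u - v)\<^sup>2 + 4uv\<close>.\<close>

locale multiplicative_cstar_seminorm = cstar_seminorm +
  fixes x
  assumes mult: "p (a * b) = p a * p b"
    and sa_x: "star x = x" and p_x: "p x = 1"
begin

text \<open>With \<open>s = 2ab\<close> and \<open>t = u - v\<close> one has
  \<open>(u + v)^2 = s^2 + t^2\<close>, and \<open>s^2\<close> has seminorm 4; adding the square
  \<open>t^2\<close> cannot lower it.\<close>

lemma square_add:
  assumes u: "u = a * a" "star a = a" "p u = 1" and v: "v = b * b" "star b = b" "p v = 1"
  shows "p (u + v) = 2"
proof -
  have sa: "star u = u" "star v = v" using u v by (simp_all add: star_mult)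
  define s t where "s = 2 *\<^sub>R (a * b)" and "t = u - v"
  have st: "star s = s" "star t = t"
    by (simp_all add: s_def t_def sa u v star_scaleR star_mult star_diff mult.commute)
  have "p a = 1" "p b = 1"
    using u v nonneg[of a] nonneg[of b]
    by (auto simp: mult power2_eq_square[symmetric] power2_eq_1_iff)
  hence "p (s * s) = 4" by (simp add: s_def mult scaleR)
  moreover have "(u + v) * (u + v) = s * s + t * t"
    unfolding s_def t_def u v by (simp add: algebra_simps scaleR_2)
  ultimately have "2\<^sup>2 \<le> (p (u + v))\<^sup>2"
    using square_le_sum_squares[OF st] mult[of "u + v" "u + v"] by (simp add: power2_eq_square)
  hence "2 \<le> p (u + v)" by (rule power2_le_imp_le) simp
  thus ?thesis using triangle[of u v] u v by simp
qed

text \<open>Were \<open>p u\<close> positive, rescaling \<open>u\<close> to seminorm 1 would give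
  \<open>w\<close> with \<open>p (w + v) = 2\<close>. But \<open>w + v\<close> exceeds
  \<open>u + v\<close> only by \<open>(1 - p u) w\<close>, which allows at most
  \<open>2 - p u\<close>.\<close>

lemma square_negligible:
  assumes u: "u = a * a" "star a = a" and v: "v = b * b" "star b = b" "p v = 1"
    and "p (u + v) \<le> 1"
  shows "p u = 0"
proof (rule ccontr)
  assume "p u \<noteq> 0"
  hence pos: "0 < p u" using nonneg[of u] by linarith
  define w where "w = (1 / p u) *\<^sub>R u"
  have pw: "p w = 1" using pos by (simp add: w_def scaleR)
  have "p u \<le> p (u + v)" using square_le_sum_squares u v by metis
  hence le1: "p u \<le> 1" using assms by simp
  define c where "c = (1 / sqrt (p u)) *\<^sub>R a"
  have "w = c * c" "star c = c" using pos by (simp_all add: w_def c_def u star_scaleR)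
  hence "p (w + v) = 2" using pw v by (rule square_add)
  moreover have "u = p u *\<^sub>R w" using pos by (simp add: w_def)
  hence "w + v = (u + v) + (1 - p u) *\<^sub>R w" by (simp add: algebra_simps)
  hence "p (w + v) \<le> p (u + v) + p ((1 - p u) *\<^sub>R w)" using triangle by metis
  hence "p (w + v) \<le> 1 + (1 - p u)" using assms le1 pw by (simp add: scaleR)
  ultimately show False using pos by simp
qed

text \<open>In \<open>((u + v)/2)^2 = ((u - v)/2)^2 + (ab)^2\<close> the left side and
  \<open>(ab)^2\<close> both have seminorm 1, so the remaining square is negligible.\<close>

lemma squares_agree:
  assumes u: "u = a * a" "star a = a" "p u = 1" and v: "v = b * b" "star b = b" "p v = 1"
  shows "p (u - v) = 0"
proof -
  have sa: "star u = u" "star v = v" using u v by (simp_all add: star_mult)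
  define s t where "s = a * b" and "t = (1/2) *\<^sub>R (u - v)"
  have st: "star s = s" "star t = t"
    by (simp_all add: s_def t_def sa u v star_scaleR star_mult star_diff mult.commute)
  have "s * s = u * v" by (simp add: s_def u v algebra_simps)
  hence ps: "p (s * s) = 1" using u v by (simp add: mult)
  define w where "w = (1/2) *\<^sub>R (u + v)"
  have "t * t + s * s = w * w"
    unfolding s_def t_def u v w_def by (simp add: algebra_simps)
      (simp flip: scaleR_add_left)
  moreover have "p w = 1" using square_add[OF u v] by (simp add: w_def scaleR)
  ultimately have "p (t * t + s * s) \<le> 1" by (simp add: mult)
  with square_negligible[OF refl st(2) refl st(1) ps] have "p (t * t) = 0" by simp
  thus ?thesis by (simp add: mult t_def scaleR)
qed

end

section \<open>Existence of minimal C*-seminorms\<close>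

text \<open>Each axiom involves finitely many elements, and in a chain one member approximates the
  infimum at all of them at once. The axioms therefore pass to the infimum as limits along a
  sequence of members.\<close>

lemma cstar_seminorm_chain_Inf:
  fixes C :: "('a::{cstar_algebra,comm_ring} \<Rightarrow> real) set"
  assumes ne: "C \<noteq> {}" and C: "\<And>p. p \<in> C \<Longrightarrow> cstar_seminorm p"
    and chain: "\<And>p q. p \<in> C \<Longrightarrow> q \<in> C \<Longrightarrow> p \<le> q \<or> q \<le> p"
  shows "cstar_seminorm (\<lambda>a. INF p\<in>C. p a)"
proof -
  define u where "u a = (INF p\<in>C. p a)" for a
  have bdd: "bdd_below ((\<lambda>p. p a) ` C)" for a
    using cstar_seminorm.nonneg[OF C] by (auto intro!: bdd_belowI2[where m = 0])
  have lower: "u a \<le> p a" if "p \<in> C" for p a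
    unfolding u_def by (rule cINF_lower[OF bdd that])
  have approx: "\<exists>p\<in>C. \<forall>a\<in>S. p a < u a + e" if "finite S" "0 < e" for S and e :: real
    using that(1)
  proof (induction S rule: finite_induct)
    case empty
    thus ?case using ne by auto
  next
    case (insert b S)
    then obtain p where p: "p \<in> C" "\<forall>a\<in>S. p a < u a + e" by auto
    have "\<exists>q\<in>C. q b < u b + e"
      using cINF_less_iff[OF ne bdd, of b "u b + e"] \<open>0 < e\<close> by (simp add: u_def)
    then obtain q where q: "q \<in> C" "q b < u b + e" by auto
    from chain[OF p(1) q(1)] show ?case
    proof
      assume "p \<le> q"
      hence "p b \<le> q b" by (simp add: le_fun_def)
      hence "p b < u b + e" using q(2) by (rule le_less_trans)
      hence "\<forall>a\<in>insert b S. p a < u a + e" using p(2) by simp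
      thus ?thesis using p(1) by (rule rev_bexI[rotated])
    next
      assume "q \<le> p"
      hence "\<forall>a. q a \<le> p a" by (simp add: le_fun_def)
      hence "\<forall>a\<in>insert b S. q a < u a + e" using p(2) q(2) by (auto intro: le_less_trans)
      thus ?thesis using q(1) by blast
    qed
  qed
  have limit: "\<exists>P. (\<forall>n. P n \<in> C) \<and> (\<forall>a\<in>S. (\<lambda>n. P n a) \<longlonglongrightarrow> u a)" if S: "finite S" for S
  proof -
    have "\<exists>p. p \<in> C \<and> (\<forall>a\<in>S. p a < u a + 1 / real (Suc n))" for n
      using approx[OF S, of "1 / real (Suc n)"] by (simp add: Bex_def)
    then obtain P where P: "\<And>n. P n \<in> C" "\<And>n a. a \<in> S \<Longrightarrow> P n a < u a + 1 / real (Suc n)"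
      by metis
    have "(\<lambda>n. P n a) \<longlonglongrightarrow> u a" if "a \<in> S" for a
    proof (rule tendsto_sandwich[of "\<lambda>_. u a" _ _ "\<lambda>n. u a + 1 / real (Suc n)"])
      show "(\<lambda>n. u a + 1 / real (Suc n)) \<longlonglongrightarrow> u a"
        using tendsto_add[OF tendsto_const LIMSEQ_Suc[OF lim_1_over_n], of "u a"]
        by simp
    qed (use P that lower in \<open>auto intro!: eventuallyI less_imp_le\<close>)
    thus ?thesis using P by blast
  qed
  have "cstar_seminorm u"
  proof
    fix a b :: 'a and c :: complex
    let ?S = "{a, b, a + b, a * b, c *\<^sub>C a, star a * a}"
    obtain P where "\<forall>n. P n \<in> C" and P': "\<forall>y\<in>?S. (\<lambda>n. P n y) \<longlonglongrightarrow> u y"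
      using limit[of ?S] by blast
    hence P: "cstar_seminorm (P n)" for n using C by blast
    have lims: "(\<lambda>n. P n y) \<longlonglongrightarrow> u y" if "y \<in> ?S" for y using P' that by (rule bspec)
    show "u (a + b) \<le> u a + u b"
    proof (rule LIMSEQ_le)
      show "(\<lambda>n. P n (a + b)) \<longlonglongrightarrow> u (a + b)" by (simp add: lims)
      show "(\<lambda>n. P n a + P n b) \<longlonglongrightarrow> u a + u b" by (intro tendsto_add lims) auto
    qed (use cstar_seminorm.triangle[OF P] in auto)
    show "u (a * b) \<le> u a * u b"
    proof (rule LIMSEQ_le)
      show "(\<lambda>n. P n (a * b)) \<longlonglongrightarrow> u (a * b)" by (simp add: lims)
      show "(\<lambda>n. P n a * P n b) \<longlonglongrightarrow> u a * u b" by (intro tendsto_mult lims) auto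
    qed (use cstar_seminorm.submult[OF P] in auto)
    show "u (c *\<^sub>C a) = cmod c * u a"
    proof (rule LIMSEQ_unique)
      show "(\<lambda>n. P n (c *\<^sub>C a)) \<longlonglongrightarrow> u (c *\<^sub>C a)" by (simp add: lims)
      show "(\<lambda>n. P n (c *\<^sub>C a)) \<longlonglongrightarrow> cmod c * u a"
        unfolding cstar_seminorm.scale[OF P] by (intro tendsto_intros lims) auto
    qed
    show "u (star a * a) = (u a)\<^sup>2"
    proof (rule LIMSEQ_unique)
      show "(\<lambda>n. P n (star a * a)) \<longlonglongrightarrow> u (star a * a)" by (simp add: lims)
      show "(\<lambda>n. P n (star a * a)) \<longlonglongrightarrow> (u a)\<^sup>2"
        unfolding cstar_seminorm.cstar[OF P] by (intro tendsto_intros lims) auto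
    qed
  qed
  thus ?thesis by (simp add: u_def[abs_def])
qed

locale minimal_cstar_seminorm = cstar_seminorm +
  fixes x
  assumes sa_x: "star x = x" and p_x: "p x = 1"
    and minimal: "\<And>q. cstar_seminorm q \<Longrightarrow> q x = 1 \<Longrightarrow> q \<le> p \<Longrightarrow> q = p"

lemma exists_minimal_cstar_seminorm:
  fixes x :: "'a::{cstar_algebra,comm_ring}"
  assumes "star x = x" "norm x = 1"
  shows "\<exists>p. minimal_cstar_seminorm p x"
proof -
  define A where "A = {p :: 'a \<Rightarrow> real. cstar_seminorm p \<and> p x = 1}"
  have "\<exists>m\<in>A. \<forall>a\<in>A. m \<ge> a \<longrightarrow> a = m"
  proof (rule predicate_Zorn)
    show "partial_order_on A (relation_of (\<lambda>p q. p \<ge> q) A)"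
      by (rule partial_order_on_relation_ofI) auto
    fix C assume "C \<in> Chains (relation_of (\<lambda>p q. p \<ge> q) A)"
    hence C: "C \<subseteq> A" and ch: "\<And>p q. p \<in> C \<Longrightarrow> q \<in> C \<Longrightarrow> p \<le> q \<or> q \<le> p"
      by (auto simp: Chains_def relation_of_def)
    show "\<exists>u\<in>A. \<forall>a\<in>C. u \<le> a"
    \<comment> \<open>The infimum over an empty set of reals carries no information, so the norm
      serves as bound of the empty chain.\<close>
    proof (cases "C = {}")
      case True
      thus ?thesis using assms cstar_seminorm_norm by (auto simp: A_def)
    next
      case False
      let ?u = "\<lambda>a. INF p\<in>C. p a"
      have "cstar_seminorm ?u"
        using C by (intro cstar_seminorm_chain_Inf False ch) (auto simp: A_def)
      moreover have "(INF p\<in>C. p x) = (INF p\<in>C. 1)" using C by (intro INF_cong) (auto simp: A_def)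
      hence "?u x = 1" using False by simp
      moreover have "?u \<le> a" if "a \<in> C" for a
        using C cstar_seminorm.nonneg that
        by (auto simp: A_def le_fun_def intro!: cINF_lower bdd_belowI2[where m = 0])
      ultimately show ?thesis by (auto simp: A_def)
    qed
  qed
  thus ?thesis
    using assms
    by (auto simp: A_def minimal_cstar_seminorm_def minimal_cstar_seminorm_axioms_def)
qed

text \<open>\<open>((*) b ^^ n) a\<close> is \<open>b\<^sup>n a\<close>, powers not being available without a unit.\<close>

lemma funpow_mult_add: "((*) b ^^ n) (a + c) = ((*) b ^^ n) a + ((*) b ^^ n) (c :: 'a::ring)"
  by (induction n) (auto simp: distrib_left)

lemma funpow_mult_scaleC:
  "((*) b ^^ n) (c *\<^sub>C a) = c *\<^sub>C ((*) b ^^ n) (a :: 'a::cstar_algebra)"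
  by (induction n) (auto simp: mult_scaleC_right)

lemma funpow_mult_left: "((*) b ^^ n) (a * c) = ((*) b ^^ n) a * (c :: 'a::comm_ring)"
  by (induction n) (auto simp: mult.assoc)

lemma funpow_mult_right: "((*) b ^^ n) (a * c) = a * ((*) b ^^ n) (c :: 'a::comm_ring)"
  using funpow_mult_left[of n b c a] by (simp add: mult.commute)

lemma funpow_mult_mult:
  "((*) b ^^ (m + n)) (a * c) = ((*) b ^^ m) a * ((*) b ^^ n) (c :: 'a::comm_ring)"
  by (simp only: funpow_add o_apply funpow_mult_right[where n = n] funpow_mult_left[where n = m])

lemma star_funpow_mult:
  "star b = b \<Longrightarrow> star (((*) b ^^ n) a) = ((*) b ^^ n) (star (a :: 'a::{cstar_algebra,comm_ring}))"
  by (induction n) (auto simp: star_mult mult.commute)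

section \<open>Multiplicativity of minimal C*-seminorms\<close>

context minimal_cstar_seminorm
begin

text \<open>\<open>a \<mapsto> lim p(b\<^sup>n a)\<close> is a C*-seminorm below \<open>p\<close>.\<close>

lemma mult_unimodular_aux:
  assumes b: "star b = b" "p b = 1" and bx: "\<And>n. p (((*) b ^^ n) x) = 1"
  shows "p (b * a) = p a"
proof -
  let ?M = "\<lambda>n. (*) b ^^ n"
  have step: "p (b * c) \<le> p c" for c using submult[of b c] b by simp
  hence dec: "decseq (\<lambda>n. p (?M n c))" for c
    by (auto intro!: decseq_SucI)
  have "\<exists>l. (\<lambda>n. p (?M n c)) \<longlonglongrightarrow> l" for c
    using decseq_convergent[OF dec, of 0 c] by auto
  then obtain q where q: "\<And>c. (\<lambda>n. p (?M n c)) \<longlonglongrightarrow> q c" by metis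
  \<comment> \<open>An even power splits over a product: \<open>b^(2n) a c\<close> is
    \<open>b^n a\<close> times \<open>b^n c\<close>. This carries the product axioms from
    \<open>p\<close> to \<open>q\<close>.\<close>
  have q2: "(\<lambda>n. p (?M (n + n) c)) \<longlonglongrightarrow> q c" for c
    using LIMSEQ_subseq_LIMSEQ[OF q, of "\<lambda>n. n + n" c]
    by (auto simp: strict_mono_def o_def)
  have q_le: "q c \<le> p (?M n c)" for c n
    by (rule decseq_ge[OF dec q])
  have "cstar_seminorm q"
  proof
    fix a c :: 'a and z :: complex
    show "q (a + c) \<le> q a + q c"
      by (rule LIMSEQ_le[OF q tendsto_add[OF q q]]) (auto simp: funpow_mult_add triangle)
    show "q (z *\<^sub>C a) = cmod z * q a"
      using tendsto_mult_left[OF q, of "cmod z"] q[of "z *\<^sub>C a"]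
      by (simp add: funpow_mult_scaleC scale LIMSEQ_unique)
    show "q (a * c) \<le> q a * q c"
      by (rule LIMSEQ_le[OF q2 tendsto_mult[OF q q]]) (auto simp: funpow_mult_mult submult)
    have "p (?M (n + n) (star a * a)) = (p (?M n a))\<^sup>2" for n
      using cstar[of "?M n a"] b by (simp add: funpow_mult_mult star_funpow_mult)
    thus "q (star a * a) = (q a)\<^sup>2"
      using q2[of "star a * a"] tendsto_power[OF q, of a 2] by (simp add: LIMSEQ_unique)
  qed
  moreover have "q x = 1" using q[of x] bx by (simp add: LIMSEQ_const_iff)
  moreover have "q \<le> p" using q_le[of _ 0] by (simp add: le_fun_def)
  ultimately have "q = p" by (rule minimal)
  \<comment> \<open>The limit \<open>q a\<close> lies below every term, in particular below
    \<open>p (b * a)\<close>, while minimality makes it equal to \<open>p a\<close>.\<close>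
  hence "p a \<le> p (b * a)" using q_le[of a 1] by simp
  thus ?thesis using step[of a] by simp
qed

text \<open>Repeated squaring and the C*-identity settle the exponents \<open>2^k\<close>;
  monotonicity settles those in between.\<close>

lemma unimodular_powers:
  assumes b: "star b = b" "p b = 1"
  shows "p (((*) b ^^ n) b) = 1"
proof -
  have step: "p (b * c) \<le> p c" for c using submult[of b c] b by simp
  hence dec: "decseq (\<lambda>n. p (((*) b ^^ n) b))"
    by (auto intro!: decseq_SucI)
  \<comment> \<open>The \<open>n\<close>-th iterate applied to \<open>b\<close> is
    \<open>b^(n+1)\<close>, hence the shift to \<open>2^k - 1\<close>.\<close>
  have "p (((*) b ^^ (2 ^ k - 1)) b) = 1" for k
  proof (induction k)
    case (Suc k)
    let ?m = "2 ^ k - 1 :: nat"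
    have "(1::nat) \<le> 2 ^ k" by simp
    hence "2 ^ Suc k - 1 = Suc (?m + ?m)" unfolding power_Suc by linarith
    moreover have "((*) b ^^ Suc (?m + ?m)) b = ((*) b ^^ ?m) b * ((*) b ^^ ?m) b"
      by (simp add: funpow_mult_mult[symmetric] funpow_swap1)
    ultimately show ?case
      using selfadjoint_square[of "((*) b ^^ ?m) b"] Suc b by (simp add: star_funpow_mult)
  qed (simp add: b)
  moreover have "n \<le> 2 ^ n - 1" using less_exp[of n] by linarith
  ultimately have "1 \<le> p (((*) b ^^ n) b)" using decseqD[OF dec, of n "2 ^ n - 1"] by metis
  moreover have "p (((*) b ^^ n) b) \<le> 1" using decseqD[OF dec, of 0 n] b by simp
  ultimately show ?thesis by simp
qed

text \<open>The auxiliary lemma, applied first with \<open>x\<close> in place of \<open>b\<close>,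
  shows that multiplication by \<open>x\<close> preserves \<open>p\<close>. Hence all
  \<open>b^n x\<close> have seminorm 1, which is its hypothesis for \<open>b\<close> itself.\<close>

lemma mult_unimodular:
  assumes b: "star b = b" "p b = 1"
  shows "p (b * a) = p a"
proof (rule mult_unimodular_aux[OF b])
  have x: "p (c * x) = p c" for c
    by (subst mult.commute) (intro mult_unimodular_aux sa_x p_x unimodular_powers)
  show "p (((*) b ^^ n) x) = 1" for n
  proof (cases n)
    case (Suc m)
    have "((*) b ^^ n) x = ((*) b ^^ m) b * x"
      by (simp only: Suc funpow_Suc_right o_apply funpow_mult_left)
    thus ?thesis using x unimodular_powers[OF b] by simp
  qed (simp add: p_x)
qed

lemma mult_selfadjoint:
  assumes b: "star b = b"
  shows "p (b * a) = p b * p a"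
proof (cases "p b = 0")
  case True
  thus ?thesis using submult[of b a] nonneg[of "b * a"] by simp
next
  case False
  have "p (((1 / p b) *\<^sub>R b) * a) = p a"
    using False b by (intro mult_unimodular) (auto simp: star_scaleR scaleR)
  thus ?thesis using False by (simp add: scaleR field_simps)
qed

text \<open>The C*-identity turns the square of \<open>p (a * b)\<close> into the seminorm of a
  product of self-adjoint elements.\<close>

sublocale multiplicative_cstar_seminorm
proof
  fix a b
  have "(p (a * b))\<^sup>2 = p ((star b * b) * (star a * a))"
    using cstar[of "a * b"] by (simp add: star_mult algebra_simps)
  also have "\<dots> = (p a * p b)\<^sup>2"
    by (subst mult_selfadjoint)
       (simp_all add: star_mult star_star cstar power_mult_distrib)
  finally show "p (a * b) = p a * p b" by (simp add: power2_eq_iff_nonneg)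
qed (fact sa_x p_x)+

end

section \<open>Characters from multiplicative C*-seminorms\<close>

context multiplicative_cstar_seminorm
begin

text \<open>For self-adjoint \<open>h\<close> and \<open>y = h / p h\<close> the squares of
  \<open>y\<close> and \<open>x\<close> agree modulo the kernel, so
  \<open>p (y - x) * p (y + x) = 0\<close> and \<open>h\<close> is plus or minus \<open>p h\<close>
  times \<open>x\<close>.\<close>

lemma scalar_modulo_kernel: "\<exists>c. p (a - c *\<^sub>C x) = 0"
proof -
  have real: "\<exists>r. p (h - r *\<^sub>R x) = 0" if h: "star h = h" for h
  proof (cases "p h = 0")
    case True
    thus ?thesis by (intro exI[of _ 0]) simp
  next
    case False
    define y where "y = (1 / p h) *\<^sub>R h"
    have y: "star y = y" "p y = 1" using False h by (simp_all add: y_def star_scaleR scaleR)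
    have "p (y * y - x * x) = 0"
      using y sa_x p_x by (intro squares_agree[of "y * y" y "x * x" x]) (auto simp: mult)
    hence "p (y - x) * p (y + x) = 0" by (simp add: algebra_simps flip: mult)
    moreover have "h = p h *\<^sub>R y" using False by (simp add: y_def)
    moreover have "p (p h *\<^sub>R y - p h *\<^sub>R x) = p h * p (y - x)"
      "p (p h *\<^sub>R y - (- p h) *\<^sub>R x) = p h * p (y + x)"
      using scaleR[of "p h" "y - x"] scaleR[of "p h" "y + x"]
      by (simp_all add: scaleR_diff_right scaleR_add_right)
    ultimately show ?thesis by (metis mult_eq_0_iff mult_zero_right)
  qed
  obtain h k where hk: "star h = h" "star k = k" "a = h + \<i> *\<^sub>C k"
    by (rule selfadjoint_decomposition)
  obtain r s where rs: "p (h - r *\<^sub>R x) = 0" "p (k - s *\<^sub>R x) = 0" using real hk by metis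
  let ?c = "of_real r + \<i> * of_real s"
  have "a - ?c *\<^sub>C x = (h - r *\<^sub>R x) + \<i> *\<^sub>C (k - s *\<^sub>R x)"
    by (simp add: hk scaleR_scaleC scaleC_add_left scaleC_diff_right scaleC_scaleC)
  hence "p (a - ?c *\<^sub>C x) \<le> p (h - r *\<^sub>R x) + p (\<i> *\<^sub>C (k - s *\<^sub>R x))" using triangle by metis
  hence "p (a - ?c *\<^sub>C x) \<le> 0" using rs by (simp add: scale)
  thus ?thesis using nonneg[of "a - ?c *\<^sub>C x"] by (intro exI[of _ ?c]) simp
qed

text \<open>Let \<open>l a\<close> be the coefficient of \<open>a\<close> along \<open>x\<close>
  modulo the kernel. If \<open>x^2\<close> is \<open>e x\<close> there, then \<open>l\<close> is
  multiplicative up to the factor \<open>e\<close>, so \<open>e * l\<close> is a character;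
  comparing seminorms gives \<open>|e| = 1\<close>.\<close>

lemma exists_character_unimodular: "\<exists>\<phi>\<in>characters. cmod (\<phi> x) = 1"
proof -
  obtain l where l: "\<And>a. p (a - l a *\<^sub>C x) = 0" using scalar_modulo_kernel by metis
  have add0: "p (a + b) = 0" if "p a = 0" "p b = 0" for a b
    using triangle[of a b] nonneg[of "a + b"] that by simp
  have uniq: "l a = c" if "p (a - c *\<^sub>C x) = 0" for a c
  proof -
    have "p ((a - c *\<^sub>C x) + - (a - l a *\<^sub>C x)) = 0" by (intro add0) (simp_all only: that l minus)
    also have "(a - c *\<^sub>C x) + - (a - l a *\<^sub>C x) = (l a + (- c)) *\<^sub>C x"
      by (simp only: scaleC_add_left scaleC_minus_left) simp
    finally show ?thesis by (simp add: scale p_x eq_neg_iff_add_eq_0[symmetric])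
  qed
  define e where "e = l (x * x)"
  have l_add: "l (a + b) = l a + l b" for a b
    using add0[OF l[of a] l[of b]] by (intro uniq) (simp add: scaleC_add_left algebra_simps)
  have l_scale: "l (c *\<^sub>C a) = c * l a" for c a
    using l[of a] scale[of c "a - l a *\<^sub>C x"]
    by (intro uniq) (simp add: scaleC_diff_right scaleC_scaleC)
  have l_mult: "l (a * b) = e * l a * l b" for a b
  proof (rule uniq)
    have "a * b - (e * l a * l b) *\<^sub>C x
      = (a - l a *\<^sub>C x) * b + ((b - l b *\<^sub>C x) * (l a *\<^sub>C x) + (l a * l b) *\<^sub>C (x * x - e *\<^sub>C x))"
      by (simp add: algebra_simps mult_scaleC_left mult_scaleC_right scaleC_scaleC scaleC_diff_right)
    also have "p \<dots> = 0"
      by (intro add0) (simp_all add: mult scale l e_def)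
    finally show "p (a * b - (e * l a * l b) *\<^sub>C x) = 0" .
  qed
  have e: "cmod e = 1"
  proof -
    have "p (x * x) \<le> p (x * x - e *\<^sub>C x) + p (e *\<^sub>C x)" "p (e *\<^sub>C x) \<le> p (e *\<^sub>C x - x * x) + p (x * x)"
      using triangle[of "x * x - e *\<^sub>C x" "e *\<^sub>C x"] triangle[of "e *\<^sub>C x - x * x" "x * x"] by simp_all
    thus ?thesis using l[of "x * x"] diff_commute[of "x * x" "e *\<^sub>C x"]
      by (simp add: e_def scale mult p_x)
  qed
  have lx: "l x = 1" by (rule uniq) simp
  define \<phi> where "\<phi> a = e * l a" for a
  have "\<phi> \<in> characters"
    using e lx unfolding characters_def \<phi>_def
    by (auto simp: l_add l_scale l_mult algebra_simps intro!: exI[of _ x])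
  thus ?thesis using e lx by (intro bexI[of _ \<phi>]) (auto simp: \<phi>_def norm_mult)
qed

end

lemma exists_character_norming_selfadjoint:
  fixes x :: "'a::{cstar_algebra,comm_ring}"
  assumes "star x = x" "norm x = 1"
  shows "\<exists>\<phi>\<in>characters. cmod (\<phi> x) = 1"
proof -
  from exists_minimal_cstar_seminorm[OF assms] obtain p where "minimal_cstar_seminorm p x" ..
  then interpret minimal_cstar_seminorm p x .
  show ?thesis by (rule exists_character_unimodular)
qed

section \<open>Characters\<close>

lemma
  assumes "\<phi> \<in> characters"
  shows character_add: "\<phi> (x + y) = \<phi> x + \<phi> y"
    and character_mult: "\<phi> (x * y) = \<phi> x * \<phi> y"
    and character_scaleC: "\<phi> (c *\<^sub>C x) = c * \<phi> x"
    and character_nonzero: "\<exists>x. \<phi> x \<noteq> 0"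
  using assms by (auto simp: characters_def)

lemma character_zero: "\<phi> \<in> characters \<Longrightarrow> \<phi> 0 = 0"
  using character_scaleC[of \<phi> 0 0] by simp

lemma character_minus: "\<phi> \<in> characters \<Longrightarrow> \<phi> (- x) = - \<phi> x"
  using character_scaleC[of \<phi> "-1" x] by simp

lemma character_diff: "\<phi> \<in> characters \<Longrightarrow> \<phi> (x - y) = \<phi> x - \<phi> y"
  using character_add[of \<phi> x "- y"] character_minus[of \<phi> y] by simp

lemma character_scaleR: "\<phi> \<in> characters \<Longrightarrow> \<phi> (r *\<^sub>R x) = of_real r * \<phi> x"
  by (simp add: scaleR_scaleC character_scaleC)

lemma character_sum: "\<phi> \<in> characters \<Longrightarrow> \<phi> (sum f A) = (\<Sum>i\<in>A. \<phi> (f i))"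
  by (induction A rule: infinite_finite_induct) (auto simp: character_add character_zero)

lemmas character_simps = character_add character_mult character_scaleC character_zero
  character_minus character_diff character_scaleR character_sum

lemma banach_fixed_point:
  fixes f :: "'a::banach \<Rightarrow> 'a"
  assumes "0 \<le> c" "c < 1" "\<And>x y. norm (f x - f y) \<le> c * norm (x - y)"
  obtains y where "f y = y"
  using banach_fix_type[of c f] assms by (auto simp: dist_norm)

text \<open>If \<open>\<phi>\<close> takes the value 1 at \<open>y\<close> with \<open>norm y < 1\<close>, then the fixed point of \<open>z \<mapsto> y + y z\<close>
  has no value under \<open>\<phi>\<close>.\<close>

lemma character_norm_le:
  fixes x :: "'a::{cstar_algebra,comm_ring}"
  assumes \<phi>: "\<phi> \<in> characters"
  shows "cmod (\<phi> x) \<le> norm x"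
proof (rule ccontr)
  assume "\<not> ?thesis"
  hence less: "norm x < cmod (\<phi> x)" by simp
  hence nz: "\<phi> x \<noteq> 0" using norm_ge_zero[of x] by (metis norm_zero not_less)
  define y where "y = inverse (\<phi> x) *\<^sub>C x"
  have "norm y = norm x / cmod (\<phi> x)"
    by (simp add: y_def norm_scaleC norm_inverse divide_inverse mult.commute)
  hence "norm y < 1" using less nz by simp
  then obtain z where z: "y + y * z = z"
    by (rule banach_fixed_point[of "norm y" "\<lambda>z. y + y * z", rotated])
       (auto simp: norm_mult_ineq simp flip: right_diff_distrib)
  have "\<phi> y = 1" using nz by (simp add: y_def character_simps[OF \<phi>])
  thus False using arg_cong[OF z, of \<phi>] by (simp add: character_simps[OF \<phi>])
qed

text \<open>For \<open>\<phi> h = \<lambda>\<close> not real, \<open>h y - \<lambda> y = h\<close> would have a solution \<open>y\<close>: this is the fixed point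
  equation below, where \<open>s\<close> is so large that \<open>norm (h + is) = \<surd>(norm h\<^sup>2 + s\<^sup>2) < cmod (\<lambda> + is)\<close>.\<close>

lemma character_selfadjoint_real:
  fixes h :: "'a::{cstar_algebra,comm_ring}"
  assumes \<phi>: "\<phi> \<in> characters" and h: "star h = h"
  shows "Im (\<phi> h) = 0"
proof (rule ccontr)
  assume im: "Im (\<phi> h) \<noteq> 0"
  define l where "l = \<phi> h"
  \<comment> \<open>This choice makes the cross term \<open>2 s Im l\<close> of
    \<open>|l + i s|^2\<close> equal to \<open>2 (norm h)^2\<close>, which covers the
    \<open>(norm h)^2\<close> to be beaten; strictness comes from \<open>Im l\<close> being
    nonzero.\<close>
  define s where "s = (norm h)\<^sup>2 / Im l"
  define m where "m = l + \<i> * of_real s"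
  have "(norm h)\<^sup>2 + s\<^sup>2 < (cmod m)\<^sup>2"
  proof -
    have "(cmod m)\<^sup>2 = (Re l)\<^sup>2 + (Im l + s)\<^sup>2" by (simp add: m_def cmod_power2)
    also have "\<dots> = (Re l)\<^sup>2 + (Im l)\<^sup>2 + 2 * (norm h)\<^sup>2 + s\<^sup>2"
      using im by (simp add: s_def l_def power2_eq_square algebra_simps)
    finally show ?thesis using im by (simp add: l_def add_nonneg_pos add_pos_nonneg)
  qed
  hence less: "sqrt ((norm h)\<^sup>2 + s\<^sup>2) < cmod m" by (intro real_less_lsqrt) auto
  define T where "T y = inverse m *\<^sub>C (h * y + (\<i> * of_real s) *\<^sub>C y - h)" for y
  define k where "k = sqrt ((norm h)\<^sup>2 + s\<^sup>2) / cmod m"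
  have "0 \<le> sqrt ((norm h)\<^sup>2 + s\<^sup>2)" by simp
  hence mpos: "0 < cmod m" using less by linarith
  have k: "0 \<le> k" "k < 1" using less mpos by (auto simp: k_def)
  \<comment> \<open>The cross terms of \<open>star ?w * ?w\<close> cancel because \<open>h\<close>
    is self-adjoint and \<open>i s\<close> is skew; the triangle inequality alone would give only
    \<open>norm h + |s|\<close>.\<close>
  have bound: "norm (h * z + (\<i> * of_real s) *\<^sub>C z) \<le> sqrt ((norm h)\<^sup>2 + s\<^sup>2) * norm z" for z
  proof (rule power2_le_imp_le)
    let ?w = "h * z + (\<i> * of_real s) *\<^sub>C z"
    have "(norm ?w)\<^sup>2 = norm (star ?w * ?w)" by (simp add: cstar_identity)
    also have "star ?w * ?w = (h * h) * (star z * z) + (s\<^sup>2) *\<^sub>R (star z * z)"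
      by (simp add: star_add star_mult star_scaleC h mult_scaleC_left mult_scaleC_right scaleC_scaleC
          scaleR_scaleC algebra_simps power2_eq_square)
    also have "norm \<dots> \<le> norm (h * h) * norm (star z * z) + s\<^sup>2 * norm (star z * z)"
      by (intro norm_triangle_le add_mono norm_mult_ineq) simp
    also have "\<dots> = ((norm h)\<^sup>2 + s\<^sup>2) * (norm z)\<^sup>2"
      using cstar_identity[of h] cstar_identity[of z] h by (simp add: algebra_simps)
    finally show "(norm ?w)\<^sup>2 \<le> (sqrt ((norm h)\<^sup>2 + s\<^sup>2) * norm z)\<^sup>2"
      by (simp add: power_mult_distrib)
  qed simp
  have "norm (T y - T z) \<le> k * norm (y - z)" for y z
  proof -
    have eq: "T y - T z = inverse m *\<^sub>C (h * (y - z) + (\<i> * of_real s) *\<^sub>C (y - z))"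
      by (simp add: T_def algebra_simps scaleC_diff_right scaleC_add_right)
    have "norm (T y - T z) = norm (h * (y - z) + (\<i> * of_real s) *\<^sub>C (y - z)) / cmod m"
      unfolding eq norm_scaleC norm_inverse by (simp add: divide_inverse mult.commute)
    thus ?thesis using bound[of "y - z"] mpos by (simp add: k_def divide_right_mono)
  qed
  with k obtain y where y: "T y = y" by (rule banach_fixed_point)
  have "m *\<^sub>C T y = h * y + (\<i> * of_real s) *\<^sub>C y - h"
    using mpos by (simp add: T_def scaleC_scaleC)
  hence "m *\<^sub>C y = h * y + (\<i> * of_real s) *\<^sub>C y - h" unfolding y .
  from arg_cong[OF this, of \<phi>] have "l = 0"
    by (simp add: character_simps[OF \<phi>] m_def l_def algebra_simps)
  thus False using im by (simp add: l_def)
qed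

lemma character_star:
  fixes x :: "'a::{cstar_algebra,comm_ring}"
  assumes \<phi>: "\<phi> \<in> characters"
  shows "\<phi> (star x) = cnj (\<phi> x)"
proof -
  obtain h k where hk: "star h = h" "star k = k" "x = h + \<i> *\<^sub>C k"
    by (rule selfadjoint_decomposition)
  have "cnj (\<phi> h) = \<phi> h" "cnj (\<phi> k) = \<phi> k"
    using character_selfadjoint_real[OF \<phi>] hk by (simp_all add: complex_eq_iff)
  thus ?thesis using hk by (simp add: star_add star_scaleC character_simps[OF \<phi>])
qed

lemma character_star_self:
  fixes x :: "'a::{cstar_algebra,comm_ring}"
  assumes \<phi>: "\<phi> \<in> characters"
  shows "\<phi> (star x * x) = of_real ((cmod (\<phi> x))\<^sup>2)"
  by (simp only: character_mult[OF \<phi>] character_star[OF \<phi>] complex_norm_square mult.commute)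

text \<open>The self-adjoint case is applied to \<open>star x * x\<close> scaled to norm 1, where a
  character takes the square of its modulus at \<open>x\<close>, up to the scaling.\<close>

lemma exists_norming_character:
  fixes x :: "'a::{cstar_algebra,comm_ring}"
  assumes "x \<noteq> 0"
  shows "\<exists>\<phi>\<in>characters. cmod (\<phi> x) = norm x"
proof -
  define y where "y = (1 / (norm x)\<^sup>2) *\<^sub>R (star x * x)"
  have "star y = y" "norm y = 1"
    using assms by (simp_all add: y_def star_scaleR star_mult star_star cstar_identity)
  then obtain \<phi> where \<phi>: "\<phi> \<in> characters" "cmod (\<phi> y) = 1"
    using exists_character_norming_selfadjoint by blast
  have "cmod (\<phi> y) = (cmod (\<phi> x))\<^sup>2 / (norm x)\<^sup>2"
    unfolding y_def character_scaleR[OF \<phi>(1)] character_star_self[OF \<phi>(1)]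
    by (simp add: norm_mult norm_divide norm_power)
  hence "(cmod (\<phi> x))\<^sup>2 = (norm x)\<^sup>2" using \<phi>(2) assms by (simp add: field_simps)
  thus ?thesis using \<phi>(1) by (auto simp: power2_eq_iff_nonneg)
qed

lemma norm_le_by_characters:
  fixes x :: "'a::{cstar_algebra,comm_ring}"
  assumes "0 \<le> M" "\<And>\<phi>. \<phi> \<in> characters \<Longrightarrow> cmod (\<phi> x) \<le> M"
  shows "norm x \<le> M"
proof (cases "x = 0")
  case False
  thus ?thesis using exists_norming_character[of x] assms(2) by fastforce
qed (simp add: assms)

lemma eq_by_characters:
  fixes x y :: "'a::{cstar_algebra,comm_ring}"
  assumes "\<And>\<phi>. \<phi> \<in> characters \<Longrightarrow> \<phi> x = \<phi> y"
  shows "x = y"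
proof -
  have "norm (x - y) \<le> 0"
    by (rule norm_le_by_characters) (simp_all add: character_diff assms)
  thus ?thesis by simp
qed

lemma exists_nonvanishing_character:
  fixes x :: "'a::{cstar_algebra,comm_ring}"
  assumes "x \<noteq> 0"
  shows "\<exists>\<phi>\<in>characters. \<phi> x \<noteq> 0"
  using exists_norming_character[OF assms] assms by (metis norm_eq_zero)

subsection \<open>Closed ideals\<close>

lemma
  assumes "closed_ideal I"
  shows closed_ideal_closed: "closed I"
    and closed_ideal_zero: "0 \<in> I"
    and closed_ideal_add: "x \<in> I \<Longrightarrow> y \<in> I \<Longrightarrow> x + y \<in> I"
    and closed_ideal_scaleC: "x \<in> I \<Longrightarrow> c *\<^sub>C x \<in> I"
    and closed_ideal_mult_left: "x \<in> I \<Longrightarrow> a * x \<in> I"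
    and closed_ideal_mult_right: "x \<in> I \<Longrightarrow> x * a \<in> I"
  using assms unfolding closed_ideal_def complex_subspace_def by blast+

lemma closed_ideal_scaleR: "closed_ideal I \<Longrightarrow> x \<in> I \<Longrightarrow> r *\<^sub>R x \<in> I"
  by (simp add: scaleR_scaleC closed_ideal_scaleC)

lemma closed_ideal_minus: "closed_ideal I \<Longrightarrow> x \<in> I \<Longrightarrow> - x \<in> I"
  using closed_ideal_scaleC[of I x "-1"] by simp

lemma closed_ideal_diff: "closed_ideal I \<Longrightarrow> x \<in> I \<Longrightarrow> y \<in> I \<Longrightarrow> x - y \<in> I"
  using closed_ideal_add[of I x "- y"] closed_ideal_minus[of I y] by simp

lemma closed_ideal_UNIV: "closed_ideal UNIV"
  by (simp add: closed_ideal_def complex_subspace_def)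

lemma closed_ideal_Int: "closed_ideal I \<Longrightarrow> closed_ideal J \<Longrightarrow> closed_ideal (I \<inter> J)"
  by (auto simp: closed_ideal_def complex_subspace_def)

lemma closed_idealI:
  fixes I :: "'a::{cstar_algebra,comm_ring} set"
  assumes "closed I" "0 \<in> I" "\<And>x y. x \<in> I \<Longrightarrow> y \<in> I \<Longrightarrow> x + y \<in> I"
    "\<And>c x. x \<in> I \<Longrightarrow> c *\<^sub>C x \<in> I" "\<And>a x. x \<in> I \<Longrightarrow> a * x \<in> I"
  shows "closed_ideal I"
  using assms by (simp add: closed_ideal_def complex_subspace_def mult.commute)

lemma closed_ideal_vanishing:
  fixes V :: "('a::{cstar_algebra,comm_ring} \<Rightarrow> complex) set"
  assumes "V \<subseteq> characters"
  shows "closed_ideal {f. \<forall>\<phi>\<in>V. \<phi> f = 0}"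
proof -
  have "closed {f. \<phi> f = 0}" if "\<phi> \<in> characters" for \<phi> :: "'a \<Rightarrow> complex"
    unfolding closed_sequential_limits
  proof (intro allI impI, elim conjE)
    fix X l assume X: "\<forall>n. X n \<in> {f. \<phi> f = 0}" and l: "X \<longlonglongrightarrow> l"
    have "cmod (\<phi> l) \<le> norm (X n - l)" for n
      using character_norm_le[OF that, of "X n - l"] X that by (simp add: character_diff)
    moreover have "(\<lambda>n. norm (X n - l)) \<longlonglongrightarrow> 0"
      using tendsto_norm[OF LIM_zero[OF l]] by simp
    ultimately have "cmod (\<phi> l) \<le> 0" by (intro LIMSEQ_le_const) auto
    thus "l \<in> {f. \<phi> f = 0}" by simp
  qed
  hence "closed (\<Inter>\<phi>\<in>V. {f. \<phi> f = 0})" using assms by (intro closed_INT) auto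
  moreover have "(\<Inter>\<phi>\<in>V. {f. \<phi> f = 0}) = {f. \<forall>\<phi>\<in>V. \<phi> f = 0}" by auto
  ultimately have closed: "closed {f. \<forall>\<phi>\<in>V. \<phi> f = 0}" by simp
  show ?thesis
  proof (rule closed_idealI[OF closed]; intro CollectI ballI)
    fix \<phi> x y a c assume V: "\<phi> \<in> V"
    note \<phi> = subsetD[OF assms V]
    show "\<phi> 0 = 0" by (rule character_zero[OF \<phi>])
    assume "x \<in> {f. \<forall>\<phi>\<in>V. \<phi> f = 0}"
    hence x: "\<phi> x = 0" using V by blast
    thus "\<phi> (c *\<^sub>C x) = 0" "\<phi> (a * x) = 0" by (simp_all add: character_simps[OF \<phi>])
    assume "y \<in> {f. \<forall>\<phi>\<in>V. \<phi> f = 0}"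
    hence "\<phi> y = 0" using V by blast
    thus "\<phi> (x + y) = 0" using x by (simp add: character_simps[OF \<phi>])
  qed
qed

subsection \<open>Functional calculus\<close>

lemma real_polynomial_calculus:
  fixes w :: "'a::{cstar_algebra,comm_ring}"
  assumes I: "closed_ideal I" and w: "w \<in> I" "\<forall>\<phi>\<in>characters. Im (\<phi> w) = 0"
    and "real_polynomial_function g"
  shows "\<exists>v\<in>I. \<forall>\<phi>\<in>characters. \<phi> v = of_real (g (Re (\<phi> w)) - g 0)"
  using assms(4)
proof (induction g rule: real_polynomial_function.induct)
  case (linear f)
  then interpret bounded_linear f .
  have f: "f r = r * f 1" for r using scaleR[of r 1] by simp
  show ?case
  proof (intro bexI ballI)
    fix \<phi> :: "'a \<Rightarrow> complex" assume \<phi>: "\<phi> \<in> characters"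
    have "\<phi> (f 1 *\<^sub>R w) = of_real (Re (\<phi> w) * f 1)"
      using bspec[OF w(2) \<phi>] by (simp add: character_scaleR[OF \<phi>] complex_eq_iff)
    thus "\<phi> (f 1 *\<^sub>R w) = of_real (f (Re (\<phi> w)) - f 0)" by (simp add: zero flip: f)
  qed (rule closed_ideal_scaleR[OF I w(1)])
next
  case (const c)
  show ?case
  proof (intro bexI ballI)
    fix \<phi> :: "'a \<Rightarrow> complex" assume \<phi>: "\<phi> \<in> characters"
    show "\<phi> 0 = of_real (c - c)" by (simp add: character_zero[OF \<phi>])
  qed (rule closed_ideal_zero[OF I])
next
  case (add f g)
  then obtain u v where uv: "u \<in> I" "v \<in> I"
    "\<forall>\<phi>\<in>characters. \<phi> u = of_real (f (Re (\<phi> w)) - f 0)"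
    "\<forall>\<phi>\<in>characters. \<phi> v = of_real (g (Re (\<phi> w)) - g 0)" by blast
  show ?case
  proof (intro bexI ballI)
    fix \<phi> :: "'a \<Rightarrow> complex" assume \<phi>: "\<phi> \<in> characters"
    show "\<phi> (u + v) = of_real (f (Re (\<phi> w)) + g (Re (\<phi> w)) - (f 0 + g 0))"
      by (simp only: character_add[OF \<phi>] bspec[OF uv(3) \<phi>] bspec[OF uv(4) \<phi>]) simp
  qed (rule closed_ideal_add[OF I uv(1,2)])
next
  case (mult f g)
  then obtain u v where uv: "u \<in> I" "v \<in> I"
    "\<forall>\<phi>\<in>characters. \<phi> u = of_real (f (Re (\<phi> w)) - f 0)"
    "\<forall>\<phi>\<in>characters. \<phi> v = of_real (g (Re (\<phi> w)) - g 0)" by blast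
  show ?case
  proof (intro bexI ballI)
    fix \<phi> :: "'a \<Rightarrow> complex" assume \<phi>: "\<phi> \<in> characters"
    show "\<phi> (u * v + (g 0 *\<^sub>R u + f 0 *\<^sub>R v)) = of_real (f (Re (\<phi> w)) * g (Re (\<phi> w)) - f 0 * g 0)"
      by (simp only: character_simps[OF \<phi>] bspec[OF uv(3) \<phi>] bspec[OF uv(4) \<phi>])
         (simp add: algebra_simps)
  next
    show "u * v + (g 0 *\<^sub>R u + f 0 *\<^sub>R v) \<in> I"
      by (intro closed_ideal_add[OF I] closed_ideal_scaleR[OF I] closed_ideal_mult_left[OF I] uv(1,2))
  qed
qed

text \<open>Weierstrass approximation on an interval containing all values of \<open>w\<close>.
  Uniform closeness at characters is closeness in norm, so the approximants converge, and the limit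
  stays in the closed ideal.\<close>

lemma continuous_calculus:
  fixes w :: "'a::{cstar_algebra,comm_ring}" and g :: "real \<Rightarrow> real"
  assumes I: "closed_ideal I" and w: "w \<in> I" "\<forall>\<phi>\<in>characters. Im (\<phi> w) = 0"
    and g: "continuous_on UNIV g" "g 0 = 0"
  obtains v where "v \<in> I" "\<And>\<phi>. \<phi> \<in> characters \<Longrightarrow> \<phi> v = of_real (g (Re (\<phi> w)))"
proof -
  let ?S = "{- norm w .. norm w}"
  have in_S: "Re (\<phi> w) \<in> ?S" if "\<phi> \<in> characters" for \<phi>
    using order_trans[OF abs_Re_le_cmod character_norm_le[OF that, of w]] by (auto simp: abs_le_iff)
  have "\<exists>v\<in>I. \<forall>\<phi>\<in>characters. cmod (\<phi> v - of_real (g (Re (\<phi> w)))) \<le> e" if e: "0 < e" for e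
  proof -
    \<comment> \<open>One half of \<open>e\<close> pays for approximating \<open>g\<close>, the
      other for subtracting \<open>q 0\<close>, which is close to \<open>g 0 = 0\<close>.\<close>
    obtain q where q: "real_polynomial_function q" "\<And>r. r \<in> ?S \<Longrightarrow> \<bar>g r - q r\<bar> < e / 2"
      by (rule Stone_Weierstrass_real_polynomial_function[of ?S g "e / 2"])
         (use e continuous_on_subset[OF g(1)] in simp_all)
    obtain v where v: "v \<in> I" "\<forall>\<phi>\<in>characters. \<phi> v = of_real (q (Re (\<phi> w)) - q 0)"
      using real_polynomial_calculus[OF I w q(1)] by blast
    have "cmod (\<phi> v - of_real (g (Re (\<phi> w)))) \<le> e" if "\<phi> \<in> characters" for \<phi>
    proof -
      have "\<phi> v - of_real (g (Re (\<phi> w))) = of_real (q (Re (\<phi> w)) - q 0 - g (Re (\<phi> w)))"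
        using v that by simp
      hence "cmod (\<phi> v - of_real (g (Re (\<phi> w)))) = \<bar>q (Re (\<phi> w)) - q 0 - g (Re (\<phi> w))\<bar>"
        by (simp only: norm_of_real)
      moreover have "\<bar>g 0 - q 0\<bar> < e / 2" by (rule q(2)) simp
      hence "\<bar>q (Re (\<phi> w)) - q 0 - g (Re (\<phi> w))\<bar> \<le> e"
        using q(2)[OF in_S[OF that]] g(2) by linarith
      ultimately show ?thesis by simp
    qed
    thus ?thesis using v by blast
  qed
  hence "\<forall>n. \<exists>v. v \<in> I \<and> (\<forall>\<phi>\<in>characters. cmod (\<phi> v - of_real (g (Re (\<phi> w)))) \<le> 1 / real (Suc n))"
    by (auto simp: Bex_def)
  then obtain V where V: "\<And>n. V n \<in> I"
    "\<And>n \<phi>. \<phi> \<in> characters \<Longrightarrow> cmod (\<phi> (V n) - of_real (g (Re (\<phi> w)))) \<le> 1 / real (Suc n)"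
    by metis
  have VV: "norm (V m - V n) \<le> 1 / real (Suc m) + 1 / real (Suc n)" for m n
  proof (rule norm_le_by_characters)
    fix \<phi> :: "'a \<Rightarrow> complex" assume \<phi>: "\<phi> \<in> characters"
    have "\<phi> (V m - V n) = (\<phi> (V m) - of_real (g (Re (\<phi> w)))) - (\<phi> (V n) - of_real (g (Re (\<phi> w))))"
      by (simp add: character_diff[OF \<phi>])
    also have "cmod \<dots> \<le> 1 / real (Suc m) + 1 / real (Suc n)"
      using norm_triangle_ineq4 V(2)[OF \<phi>] by (meson add_mono order_trans)
    finally show "cmod (\<phi> (V m - V n)) \<le> 1 / real (Suc m) + 1 / real (Suc n)" .
  qed auto
  have "Cauchy V"
    unfolding Cauchy_altdef2 dist_norm
  proof (intro allI impI)
    fix e :: real assume "0 < e"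
    then obtain N where N: "1 / real (Suc N) < e / 2"
      using reals_Archimedean[of "e / 2"] by (auto simp: inverse_eq_divide)
    have "norm (V n - V N) < e" if "n \<ge> N" for n
    proof -
      have "1 / real (Suc n) \<le> 1 / real (Suc N)" using that by (simp add: frac_le)
      thus ?thesis using VV[of n N] N by linarith
    qed
    thus "\<exists>N. \<forall>n\<ge>N. norm (V n - V N) < e" by blast
  qed
  then obtain v where lim: "V \<longlonglongrightarrow> v" using Cauchy_convergent_iff convergent_def by blast
  have "v \<in> I" using closed_ideal_closed[OF I] V(1) lim by (metis closed_sequentially)
  moreover have "\<phi> v = of_real (g (Re (\<phi> w)))" if \<phi>: "\<phi> \<in> characters" for \<phi>
  proof -
    have "cmod (of_real (g (Re (\<phi> w))) - \<phi> v) \<le> 1 / real (Suc n) + norm (V n - v)" for n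
    proof -
      have eq: "of_real (g (Re (\<phi> w))) - \<phi> v = \<phi> (V n - v) - (\<phi> (V n) - of_real (g (Re (\<phi> w))))"
        by (simp add: character_diff[OF \<phi>])
      show ?thesis unfolding eq
        using norm_triangle_ineq4[of "\<phi> (V n - v)" "\<phi> (V n) - of_real (g (Re (\<phi> w)))"]
          V(2)[OF \<phi>, of n] character_norm_le[OF \<phi>, of "V n - v"] by linarith
    qed
    moreover have "(\<lambda>n. 1 / real (Suc n) + norm (V n - v)) \<longlonglongrightarrow> 0 + 0"
      by (intro tendsto_add LIMSEQ_Suc[OF lim_1_over_n] tendsto_norm_zero LIM_zero lim)
    ultimately have "cmod (of_real (g (Re (\<phi> w))) - \<phi> v) \<le> 0 + 0"
      by (intro LIMSEQ_le_const) auto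
    thus ?thesis by simp
  qed
  ultimately show thesis by (rule that)
qed

lemma positive_element_character:
  fixes x :: "'a::{cstar_algebra,comm_ring}"
  assumes "positive_element x" "\<phi> \<in> characters"
  shows "\<phi> x = of_real (Re (\<phi> x))" "0 \<le> Re (\<phi> x)"
  using assms character_star_self[OF assms(2)] by (auto simp: positive_element_def)

lemma positive_element_iff:
  fixes x :: "'a::{cstar_algebra,comm_ring}"
  shows "positive_element x \<longleftrightarrow> (\<forall>\<phi>\<in>characters. Im (\<phi> x) = 0 \<and> 0 \<le> Re (\<phi> x))"
proof
  assume "positive_element x"
  thus "\<forall>\<phi>\<in>characters. Im (\<phi> x) = 0 \<and> 0 \<le> Re (\<phi> x)"
    using positive_element_character by (metis Im_complex_of_real)
next
  assume x: "\<forall>\<phi>\<in>characters. Im (\<phi> x) = 0 \<and> 0 \<le> Re (\<phi> x)"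
  obtain y where y: "\<And>\<phi>. \<phi> \<in> characters \<Longrightarrow> \<phi> y = of_real (sqrt \<bar>Re (\<phi> x)\<bar>)"
    by (rule continuous_calculus[OF closed_ideal_UNIV UNIV_I, where w = x and g = "\<lambda>r. sqrt \<bar>r\<bar>"])
       (use x in \<open>auto intro!: continuous_intros\<close>)
  have "x = star y * y"
  proof (rule eq_by_characters)
    fix \<phi> :: "'a \<Rightarrow> complex" assume \<phi>: "\<phi> \<in> characters"
    show "\<phi> x = \<phi> (star y * y)"
      unfolding character_star_self[OF \<phi>] using x \<phi> by (simp add: y complex_eq_iff)
  qed
  thus "positive_element x" by (auto simp: positive_element_def)
qed

lemma positive_element_star_mult: "positive_element (star x * x)"
  by (auto simp: positive_element_def)

subsection \<open>Separation\<close>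

text \<open>If \<open>k\<close> in the ideal is nonzero at \<open>\<phi>\<close> and
  \<open>a\<close> distinguishes the characters, then \<open>k a - \<psi>(a) k\<close> vanishes at
  \<open>\<psi>\<close> but not at \<open>\<phi>\<close>. Its normalized absolute square is the
  required element.\<close>

lemma separating_element:
  fixes \<phi> \<psi> :: "'a::{cstar_algebra,comm_ring} \<Rightarrow> complex"
  assumes I: "closed_ideal I" and \<phi>: "\<phi> \<in> open_support I" and \<psi>: "\<psi> \<in> characters" and "\<phi> \<noteq> \<psi>"
  obtains u where "u \<in> I" "positive_element u" "\<phi> u = 1" "\<psi> u = 0"
proof -
  obtain k where k: "\<phi> \<in> characters" "k \<in> I" "\<phi> k \<noteq> 0" using \<phi> by (auto simp: open_support_def)
  obtain a where a: "\<phi> a \<noteq> \<psi> a" using \<open>\<phi> \<noteq> \<psi>\<close> by auto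
  define v where "v = k * a - \<psi> a *\<^sub>C k"
  define c where "c = cmod (\<phi> v)"
  have "\<phi> v \<noteq> 0" using k a by (simp add: v_def character_simps[OF k(1)])
  hence c: "c > 0" by (simp add: c_def)
  have vI: "v \<in> I" unfolding v_def
    by (intro closed_ideal_diff[OF I] closed_ideal_mult_right[OF I] closed_ideal_scaleC[OF I] k(2))
  define y where "y = (1 / c) *\<^sub>R v"
  show thesis
  proof
    show "star y * y \<in> I" unfolding y_def
      by (intro closed_ideal_mult_left[OF I] closed_ideal_scaleR[OF I] vI)
    show "positive_element (star y * y)" by (rule positive_element_star_mult)
    have "cmod (\<phi> y) = 1"
      using c by (simp add: y_def character_scaleR[OF k(1)] norm_mult norm_divide c_def)
    thus "\<phi> (star y * y) = 1" unfolding character_star_self[OF k(1)] by simp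
    show "\<psi> (star y * y) = 0" unfolding character_star_self[OF \<psi>]
      by (simp add: y_def v_def character_simps[OF \<psi>])
  qed
qed

lemma open_support_UNIV: "open_support UNIV = characters"
  using character_nonzero by (auto simp: open_support_def)

text \<open>Take the positive and negative parts of \<open>u - v\<close>, where \<open>u\<close> is
  1 at \<open>\<phi>\<close> and 0 at \<open>\<psi>\<close>, and \<open>v\<close> conversely. This
  is the Hausdorff property in algebraic form.\<close>

lemma disjoint_separating_elements:
  fixes \<phi> \<psi> :: "'a::{cstar_algebra,comm_ring} \<Rightarrow> complex"
  assumes \<phi>: "\<phi> \<in> characters" and \<psi>: "\<psi> \<in> characters" and "\<phi> \<noteq> \<psi>"
  obtains p q where "p * q = 0" "\<phi> p \<noteq> 0" "\<psi> q \<noteq> 0"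
proof -
  obtain u where u: "positive_element u" "\<phi> u = 1" "\<psi> u = 0"
    using separating_element[OF closed_ideal_UNIV, of \<phi> \<psi>] assms by (auto simp: open_support_UNIV)
  obtain v where v: "positive_element v" "\<psi> v = 1" "\<phi> v = 0"
    using separating_element[OF closed_ideal_UNIV, of \<psi> \<phi>] assms by (auto simp: open_support_UNIV)
  have im: "\<forall>\<omega>\<in>characters. Im (\<omega> (u - v)) = 0"
    using u(1) v(1) by (simp add: character_diff positive_element_iff)
  obtain p where p: "\<And>\<omega>. \<omega> \<in> characters \<Longrightarrow> \<omega> p = of_real (max 0 (Re (\<omega> (u - v))))"
    by (rule continuous_calculus[OF closed_ideal_UNIV UNIV_I im, where g = "max 0"])
       (auto intro!: continuous_intros)
  obtain q where q: "\<And>\<omega>. \<omega> \<in> characters \<Longrightarrow> \<omega> q = of_real (max 0 (- Re (\<omega> (u - v))))"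
    by (rule continuous_calculus[OF closed_ideal_UNIV UNIV_I im, where g = "\<lambda>r. max 0 (- r)"])
       (auto intro!: continuous_intros)
  show thesis
  proof
    show "p * q = 0"
    proof (rule eq_by_characters)
      fix \<omega> :: "'a \<Rightarrow> complex" assume \<omega>: "\<omega> \<in> characters"
      show "\<omega> (p * q) = \<omega> 0"
        by (simp add: character_mult[OF \<omega>] character_zero[OF \<omega>] p[OF \<omega>] q[OF \<omega>] max_def)
    qed
    show "\<phi> p \<noteq> 0" "\<psi> q \<noteq> 0"
      using u v by (simp_all add: p[OF \<phi>] q[OF \<psi>] character_diff[OF \<phi>] character_diff[OF \<psi>])
  qed
qed

subsection \<open>The spectrum\<close>

lemma openin_gelfand_spectrum_nonvanishing:
  "openin gelfand_spectrum {\<phi> \<in> characters. \<phi> (f :: 'a::cstar_algebra) \<noteq> 0}"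
proof -
  have "continuous_on UNIV (\<lambda>\<phi>::'a \<Rightarrow> complex. \<phi> f)" by (rule continuous_on_product_coordinates)
  hence "open ((\<lambda>\<phi>::'a \<Rightarrow> complex. \<phi> f) -` (- {0}))"
    by (rule open_vimage[rotated]) (simp add: open_Compl)
  moreover have "{\<phi> \<in> characters. \<phi> f \<noteq> 0} = (\<lambda>\<phi>. \<phi> f) -` (- {0}) \<inter> characters" by auto
  ultimately show ?thesis
    unfolding gelfand_spectrum_def openin_subtopology by auto
qed

text \<open>\<open>\<omega> f\<close> is the positive part of \<open>(cmod (\<omega> e))\<^sup>2 (\<epsilon>\<^sup>2 - (cmod (\<omega> a - \<phi> a))\<^sup>2)\<close>, where \<open>\<phi> e = 1\<close>.\<close>

lemma basic_neighbourhood_function: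
  fixes \<phi> :: "'a::{cstar_algebra,comm_ring} \<Rightarrow> complex"
  assumes \<phi>: "\<phi> \<in> characters" and "0 < \<epsilon>"
  obtains f where "\<phi> f \<noteq> 0" "\<And>\<psi>. \<psi> \<in> characters \<Longrightarrow> \<psi> f \<noteq> 0 \<Longrightarrow> cmod (\<psi> a - \<phi> a) < \<epsilon>"
proof -
  obtain e0 where "\<phi> e0 \<noteq> 0" using character_nonzero[OF \<phi>] by blast
  define e where "e = inverse (\<phi> e0) *\<^sub>C e0"
  have e: "\<phi> e = 1" using \<open>\<phi> e0 \<noteq> 0\<close> by (simp add: e_def character_scaleC[OF \<phi>])
  define z where "z = e * a - \<phi> a *\<^sub>C e"
  define w where "w = \<epsilon>\<^sup>2 *\<^sub>R (star e * e) - star z * z"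
  have w: "\<psi> w = of_real ((cmod (\<psi> e))\<^sup>2 * (\<epsilon>\<^sup>2 - (cmod (\<psi> a - \<phi> a))\<^sup>2))" if \<psi>: "\<psi> \<in> characters" for \<psi>
  proof -
    have "\<psi> z = \<psi> e * (\<psi> a - \<phi> a)" by (simp add: z_def character_simps[OF \<psi>] algebra_simps)
    hence "(cmod (\<psi> z))\<^sup>2 = (cmod (\<psi> e))\<^sup>2 * (cmod (\<psi> a - \<phi> a))\<^sup>2"
      by (simp add: norm_mult power_mult_distrib)
    thus ?thesis
      unfolding w_def character_diff[OF \<psi>] character_scaleR[OF \<psi>] character_star_self[OF \<psi>]
      by (simp add: algebra_simps)
  qed
  obtain f where f: "\<And>\<psi>. \<psi> \<in> characters \<Longrightarrow> \<psi> f = of_real (max 0 (Re (\<psi> w)))"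
    by (rule continuous_calculus[OF closed_ideal_UNIV UNIV_I, where w = w and g = "max 0"])
       (auto simp: w intro!: continuous_intros)
  show thesis
  proof
    show "\<phi> f \<noteq> 0" using \<open>0 < \<epsilon>\<close> by (simp add: f[OF \<phi>] w[OF \<phi>] e)
    fix \<psi> :: "'a \<Rightarrow> complex" assume \<psi>: "\<psi> \<in> characters" and "\<psi> f \<noteq> 0"
    hence "0 < (cmod (\<psi> e))\<^sup>2 * (\<epsilon>\<^sup>2 - (cmod (\<psi> a - \<phi> a))\<^sup>2)"
      unfolding f[OF \<psi>] w[OF \<psi>] Re_complex_of_real by (metis max.absorb1 not_less of_real_0)
    hence "(cmod (\<psi> a - \<phi> a))\<^sup>2 < \<epsilon>\<^sup>2" by (auto simp: zero_less_mult_iff)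
    thus "cmod (\<psi> a - \<phi> a) < \<epsilon>" using \<open>0 < \<epsilon>\<close> by (simp add: power2_less_imp_less)
  qed
qed

text \<open>A basic open set for pointwise convergence constrains finitely many coordinates. One
  function enforces each constraint, and their product is nonzero only where all of them
  hold.\<close>

lemma gelfand_spectrum_urysohn:
  fixes \<phi> :: "'a::{cstar_algebra,comm_ring} \<Rightarrow> complex"
  assumes "openin gelfand_spectrum W" "\<phi> \<in> W"
  obtains f where "\<phi> f \<noteq> 0" "{\<psi> \<in> characters. \<psi> f \<noteq> 0} \<subseteq> W"
proof -
  obtain T where T: "open T" "W = T \<inter> characters"
    using assms unfolding gelfand_spectrum_def openin_subtopology by auto
  have \<phi>: "\<phi> \<in> characters" "\<phi> \<in> T" using assms T by auto
  obtain X where X: "\<phi> \<in> (\<Pi>\<^sub>E i\<in>UNIV. X i)" "\<And>i. open (X i)" "finite {i. X i \<noteq> UNIV}"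
    "(\<Pi>\<^sub>E i\<in>UNIV. X i) \<subseteq> T"
    using product_topology_open_contains_basis[of "\<lambda>_. euclidean" UNIV T \<phi>] T(1) \<phi>(2)
    by (auto simp: open_fun_def)
  have "\<exists>f. \<phi> f \<noteq> 0 \<and> (\<forall>\<psi>\<in>characters. \<psi> f \<noteq> 0 \<longrightarrow> (\<forall>i\<in>J. \<psi> i \<in> X i))" if "finite J" for J
    using that
  proof (induction J rule: finite_induct)
    case empty
    thus ?case using character_nonzero[OF \<phi>(1)] by auto
  next
    case (insert a J)
    then obtain f where f: "\<phi> f \<noteq> 0" "\<forall>\<psi>\<in>characters. \<psi> f \<noteq> 0 \<longrightarrow> (\<forall>i\<in>J. \<psi> i \<in> X i)" by blast
    have "\<phi> a \<in> X a" using X(1) by auto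
    then obtain e where e: "0 < e" "ball (\<phi> a) e \<subseteq> X a" using X(2) open_contains_ball by blast
    obtain g where g: "\<phi> g \<noteq> 0" "\<And>\<psi>. \<psi> \<in> characters \<Longrightarrow> \<psi> g \<noteq> 0 \<Longrightarrow> cmod (\<psi> a - \<phi> a) < e"
      by (rule basic_neighbourhood_function[OF \<phi>(1) e(1), of a]) blast
    have "\<forall>i\<in>insert a J. \<psi> i \<in> X i" if \<psi>: "\<psi> \<in> characters" and "\<psi> (f * g) \<noteq> 0" for \<psi>
    proof -
      have "\<psi> f \<noteq> 0" "\<psi> g \<noteq> 0" using that by (auto simp: character_mult[OF \<psi>])
      hence "\<psi> a \<in> ball (\<phi> a) e" "\<forall>i\<in>J. \<psi> i \<in> X i"
        using f(2) g(2)[OF \<psi>] \<psi> by (auto simp: dist_norm norm_minus_commute)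
      thus ?thesis using e(2) by blast
    qed
    moreover have "\<phi> (f * g) \<noteq> 0" using f(1) g(1) by (simp add: character_mult[OF \<phi>(1)])
    ultimately show ?case by blast
  qed
  from this[OF X(3)] obtain f where f: "\<phi> f \<noteq> 0"
    "\<forall>\<psi>\<in>characters. \<psi> f \<noteq> 0 \<longrightarrow> (\<forall>i\<in>{i. X i \<noteq> UNIV}. \<psi> i \<in> X i)" by blast
  have "\<psi> \<in> W" if \<psi>: "\<psi> \<in> characters" "\<psi> f \<noteq> 0" for \<psi>
  proof -
    have "\<psi> i \<in> X i" for i using f(2) \<psi> by (cases "X i = UNIV") auto
    hence "\<psi> \<in> (\<Pi>\<^sub>E i\<in>UNIV. X i)" by auto
    thus ?thesis using X(4) T(2) \<psi>(1) by blast
  qed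
  thus thesis using f(1) by (intro that) auto
qed

text \<open>The sets where an element does not vanish form a base, and such a set is empty only for
  the element 0. Topological freeness thereby becomes a statement about elements.\<close>

lemma gelfand_spectrum_interior_empty_iff:
  fixes S :: "('a::{cstar_algebra,comm_ring} \<Rightarrow> complex) set"
  shows "gelfand_spectrum interior_of S = {} \<longleftrightarrow> (\<forall>f. f \<noteq> 0 \<longrightarrow> \<not> {\<phi> \<in> characters. \<phi> f \<noteq> 0} \<subseteq> S)"
proof
  assume L: "gelfand_spectrum interior_of S = {}"
  show "\<forall>f. f \<noteq> 0 \<longrightarrow> \<not> {\<phi> \<in> characters. \<phi> f \<noteq> 0} \<subseteq> S"
  proof (intro allI impI notI)
    fix f :: 'a assume f: "f \<noteq> 0" "{\<phi> \<in> characters. \<phi> f \<noteq> 0} \<subseteq> S"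
    have "{\<phi> \<in> characters. \<phi> f \<noteq> 0} \<subseteq> gelfand_spectrum interior_of S"
      using f(2) openin_gelfand_spectrum_nonvanishing by (rule interior_of_maximal)
    thus False using exists_nonvanishing_character[OF f(1)] L by blast
  qed
next
  assume R: "\<forall>f. f \<noteq> 0 \<longrightarrow> \<not> {\<phi> \<in> characters. \<phi> f \<noteq> 0} \<subseteq> S"
  show "gelfand_spectrum interior_of S = {}"
  proof (rule equals0I)
    fix \<phi> assume "\<phi> \<in> gelfand_spectrum interior_of S"
    with openin_interior_of obtain f
      where f: "\<phi> f \<noteq> 0" "{\<psi> \<in> characters. \<psi> f \<noteq> 0} \<subseteq> gelfand_spectrum interior_of S"
      by (rule gelfand_spectrum_urysohn)
    have \<phi>: "\<phi> \<in> characters"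
      using \<open>\<phi> \<in> _\<close> interior_of_subset_topspace[of gelfand_spectrum S]
      by (auto simp: gelfand_spectrum_def)
    have "f \<noteq> 0" using f(1) character_zero[OF \<phi>] by auto
    moreover have "{\<psi> \<in> characters. \<psi> f \<noteq> 0} \<subseteq> S"
      using f(2) interior_of_subset by (rule order_trans)
    ultimately show False using R by blast
  qed
qed

subsection \<open>Ideals and their supports\<close>

text \<open>\<open>star x\<close> is approximated by \<open>star x * v\<close>, where \<open>v\<close> is the image of \<open>star x * x\<close> under a function
  that equals 1 outside a neighbourhood of 0.\<close>

lemma closed_ideal_star:
  fixes x :: "'a::{cstar_algebra,comm_ring}"
  assumes I: "closed_ideal I" and x: "x \<in> I"
  shows "star x \<in> I"
proof -
  have "\<exists>y\<in>I. dist y (star x) < e" if "0 < e" for e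
  proof -
    define d where "d = e / 2"
    have d: "0 < d" using that by (simp add: d_def)
    obtain v where v: "v \<in> I"
      "\<And>\<phi>. \<phi> \<in> characters \<Longrightarrow> \<phi> v = of_real (min 1 (\<bar>Re (\<phi> (star x * x))\<bar> / d\<^sup>2))"
      by (rule continuous_calculus[OF I closed_ideal_mult_left[OF I x, of "star x"],
            where g = "\<lambda>r. min 1 (\<bar>r\<bar> / d\<^sup>2)"])
         (use d in \<open>auto simp: character_star_self intro!: continuous_intros\<close>)
    have "norm (star x * v - star x) \<le> d"
    proof (rule norm_le_by_characters)
      fix \<phi> :: "'a \<Rightarrow> complex" assume \<phi>: "\<phi> \<in> characters"
      define c where "c = cmod (\<phi> x)"
      have c: "0 \<le> c" by (simp add: c_def)
      have "\<phi> (star x * v - star x) = cnj (\<phi> x) * of_real (min 1 (c\<^sup>2 / d\<^sup>2) - 1)"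
        unfolding character_diff[OF \<phi>] character_mult[OF \<phi>, of "star x" v] v(2)[OF \<phi>]
          character_star_self[OF \<phi>] character_star[OF \<phi>]
        by (simp add: c_def algebra_simps)
      hence *: "cmod (\<phi> (star x * v - star x)) = c * \<bar>min 1 (c\<^sup>2 / d\<^sup>2) - 1\<bar>"
        by (simp add: norm_mult c_def del: of_real_diff)
      show "cmod (\<phi> (star x * v - star x)) \<le> d"
      \<comment> \<open>Where \<open>|\<phi> x| \<le> d\<close>, the factor \<open>v - 1\<close> has
        modulus at most 1 and the small value of \<open>x\<close> suffices; elsewhere
        \<open>v\<close> equals 1 and the error vanishes.\<close>
      proof (cases "c \<le> d")
        case True
        have "\<bar>min 1 (c\<^sup>2 / d\<^sup>2) - 1\<bar> \<le> 1" by (auto simp: min_def abs_le_iff)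
        thus ?thesis unfolding * using mult_mono[OF True, of _ 1] c d by fastforce
      next
        case False
        hence "d\<^sup>2 \<le> c\<^sup>2" using d by (intro power_mono) auto
        hence "min 1 (c\<^sup>2 / d\<^sup>2) = 1" using d by simp
        thus ?thesis unfolding * using d by simp
      qed
    qed (use d in simp)
    hence "dist (star x * v) (star x) < e" using that by (simp add: dist_norm d_def)
    thus ?thesis using closed_ideal_mult_left[OF I v(1)] by blast
  qed
  thus ?thesis using closed_approachable[OF closed_ideal_closed[OF I]] by blast
qed

text \<open>A nonzero multiplicative functional \<open>\<eta>\<close> on an ideal extends to the character
  \<open>a \<mapsto> \<eta> (a u)\<close>, where \<open>\<eta> u = 1\<close>.\<close>

lemma extend_character:
  fixes \<eta> :: "'a::{cstar_algebra,comm_ring} \<Rightarrow> complex"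
  assumes I: "closed_ideal I"
    and add: "\<And>x y. x \<in> I \<Longrightarrow> y \<in> I \<Longrightarrow> \<eta> (x + y) = \<eta> x + \<eta> y"
    and mult: "\<And>x y. x \<in> I \<Longrightarrow> y \<in> I \<Longrightarrow> \<eta> (x * y) = \<eta> x * \<eta> y"
    and scaleC: "\<And>c x. x \<in> I \<Longrightarrow> \<eta> (c *\<^sub>C x) = c * \<eta> x"
    and nz: "x \<in> I" "\<eta> x \<noteq> 0"
  obtains \<phi> where "\<phi> \<in> open_support I" "\<And>f. f \<in> I \<Longrightarrow> \<phi> f = \<eta> f"
proof -
  define u where "u = inverse (\<eta> x) *\<^sub>C x"
  have u: "u \<in> I" "\<eta> u = 1" using nz by (simp_all add: u_def closed_ideal_scaleC[OF I] scaleC)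
  have uI: "a * u \<in> I" for a by (rule closed_ideal_mult_left[OF I u(1)])
  define \<phi> where "\<phi> a = \<eta> (a * u)" for a
  have ext: "\<phi> f = \<eta> f" if "f \<in> I" for f using mult[OF that u(1)] u(2) by (simp add: \<phi>_def)
  have "\<phi> (a * b) = \<phi> a * \<phi> b" for a b
  proof -
    have "\<phi> a * \<phi> b = \<eta> ((a * u) * (b * u))" using mult[OF uI uI] by (simp add: \<phi>_def)
    also have "(a * u) * (b * u) = ((a * b) * u) * u" by (simp add: algebra_simps)
    also have "\<eta> \<dots> = \<phi> (a * b)" using mult[OF uI u(1)] u(2) by (simp add: \<phi>_def)
    finally show ?thesis by simp
  qed
  moreover have "\<phi> (a + b) = \<phi> a + \<phi> b" for a b
    using add[OF uI uI] by (simp add: \<phi>_def distrib_right)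
  moreover have "\<phi> (c *\<^sub>C a) = c * \<phi> a" for c a
    using scaleC[OF uI] by (simp add: \<phi>_def mult_scaleC_left)
  moreover have "\<phi> u \<noteq> 0" using ext u by simp
  ultimately have "\<phi> \<in> characters" by (auto simp: characters_def)
  hence "\<phi> \<in> open_support I" using \<open>\<phi> u \<noteq> 0\<close> u(1) by (auto simp: open_support_def)
  thus thesis using ext by (rule that)
qed

lemma open_supportI: "\<phi> \<in> characters \<Longrightarrow> f \<in> I \<Longrightarrow> \<phi> f \<noteq> 0 \<Longrightarrow> \<phi> \<in> open_support I"
  by (auto simp: open_support_def)

text \<open>A character of the support is recovered from the ideal by
  \<open>\<phi> a = \<phi> (a u) / \<phi> u\<close>.\<close>

lemma open_support_eqI:
  assumes I: "closed_ideal I" and \<phi>: "\<phi> \<in> open_support I" and \<psi>: "\<psi> \<in> characters"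
    and eq: "\<And>f. f \<in> I \<Longrightarrow> \<phi> f = \<psi> f"
  shows "\<phi> = \<psi>"
proof
  fix a
  from \<phi> obtain u where u: "\<phi> \<in> characters" "u \<in> I" "\<phi> u \<noteq> 0" by (auto simp: open_support_def)
  have "\<phi> a * \<phi> u = \<psi> a * \<psi> u"
    using eq[OF closed_ideal_mult_left[OF I u(2), of a]]
    by (simp add: character_mult[OF u(1)] character_mult[OF \<psi>])
  thus "\<phi> a = \<psi> a" using eq[OF u(2)] u(3) by simp
qed

section \<open>Partial dynamical systems\<close>

locale abelian_partial_system =
  fixes D :: "'g::group_add \<Rightarrow> 'a::{cstar_algebra,comm_ring} set" and \<alpha> :: "'g \<Rightarrow> 'a \<Rightarrow> 'a"
  assumes partial_action: "partial_action D \<alpha>"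
begin

lemma ideal: "closed_ideal (D t)"
  using partial_action unfolding partial_action_def by blast

lemma iso: "star_isomorphism (\<alpha> t) (D (- t)) (D t)"
  using partial_action unfolding partial_action_def by blast

lemma D_zero: "D 0 = UNIV"
  using partial_action unfolding partial_action_def by blast

lemma action_in: "x \<in> D (- t) \<Longrightarrow> \<alpha> t x \<in> D t"
  using iso[of t] unfolding star_isomorphism_def bij_betw_def by blast

lemma action_minus_in: "x \<in> D t \<Longrightarrow> \<alpha> (- t) x \<in> D (- t)"
  using action_in[of x "- t"] by simp

lemma action_add: "x \<in> D (- t) \<Longrightarrow> y \<in> D (- t) \<Longrightarrow> \<alpha> t (x + y) = \<alpha> t x + \<alpha> t y"
  using iso[of t] unfolding star_isomorphism_def by blast

lemma action_mult: "x \<in> D (- t) \<Longrightarrow> y \<in> D (- t) \<Longrightarrow> \<alpha> t (x * y) = \<alpha> t x * \<alpha> t y"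
  using iso[of t] unfolding star_isomorphism_def by blast

lemma action_scaleC: "x \<in> D (- t) \<Longrightarrow> \<alpha> t (c *\<^sub>C x) = c *\<^sub>C \<alpha> t x"
  using iso[of t] unfolding star_isomorphism_def by blast

lemma action_star: "x \<in> D (- t) \<Longrightarrow> \<alpha> t (star x) = star (\<alpha> t x)"
  using iso[of t] unfolding star_isomorphism_def by blast

lemma action_zero [simp]: "\<alpha> t 0 = 0"
  using action_scaleC[OF closed_ideal_zero[OF ideal], of t 0] by simp

lemma action_comp: "x \<in> D (- s) \<Longrightarrow> \<alpha> s x \<in> D (- t) \<Longrightarrow> \<alpha> t (\<alpha> s x) = \<alpha> (t + s) x"
  using partial_action action_in unfolding partial_action_def by blast

lemma action_comp_in: "x \<in> D (- s) \<Longrightarrow> \<alpha> s x \<in> D (- t) \<Longrightarrow> x \<in> D (- (t + s))"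
  using partial_action action_in unfolding partial_action_def by blast

text \<open>The axioms make \<open>\<alpha> 0\<close> idempotent, and an injective idempotent map is
  the identity.\<close>

lemma zero_action [simp]: "\<alpha> 0 x = x"
proof -
  have "\<alpha> 0 (\<alpha> 0 x) = \<alpha> 0 x" using action_comp[of x 0 0] by (simp add: D_zero)
  moreover have "inj (\<alpha> 0)" using iso[of 0] by (simp add: star_isomorphism_def D_zero bij_betw_def)
  ultimately show ?thesis by (simp add: inj_eq)
qed

lemma action_left_inverse: "x \<in> D (- t) \<Longrightarrow> \<alpha> (- t) (\<alpha> t x) = x"
  using action_comp[of x t "- t"] action_in by simp

lemma action_right_inverse: "x \<in> D t \<Longrightarrow> \<alpha> t (\<alpha> (- t) x) = x"
  using action_left_inverse[of x "- t"] by simp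

text \<open>The domain axiom for \<open>\<alpha> t x\<close>, moved first by \<open>- t\<close> and
  then by \<open>- s\<close>.\<close>

lemma action_image_Int: "x \<in> D (- t) \<Longrightarrow> x \<in> D s \<Longrightarrow> \<alpha> t x \<in> D (t + s)"
  using action_comp_in[of "\<alpha> t x" "- t" "- s"]
  by (simp add: action_left_inverse action_in minus_add)

subsection \<open>The dual maps\<close>

text \<open>\<open>\<phi>\<close> composed with \<open>\<alpha> t\<close> is a multiplicative
  functional on \<open>D (- t)\<close>, hence extends to a character. Values of
  \<open>\<alpha> t f\<close> thus become values of \<open>f\<close>.\<close>

lemma action_eval:
  assumes \<phi>: "\<phi> \<in> characters" and f: "f \<in> D (- t)" "\<phi> (\<alpha> t f) \<noteq> 0"
  obtains \<psi> where "\<psi> \<in> open_support (D (- t))" "\<And>f. f \<in> D (- t) \<Longrightarrow> \<phi> (\<alpha> t f) = \<psi> f"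
proof (rule extend_character[OF ideal, where \<eta> = "\<lambda>f. \<phi> (\<alpha> t f)"])
  fix \<psi>
  assume "\<psi> \<in> open_support (D (- t))" and "\<And>f. f \<in> D (- t) \<Longrightarrow> \<psi> f = \<phi> (\<alpha> t f)"
  thus thesis by (intro that[of \<psi>]) auto
qed (use f in \<open>simp_all add: action_add action_mult action_scaleC character_simps[OF \<phi>]\<close>)

text \<open>The factor \<open>a\<close> need not lie in \<open>D (- t)\<close>, so
  \<open>\<alpha> t (a * f)\<close> cannot be split; the extended character is defined at
  \<open>a\<close> and bounded there by \<open>norm a\<close>.\<close>

lemma cmod_action_le:
  assumes \<phi>: "\<phi> \<in> characters" and f: "f \<in> D (- t)"
  shows "cmod (\<phi> (\<alpha> t (a * f))) \<le> norm a * cmod (\<phi> (\<alpha> t f))"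
proof (cases "\<phi> (\<alpha> t (a * f)) = 0")
  case False
  obtain \<psi> where \<psi>: "\<psi> \<in> open_support (D (- t))" "\<And>f. f \<in> D (- t) \<Longrightarrow> \<phi> (\<alpha> t f) = \<psi> f"
    using action_eval[OF \<phi> closed_ideal_mult_left[OF ideal f] False] by blast
  hence "\<psi> \<in> characters" by (simp add: open_support_def)
  thus ?thesis
    using \<psi>(2)[OF f] \<psi>(2)[OF closed_ideal_mult_left[OF ideal f], of a] character_norm_le[of \<psi> a]
    by (simp add: character_mult[of \<psi>] norm_mult mult_right_mono)
qed simp

lemma norm_action_le:
  assumes f: "f \<in> D (- t)"
  shows "norm (\<alpha> t f) \<le> norm f"
proof (rule norm_le_by_characters)
  fix \<phi> :: "'a \<Rightarrow> complex" assume \<phi>: "\<phi> \<in> characters"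
  show "cmod (\<phi> (\<alpha> t f)) \<le> norm f"
  proof (cases "\<phi> (\<alpha> t f) = 0")
    case False
    obtain \<psi> where \<psi>: "\<psi> \<in> open_support (D (- t))" "\<And>f. f \<in> D (- t) \<Longrightarrow> \<phi> (\<alpha> t f) = \<psi> f"
      using action_eval[OF \<phi> f False] by blast
    hence "\<psi> \<in> characters" by (simp add: open_support_def)
    thus ?thesis using \<psi>(2)[OF f] character_norm_le[of \<psi> f] by simp
  qed simp
qed simp

lemma norm_action: "f \<in> D (- t) \<Longrightarrow> norm (\<alpha> t f) = norm f"
  using norm_action_le[of f t] norm_action_le[of "\<alpha> t f" "- t"]
  by (simp add: action_left_inverse action_in)

lemma dual_map_eqI:
  assumes \<psi>: "\<psi> \<in> open_support (D t)" and eq: "\<And>f. f \<in> D (- t) \<Longrightarrow> \<psi> (\<alpha> t f) = \<phi> f"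
  shows "dual_map D \<alpha> t \<phi> = \<psi>"
  unfolding dual_map_def
proof (rule the_equality)
  fix \<psi>' assume \<psi>': "\<psi>' \<in> open_support (D t) \<and> (\<forall>f\<in>D (- t). \<psi>' (\<alpha> t f) = \<phi> f)"
  show "\<psi>' = \<psi>"
  proof (rule open_support_eqI[OF ideal])
    fix f assume "f \<in> D t"
    thus "\<psi>' f = \<psi> f" using \<psi>' eq action_minus_in action_right_inverse by metis
  qed (use \<psi> \<psi>' in \<open>auto simp: open_support_def\<close>)
qed (use assms in auto)

lemma dual_map:
  assumes "\<phi> \<in> open_support (D (- t))"
  shows dual_map_in: "dual_map D \<alpha> t \<phi> \<in> open_support (D t)"
    and dual_map_eval: "f \<in> D (- t) \<Longrightarrow> dual_map D \<alpha> t \<phi> (\<alpha> t f) = \<phi> f"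
proof -
  obtain g where \<phi>: "\<phi> \<in> characters" and g: "g \<in> D (- t)" "\<phi> g \<noteq> 0"
    using assms by (auto simp: open_support_def)
  have "\<phi> (\<alpha> (- t) (\<alpha> t g)) \<noteq> 0" using g by (simp add: action_left_inverse)
  then obtain \<psi> where \<psi>: "\<psi> \<in> open_support (D t)" "\<And>f. f \<in> D t \<Longrightarrow> \<phi> (\<alpha> (- t) f) = \<psi> f"
    using action_eval[OF \<phi>, of "\<alpha> t g" "- t"] action_in[OF g(1)] by auto
  have eval: "\<psi> (\<alpha> t f) = \<phi> f" if "f \<in> D (- t)" for f
    using \<psi>(2)[OF action_in[OF that]] that by (simp add: action_left_inverse)
  with \<psi>(1) have "dual_map D \<alpha> t \<phi> = \<psi>" by (rule dual_map_eqI)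
  thus "dual_map D \<alpha> t \<phi> \<in> open_support (D t)"
    "f \<in> D (- t) \<Longrightarrow> dual_map D \<alpha> t \<phi> (\<alpha> t f) = \<phi> f"
    using \<psi>(1) eval by simp_all
qed

lemma dual_map_eval_inverse:
  "\<phi> \<in> open_support (D (- t)) \<Longrightarrow> g \<in> D t \<Longrightarrow> dual_map D \<alpha> t \<phi> g = \<phi> (\<alpha> (- t) g)"
  using dual_map_eval[of \<phi> t "\<alpha> (- t) g"] by (simp add: action_minus_in action_right_inverse)

lemma dual_map_inverse:
  assumes "\<phi> \<in> open_support (D t)"
  shows "dual_map D \<alpha> t (dual_map D \<alpha> (- t) \<phi>) = \<phi>"
proof (rule dual_map_eqI[OF assms])
  fix f assume "f \<in> D (- t)"
  thus "\<phi> (\<alpha> t f) = dual_map D \<alpha> (- t) \<phi> f"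
    using dual_map_eval_inverse[of \<phi> "- t" f] assms by simp
qed

text \<open>Functions \<open>p\<close>, \<open>q\<close> with product 0 separate
  \<open>\<phi>\<close> from its image. A factor \<open>d\<close> brings \<open>q\<close> into
  \<open>D t\<close>, and \<open>r\<close> is the pullback of \<open>q d\<close>, so that
  \<open>p\<close> kills \<open>\<alpha> t r\<close>. The orthogonality relations below all come
  from this pair.\<close>

lemma moved_point:
  assumes \<phi>: "\<phi> \<in> open_support (D (- t))" and moved: "dual_map D \<alpha> t \<phi> \<noteq> \<phi>"
  obtains p r where "r \<in> D (- t)" "\<phi> p \<noteq> 0" "\<phi> r \<noteq> 0" "p * \<alpha> t r = 0"
proof -
  let ?\<psi> = "dual_map D \<alpha> t \<phi>"
  have chars: "\<phi> \<in> characters" "?\<psi> \<in> characters"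
    using \<phi> dual_map_in[OF \<phi>] by (auto simp: open_support_def)
  then obtain p q where pq: "p * q = 0" "\<phi> p \<noteq> 0" "?\<psi> q \<noteq> 0"
    using moved by (metis disjoint_separating_elements)
  obtain d where d: "d \<in> D t" "?\<psi> d \<noteq> 0" using dual_map_in[OF \<phi>] by (auto simp: open_support_def)
  have qd: "q * d \<in> D t" by (rule closed_ideal_mult_left[OF ideal d(1)])
  have "\<phi> (\<alpha> (- t) (q * d)) = ?\<psi> q * ?\<psi> d"
    using dual_map_eval_inverse[OF \<phi> qd] by (simp add: character_mult[OF chars(2)])
  hence nz: "\<phi> (\<alpha> (- t) (q * d)) \<noteq> 0" using pq d by simp
  show thesis
  proof (rule that[OF action_minus_in[OF qd] pq(2) nz])
    show "p * \<alpha> t (\<alpha> (- t) (q * d)) = 0"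
      using pq by (simp add: action_right_inverse[OF qd] flip: mult.assoc)
  qed
qed

text \<open>The complement of the fixed point set is relatively open. This is why finite unions can be
  treated one group element at a time.\<close>

lemma topologically_free_iff:
  "topologically_free D \<alpha> \<longleftrightarrow>
     (\<forall>t. t \<noteq> 0 \<longrightarrow> (\<forall>f\<in>D (- t). f \<noteq> 0 \<longrightarrow>
       (\<exists>\<phi>\<in>characters. \<phi> f \<noteq> 0 \<and> dual_map D \<alpha> t \<phi> \<noteq> \<phi>)))" (is "_ \<longleftrightarrow> ?R")
proof
  assume tf: "topologically_free D \<alpha>"
  show ?R
  proof (intro allI impI ballI)
    fix t f assume tf': "(t::'g) \<noteq> 0" "f \<in> D (- t)" "f \<noteq> 0"
    let ?Fix = "{\<phi> \<in> open_support (D (- t)). dual_map D \<alpha> t \<phi> = \<phi>}"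
    have "gelfand_spectrum interior_of ?Fix = {}"
      using tf[unfolded topologically_free_def, rule_format, of "{t}"] tf'(1) by simp
    hence "\<not> {\<phi> \<in> characters. \<phi> f \<noteq> 0} \<subseteq> ?Fix"
      unfolding gelfand_spectrum_interior_empty_iff using tf'(3) by blast
    thus "\<exists>\<phi>\<in>characters. \<phi> f \<noteq> 0 \<and> dual_map D \<alpha> t \<phi> \<noteq> \<phi>"
      using tf'(2) open_supportI by blast
  qed
next
  assume R: ?R
  let ?Fix = "\<lambda>t. {\<phi> \<in> open_support (D (- t)). dual_map D \<alpha> t \<phi> = \<phi>}"
  have step: "\<exists>g. g \<noteq> 0 \<and> {\<phi> \<in> characters. \<phi> g \<noteq> 0} \<subseteq> {\<phi> \<in> characters. \<phi> f \<noteq> 0} - ?Fix t"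
    if t: "t \<noteq> 0" and f: "f \<noteq> 0" for t f
  \<comment> \<open>If \<open>f\<close> annihilates \<open>D (- t)\<close>, its support misses the
    whole domain of the dual map and nothing has to be removed.\<close>
  proof (cases "\<forall>d\<in>D (- t). f * d = 0")
    case True
    have "{\<phi> \<in> characters. \<phi> f \<noteq> 0} \<inter> open_support (D (- t)) = {}"
    proof (rule equals0I, elim IntE CollectE conjE)
      fix \<phi> assume \<phi>: "\<phi> \<in> characters" "\<phi> f \<noteq> 0" "\<phi> \<in> open_support (D (- t))"
      then obtain d where d: "d \<in> D (- t)" "\<phi> d \<noteq> 0" by (auto simp: open_support_def)
      hence "\<phi> f * \<phi> d = 0"
        using bspec[OF True d(1)] by (simp add: character_zero[OF \<phi>(1)] flip: character_mult[OF \<phi>(1)])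
      thus False using d \<phi> by simp
    qed
    thus ?thesis using f by (intro exI[of _ f]) auto
  next
    case False
    then obtain d where d: "d \<in> D (- t)" "f * d \<noteq> 0" by auto
    then obtain \<phi> where \<phi>: "\<phi> \<in> characters" "\<phi> (f * d) \<noteq> 0" "dual_map D \<alpha> t \<phi> \<noteq> \<phi>"
      using R t closed_ideal_mult_left[OF ideal d(1), of f] by blast
    hence fd: "\<phi> f \<noteq> 0" "\<phi> d \<noteq> 0" by (auto simp: character_mult[OF \<phi>(1)])
    with \<phi> d have "\<phi> \<in> open_support (D (- t))" by (intro open_supportI)
    then obtain p r where pr: "r \<in> D (- t)" "\<phi> p \<noteq> 0" "\<phi> r \<noteq> 0" "p * \<alpha> t r = 0"
      using \<phi>(3) by (rule moved_point)
    \<comment> \<open>Where \<open>g\<close> is nonzero, so are \<open>p\<close> and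
      \<open>r\<close>; then \<open>\<alpha> t r\<close> vanishes there while \<open>r\<close> does
      not, so the point is not fixed.\<close>
    define g where "g = f * (p * r)"
    have "\<phi> g \<noteq> 0" using fd pr by (simp add: g_def character_mult[OF \<phi>(1)])
    hence "g \<noteq> 0" using character_zero[OF \<phi>(1)] by auto
    moreover have "\<psi> f \<noteq> 0 \<and> \<psi> \<notin> ?Fix t" if \<psi>: "\<psi> \<in> characters" "\<psi> g \<noteq> 0" for \<psi>
    proof -
      have nz: "\<psi> f \<noteq> 0" "\<psi> p \<noteq> 0" "\<psi> r \<noteq> 0"
        using \<psi>(2) by (auto simp: g_def character_mult[OF \<psi>(1)])
      have "\<psi> p * \<psi> (\<alpha> t r) = 0"
        using pr(4) by (simp add: character_zero[OF \<psi>(1)] flip: character_mult[OF \<psi>(1)])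
      hence "\<psi> (\<alpha> t r) \<noteq> \<psi> r" using nz by auto
      thus ?thesis using dual_map_eval[OF _ pr(1), of \<psi>] nz(1) by auto
    qed
    ultimately show ?thesis by (intro exI[of _ g]) blast
  qed
  have avoid: "\<exists>g. g \<noteq> 0 \<and> {\<phi> \<in> characters. \<phi> g \<noteq> 0} \<subseteq> {\<phi> \<in> characters. \<phi> f \<noteq> 0} - (\<Union>t\<in>F. ?Fix t)"
    if "finite F" "0 \<notin> F" "f \<noteq> 0" for F f
    using that
  proof (induction F rule: finite_induct)
    case empty
    thus ?case by auto
  next
    case (insert t F)
    then obtain g where g: "g \<noteq> 0"
      "{\<phi> \<in> characters. \<phi> g \<noteq> 0} \<subseteq> {\<phi> \<in> characters. \<phi> f \<noteq> 0} - (\<Union>t\<in>F. ?Fix t)" by auto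
    have "t \<noteq> 0" using insert.prems by auto
    from step[OF this g(1)] obtain h where "h \<noteq> 0"
      "{\<phi> \<in> characters. \<phi> h \<noteq> 0} \<subseteq> {\<phi> \<in> characters. \<phi> g \<noteq> 0} - ?Fix t" by blast
    thus ?case using g(2) by (intro exI[of _ h]) blast
  qed
  have "\<not> {\<phi> \<in> characters. \<phi> f \<noteq> 0} \<subseteq> (\<Union>t\<in>F. ?Fix t)"
    if F: "finite F" "0 \<notin> F" "f \<noteq> 0" for F f
  proof -
    obtain g where g: "g \<noteq> 0"
      "{\<phi> \<in> characters. \<phi> g \<noteq> 0} \<subseteq> {\<phi> \<in> characters. \<phi> f \<noteq> 0} - (\<Union>t\<in>F. ?Fix t)"
      using avoid[OF F] by blast
    obtain \<phi> where "\<phi> \<in> characters" "\<phi> g \<noteq> 0" using exists_nonvanishing_character[OF g(1)] by blast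
    thus ?thesis using g(2) by blast
  qed
  thus "topologically_free D \<alpha>"
    unfolding topologically_free_def gelfand_spectrum_interior_empty_iff by blast
qed

end

section \<open>The Hilbert module of the reduced crossed product\<close>

context abelian_partial_system
begin

section \<open>Coefficients, inner product and norm of formal sums\<close>

lemma action_minus: "x \<in> D (- t) \<Longrightarrow> \<alpha> t (- x) = - \<alpha> t x"
  using action_scaleC[of x t "-1"] by simp

lemma action_diff: "x \<in> D (- t) \<Longrightarrow> y \<in> D (- t) \<Longrightarrow> \<alpha> t (x - y) = \<alpha> t x - \<alpha> t y"
  using action_add[of x t "- y"] closed_ideal_minus[OF ideal, of y "- t"] by (simp add: action_minus)

lemma ideal_star: "x \<in> D t \<Longrightarrow> star x \<in> D t"
  by (rule closed_ideal_star[OF ideal])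

lemma formal_sums_lookup: "x \<in> formal_sums D \<Longrightarrow> Poly_Mapping.lookup x t \<in> D t"
  by (simp add: formal_sums_def)

lemma formal_sums_diff: "x \<in> formal_sums D \<Longrightarrow> y \<in> formal_sums D \<Longrightarrow> x - y \<in> formal_sums D"
  by (simp add: formal_sums_def lookup_minus closed_ideal_diff[OF ideal])

lemma formal_sums_minus: "x \<in> formal_sums D \<Longrightarrow> - x \<in> formal_sums D"
  by (simp add: formal_sums_def closed_ideal_minus[OF ideal])

lemma formal_sums_add: "x \<in> formal_sums D \<Longrightarrow> y \<in> formal_sums D \<Longrightarrow> x + y \<in> formal_sums D"
  by (simp add: formal_sums_def lookup_add closed_ideal_add[OF ideal])

lemma formal_sums_single: "a \<in> D t \<Longrightarrow> Poly_Mapping.single t a \<in> formal_sums D"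
  by (simp add: formal_sums_def lookup_single when_def closed_ideal_zero[OF ideal])

lemma lookup_fs_star:
  "Poly_Mapping.lookup (fs_star \<alpha> x) s = \<alpha> s (star (Poly_Mapping.lookup x (- s)))"
proof -
  have "Poly_Mapping.lookup (fs_star \<alpha> x) s
    = (\<Sum>t\<in>Poly_Mapping.keys x. if t = - s then \<alpha> s (star (Poly_Mapping.lookup x (- s))) else 0)"
    unfolding fs_star_def lookup_sum lookup_single when_def
    by (intro sum.cong) (auto simp: minus_equation_iff)
  also have "\<dots> = \<alpha> s (star (Poly_Mapping.lookup x (- s)))"
    by (simp add: sum.delta in_keys_iff)
  finally show ?thesis .
qed

lemma lookup_fs_mult:
  assumes "finite S" "Poly_Mapping.keys x \<subseteq> S"
  shows "Poly_Mapping.lookup (fs_mult \<alpha> x y) r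
    = (\<Sum>t\<in>S. \<alpha> t (\<alpha> (- t) (Poly_Mapping.lookup x t) * Poly_Mapping.lookup y (- t + r)))"
proof -
  have "Poly_Mapping.lookup (fs_mult \<alpha> x y) r
    = (\<Sum>t\<in>Poly_Mapping.keys x. \<Sum>s\<in>Poly_Mapping.keys y. if s = - t + r
        then \<alpha> t (\<alpha> (- t) (Poly_Mapping.lookup x t) * Poly_Mapping.lookup y (- t + r)) else 0)"
    unfolding fs_mult_def lookup_sum lookup_single when_def
    by (intro sum.cong) (auto simp: algebra_simps)
  also have "\<dots> = (\<Sum>t\<in>Poly_Mapping.keys x. \<alpha> t (\<alpha> (- t) (Poly_Mapping.lookup x t) * Poly_Mapping.lookup y (- t + r)))"
    by (intro sum.cong refl) (simp add: sum.delta in_keys_iff)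
  also have "\<dots> = (\<Sum>t\<in>S. \<alpha> t (\<alpha> (- t) (Poly_Mapping.lookup x t) * Poly_Mapping.lookup y (- t + r)))"
    using assms by (intro sum.mono_neutral_left) (auto simp: in_keys_iff)
  finally show ?thesis .
qed

lemma lookup_fs_mult_single:
  "Poly_Mapping.lookup (fs_mult \<alpha> (Poly_Mapping.single t b) y) r
    = \<alpha> t (\<alpha> (- t) b * Poly_Mapping.lookup y (- t + r))"
  by (subst lookup_fs_mult[of "{t}"]) auto

lemma fs_mult_single_single:
  "fs_mult \<alpha> (Poly_Mapping.single t a) (Poly_Mapping.single s b)
    = Poly_Mapping.single (t + s) (\<alpha> t (\<alpha> (- t) a * b))"
proof (rule poly_mapping_eqI)
  fix r
  have "s = - t + r \<longleftrightarrow> t + s = r" by (metis add_minus_cancel minus_add_cancel)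
  thus "Poly_Mapping.lookup (fs_mult \<alpha> (Poly_Mapping.single t a) (Poly_Mapping.single s b)) r
    = Poly_Mapping.lookup (Poly_Mapping.single (t + s) (\<alpha> t (\<alpha> (- t) a * b))) r"
    by (simp add: lookup_fs_mult_single lookup_single when_def)
qed

text \<open>The coefficient of the adjoint of \<open>x\<close> at \<open>- t\<close> is
  \<open>\<alpha> (- t)\<close> of the adjoint of \<open>x_t\<close>, and it meets
  \<open>y_t\<close> in the coefficient at the identity, where the inner \<open>\<alpha> t\<close>
  undoes it.\<close>

lemma fs_inner_eq:
  assumes x: "x \<in> formal_sums D" and S: "finite S" "Poly_Mapping.keys x \<subseteq> S"
  shows "fs_inner \<alpha> x y = (\<Sum>t\<in>S. \<alpha> (- t) (star (Poly_Mapping.lookup x t) * Poly_Mapping.lookup y t))"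
proof -
  have "Poly_Mapping.keys (fs_star \<alpha> x) \<subseteq> uminus ` S"
  proof
    fix s assume "s \<in> Poly_Mapping.keys (fs_star \<alpha> x)"
    hence "Poly_Mapping.lookup x (- s) \<noteq> 0" by (auto simp: in_keys_iff lookup_fs_star)
    hence "- s \<in> S" using S(2) by (auto simp: in_keys_iff)
    thus "s \<in> uminus ` S" by force
  qed
  hence "fs_inner \<alpha> x y = (\<Sum>s\<in>uminus ` S. \<alpha> s (\<alpha> (- s) (\<alpha> s (star (Poly_Mapping.lookup x (- s)))) * Poly_Mapping.lookup y (- s)))"
    unfolding fs_inner_def using S(1) by (subst lookup_fs_mult[of "uminus ` S"]) (auto simp: lookup_fs_star)
  also have "\<dots> = (\<Sum>t\<in>S. \<alpha> (- t) (\<alpha> t (\<alpha> (- t) (star (Poly_Mapping.lookup x t))) * Poly_Mapping.lookup y t))"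
    by (subst sum.reindex) (auto simp: inj_on_def)
  also have "\<dots> = (\<Sum>t\<in>S. \<alpha> (- t) (star (Poly_Mapping.lookup x t) * Poly_Mapping.lookup y t))"
    by (simp add: action_right_inverse ideal_star formal_sums_lookup[OF x])
  finally show ?thesis .
qed

text \<open>Every character \<open>\<phi>\<close> turns the formal sums into the inner product space of finitely supported
  functions, via the coordinates below, and \<open>fs_norm\<close> is the supremum of the norms obtained.\<close>

definition coordinate :: "('a \<Rightarrow> complex) \<Rightarrow> ('g \<Rightarrow>\<^sub>0 'a) \<Rightarrow> 'g \<Rightarrow> complex" where
  "coordinate \<phi> x t = \<phi> (\<alpha> (- t) (Poly_Mapping.lookup x t))"

lemma coordinate_add:
  assumes "\<phi> \<in> characters" "x \<in> formal_sums D" "y \<in> formal_sums D"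
  shows "coordinate \<phi> (x + y) t = coordinate \<phi> x t + coordinate \<phi> y t"
  using assms by (simp add: coordinate_def lookup_add action_add formal_sums_lookup character_add[OF assms(1)])

lemma character_fs_inner:
  assumes \<phi>: "\<phi> \<in> characters" and x: "x \<in> formal_sums D" and y: "y \<in> formal_sums D"
    and S: "finite S" "Poly_Mapping.keys x \<subseteq> S"
  shows "\<phi> (fs_inner \<alpha> x y) = (\<Sum>t\<in>S. cnj (coordinate \<phi> x t) * coordinate \<phi> y t)"
proof -
  have "\<phi> (\<alpha> (- t) (star (Poly_Mapping.lookup x t) * Poly_Mapping.lookup y t))
    = cnj (coordinate \<phi> x t) * coordinate \<phi> y t" for t
    using formal_sums_lookup[OF x, of t] formal_sums_lookup[OF y, of t]
    by (simp add: coordinate_def action_mult action_star ideal_star character_mult[OF \<phi>] character_star[OF \<phi>])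
  thus ?thesis by (simp add: fs_inner_eq[OF x S] character_sum[OF \<phi>])
qed

lemma fs_inner_add_left:
  assumes "x \<in> formal_sums D" "y \<in> formal_sums D" "z \<in> formal_sums D"
  shows "fs_inner \<alpha> (x + y) z = fs_inner \<alpha> x z + fs_inner \<alpha> y z"
proof (rule eq_by_characters)
  fix \<phi> :: "'a \<Rightarrow> complex" assume \<phi>: "\<phi> \<in> characters"
  let ?S = "Poly_Mapping.keys x \<union> Poly_Mapping.keys y"
  have S: "finite ?S" "Poly_Mapping.keys (x + y) \<subseteq> ?S" "Poly_Mapping.keys x \<subseteq> ?S" "Poly_Mapping.keys y \<subseteq> ?S"
    using keys_add[of x y] by auto
  show "\<phi> (fs_inner \<alpha> (x + y) z) = \<phi> (fs_inner \<alpha> x z + fs_inner \<alpha> y z)"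
    unfolding character_add[OF \<phi>]
      character_fs_inner[OF \<phi> formal_sums_add[OF assms(1,2)] assms(3) S(1,2)]
      character_fs_inner[OF \<phi> assms(1,3) S(1,3)] character_fs_inner[OF \<phi> assms(2,3) S(1,4)]
    by (simp add: coordinate_add[OF \<phi> assms(1,2)] distrib_right sum.distrib)
qed

lemma fs_inner_add_right:
  assumes "x \<in> formal_sums D" "y \<in> formal_sums D" "z \<in> formal_sums D"
  shows "fs_inner \<alpha> x (y + z) = fs_inner \<alpha> x y + fs_inner \<alpha> x z"
  using assms
  by (simp add: fs_inner_eq[OF assms(1) finite_keys order_refl] lookup_add distrib_left
      action_add sum.distrib closed_ideal_mult_left[OF ideal] formal_sums_lookup)

lemma fs_inner_zero_right [simp]: "x \<in> formal_sums D \<Longrightarrow> fs_inner \<alpha> x 0 = 0"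
  by (simp add: fs_inner_eq[OF _ finite_keys order_refl])

lemma fs_norm_zero [simp]: "fs_norm \<alpha> 0 = 0"
  by (simp add: fs_norm_def formal_sums_def closed_ideal_zero[OF ideal])

lemma fs_norm_minus: "x \<in> formal_sums D \<Longrightarrow> fs_norm \<alpha> (- x) = fs_norm \<alpha> x"
  by (simp add: fs_norm_def fs_inner_eq[OF _ finite_keys order_refl] formal_sums_minus)

lemma fs_norm_nonneg [simp]: "0 \<le> fs_norm \<alpha> x"
  by (simp add: fs_norm_def)

text \<open>A Bessel inequality: \<open>S\<close> is arbitrary because left translation moves index
  sets off the support.\<close>

lemma sum_coordinates_le:
  assumes \<phi>: "\<phi> \<in> characters" and x: "x \<in> formal_sums D" and S: "finite S"
  shows "(\<Sum>t\<in>S. (cmod (coordinate \<phi> x t))\<^sup>2) \<le> (fs_norm \<alpha> x)\<^sup>2"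
proof -
  let ?S = "S \<union> Poly_Mapping.keys x"
  have "(\<Sum>t\<in>S. (cmod (coordinate \<phi> x t))\<^sup>2) \<le> (\<Sum>t\<in>?S. (cmod (coordinate \<phi> x t))\<^sup>2)"
    using S by (intro sum_mono2) auto
  also have "of_real \<dots> = \<phi> (fs_inner \<alpha> x x)"
    using S by (subst character_fs_inner[OF \<phi> x x, of ?S])
      (auto simp: complex_norm_square mult.commute simp del: of_real_power)
  hence "(\<Sum>t\<in>?S. (cmod (coordinate \<phi> x t))\<^sup>2) = Re (\<phi> (fs_inner \<alpha> x x))"
    by (metis Re_complex_of_real)
  hence "(\<Sum>t\<in>?S. (cmod (coordinate \<phi> x t))\<^sup>2) \<le> norm (fs_inner \<alpha> x x)"
    using complex_Re_le_cmod[of "\<phi> (fs_inner \<alpha> x x)"] character_norm_le[OF \<phi>, of "fs_inner \<alpha> x x"]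
    by linarith
  finally show ?thesis by (simp add: fs_norm_def)
qed

lemma fs_norm_leI:
  assumes x: "x \<in> formal_sums D" and "0 \<le> M"
    and le: "\<And>\<phi>. \<phi> \<in> characters \<Longrightarrow> (\<Sum>t\<in>Poly_Mapping.keys x. (cmod (coordinate \<phi> x t))\<^sup>2) \<le> M\<^sup>2"
  shows "fs_norm \<alpha> x \<le> M"
proof -
  have "norm (fs_inner \<alpha> x x) \<le> M\<^sup>2"
  proof (rule norm_le_by_characters)
    fix \<phi> :: "'a \<Rightarrow> complex" assume \<phi>: "\<phi> \<in> characters"
    have "\<phi> (fs_inner \<alpha> x x) = of_real (\<Sum>t\<in>Poly_Mapping.keys x. (cmod (coordinate \<phi> x t))\<^sup>2)"
      by (subst character_fs_inner[OF \<phi> x x finite_keys order_refl])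
        (auto simp: complex_norm_square mult.commute simp del: of_real_power)
    hence "cmod (\<phi> (fs_inner \<alpha> x x)) = (\<Sum>t\<in>Poly_Mapping.keys x. (cmod (coordinate \<phi> x t))\<^sup>2)"
      by (simp only: norm_of_real) (simp add: sum_nonneg)
    thus "cmod (\<phi> (fs_inner \<alpha> x x)) \<le> M\<^sup>2" using le[OF \<phi>] by simp
  qed simp
  hence "sqrt (norm (fs_inner \<alpha> x x)) \<le> sqrt (M\<^sup>2)" by (rule real_sqrt_le_mono)
  thus ?thesis using \<open>0 \<le> M\<close> by (simp add: fs_norm_def)
qed

lemma fs_inner_cauchy_schwarz:
  assumes x: "x \<in> formal_sums D" and y: "y \<in> formal_sums D"
  shows "norm (fs_inner \<alpha> x y) \<le> fs_norm \<alpha> x * fs_norm \<alpha> y"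
proof (rule norm_le_by_characters)
  fix \<phi> :: "'a \<Rightarrow> complex" assume \<phi>: "\<phi> \<in> characters"
  let ?K = "Poly_Mapping.keys x"
  have "cmod (\<phi> (fs_inner \<alpha> x y)) \<le> (\<Sum>t\<in>?K. cmod (coordinate \<phi> x t) * cmod (coordinate \<phi> y t))"
    unfolding character_fs_inner[OF \<phi> x y finite_keys order_refl]
    by (rule order_trans[OF norm_sum]) (simp add: norm_mult)
  hence "(cmod (\<phi> (fs_inner \<alpha> x y)))\<^sup>2 \<le> (\<Sum>t\<in>?K. cmod (coordinate \<phi> x t) * cmod (coordinate \<phi> y t))\<^sup>2"
    by (rule power_mono) simp
  also have "\<dots> \<le> (\<Sum>t\<in>?K. (cmod (coordinate \<phi> x t))\<^sup>2) * (\<Sum>t\<in>?K. (cmod (coordinate \<phi> y t))\<^sup>2)"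
    by (rule Cauchy_Schwarz_ineq_sum)
  also have "\<dots> \<le> (fs_norm \<alpha> x)\<^sup>2 * (fs_norm \<alpha> y)\<^sup>2"
    by (intro mult_mono sum_coordinates_le \<phi> x y finite_keys) (auto intro: sum_nonneg)
  finally show "cmod (\<phi> (fs_inner \<alpha> x y)) \<le> fs_norm \<alpha> x * fs_norm \<alpha> y"
    by (intro power2_le_imp_le[of "cmod _"]) (auto simp: power_mult_distrib)
qed simp

lemma fs_norm_triangle:
  assumes x: "x \<in> formal_sums D" and y: "y \<in> formal_sums D"
  shows "fs_norm \<alpha> (x + y) \<le> fs_norm \<alpha> x + fs_norm \<alpha> y"
proof (rule power2_le_imp_le)
  have "fs_inner \<alpha> (x + y) (x + y)
    = (fs_inner \<alpha> x x + fs_inner \<alpha> x y) + (fs_inner \<alpha> y x + fs_inner \<alpha> y y)"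
    using x y by (simp add: fs_inner_add_left fs_inner_add_right formal_sums_add)
  hence "norm (fs_inner \<alpha> (x + y) (x + y))
    \<le> (norm (fs_inner \<alpha> x x) + norm (fs_inner \<alpha> x y)) + (norm (fs_inner \<alpha> y x) + norm (fs_inner \<alpha> y y))"
    by (auto intro!: norm_triangle_le add_mono norm_triangle_ineq)
  also have "\<dots> \<le> (fs_norm \<alpha> x * fs_norm \<alpha> x + fs_norm \<alpha> x * fs_norm \<alpha> y)
      + (fs_norm \<alpha> y * fs_norm \<alpha> x + fs_norm \<alpha> y * fs_norm \<alpha> y)"
    by (intro add_mono fs_inner_cauchy_schwarz x y)
  also have "\<dots> = (fs_norm \<alpha> x + fs_norm \<alpha> y)\<^sup>2" by (simp add: power2_eq_square algebra_simps)
  finally show "(fs_norm \<alpha> (x + y))\<^sup>2 \<le> (fs_norm \<alpha> x + fs_norm \<alpha> y)\<^sup>2" by (simp add: fs_norm_def)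
qed simp

lemma fs_norm_diff_triangle:
  assumes "x \<in> formal_sums D" "y \<in> formal_sums D" "z \<in> formal_sums D"
  shows "fs_norm \<alpha> (x - z) \<le> fs_norm \<alpha> (x - y) + fs_norm \<alpha> (y - z)"
  using fs_norm_triangle[OF formal_sums_diff[OF assms(1,2)] formal_sums_diff[OF assms(2,3)]] by simp

lemma fs_norm_diff_commute:
  "x \<in> formal_sums D \<Longrightarrow> y \<in> formal_sums D \<Longrightarrow> fs_norm \<alpha> (x - y) = fs_norm \<alpha> (y - x)"
  using fs_norm_minus[OF formal_sums_diff, of x y] by simp

lemma fs_norm_single: "a \<in> D t \<Longrightarrow> fs_norm \<alpha> (Poly_Mapping.single t a) = norm a"
proof -
  assume a: "a \<in> D t"
  have "fs_inner \<alpha> (Poly_Mapping.single t a) (Poly_Mapping.single t a) = \<alpha> (- t) (star a * a)"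
    by (subst fs_inner_eq[OF formal_sums_single[OF a], of "{t}"]) auto
  thus ?thesis
    using norm_action[of "star a * a" "- t"] closed_ideal_mult_left[OF ideal a, of "star a"]
    by (simp add: fs_norm_def cstar_identity)
qed

subsection \<open>Left multiplication by a monomial\<close>

lemma formal_sums_fs_mult_single:
  assumes "b \<in> D t" "x \<in> formal_sums D"
  shows "fs_mult \<alpha> (Poly_Mapping.single t b) x \<in> formal_sums D"
proof -
  have "\<alpha> t (\<alpha> (- t) b * Poly_Mapping.lookup x (- t + r)) \<in> D (t + (- t + r))" for r
    by (intro action_image_Int closed_ideal_mult_right[OF ideal] closed_ideal_mult_left[OF ideal]
        action_minus_in assms(1) formal_sums_lookup[OF assms(2)])
  thus ?thesis by (simp add: formal_sums_def lookup_fs_mult_single flip: add.assoc)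
qed

lemma fs_mult_single_diff:
  assumes "b \<in> D t"
  shows "fs_mult \<alpha> (Poly_Mapping.single t b) (x - y)
    = fs_mult \<alpha> (Poly_Mapping.single t b) x - fs_mult \<alpha> (Poly_Mapping.single t b) y"
  by (rule poly_mapping_eqI)
    (simp add: lookup_fs_mult_single lookup_minus right_diff_distrib action_diff
      closed_ideal_mult_right[OF ideal] action_minus_in[OF assms])

text \<open>At a character, multiplication by the monomial translates the coordinates by
  \<open>t\<close> and multiplies each modulus by at most \<open>norm b\<close>.\<close>

lemma fs_norm_fs_mult_single_le:
  assumes b: "b \<in> D t" and x: "x \<in> formal_sums D"
  shows "fs_norm \<alpha> (fs_mult \<alpha> (Poly_Mapping.single t b) x) \<le> norm b * fs_norm \<alpha> x"
proof (rule fs_norm_leI[OF formal_sums_fs_mult_single[OF b x]])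
  fix \<phi> :: "'a \<Rightarrow> complex" assume \<phi>: "\<phi> \<in> characters"
  let ?z = "fs_mult \<alpha> (Poly_Mapping.single t b) x"
  let ?K = "Poly_Mapping.keys ?z"
  define c where "c = \<alpha> (- t) b"
  have c: "c \<in> D (- t)" "norm c = norm b"
    using b norm_action[of b "- t"] by (simp_all add: c_def action_minus_in)
  have coord: "cmod (coordinate \<phi> ?z r) \<le> norm b * cmod (coordinate \<phi> x (- t + r))" for r
  proof -
    define s where "s = - t + r"
    have r: "r = t + s" by (simp add: s_def flip: add.assoc)
    have xs: "Poly_Mapping.lookup x s \<in> D s" by (rule formal_sums_lookup[OF x])
    let ?f = "c * Poly_Mapping.lookup x s"
    have f: "?f \<in> D (- t)" "?f \<in> D s"
      using closed_ideal_mult_right[OF ideal c(1)] closed_ideal_mult_left[OF ideal xs] by auto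
    \<comment> \<open>Since \<open>r = t + s\<close>, the composite collapses to
      \<open>\<alpha> (- s)\<close>; its domain condition holds because the argument lies in both
      \<open>D (- t)\<close> and \<open>D s\<close>.\<close>
    have "\<alpha> (- r) (\<alpha> t ?f) = \<alpha> (- r + t) ?f"
      using action_image_Int[OF f] by (intro action_comp[OF f(1)]) (simp add: r)
    hence "coordinate \<phi> ?z r = \<phi> (\<alpha> (- s) ?f)"
      by (simp add: coordinate_def lookup_fs_mult_single r minus_add flip: c_def)
    thus ?thesis using cmod_action_le[OF \<phi>, of "Poly_Mapping.lookup x s" "- s" c] xs c(2)
      by (simp add: coordinate_def flip: s_def)
  qed
  have "(\<Sum>r\<in>?K. (cmod (coordinate \<phi> ?z r))\<^sup>2) \<le> (\<Sum>r\<in>?K. (norm b * cmod (coordinate \<phi> x (- t + r)))\<^sup>2)"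
    by (intro sum_mono power_mono coord) simp
  also have "\<dots> = (norm b)\<^sup>2 * (\<Sum>s\<in>(\<lambda>r. - t + r) ` ?K. (cmod (coordinate \<phi> x s))\<^sup>2)"
    by (subst sum.reindex) (auto simp: power_mult_distrib sum_distrib_left inj_on_def)
  also have "\<dots> \<le> (norm b)\<^sup>2 * (fs_norm \<alpha> x)\<^sup>2"
    by (intro mult_left_mono sum_coordinates_le \<phi> x) auto
  finally show "(\<Sum>r\<in>?K. (cmod (coordinate \<phi> ?z r))\<^sup>2) \<le> (norm b * fs_norm \<alpha> x)\<^sup>2"
    by (simp add: power_mult_distrib)
qed simp

subsection \<open>The completion\<close>

lemma l2_cauchy_in: "x \<in> l2_cauchy D \<alpha> \<Longrightarrow> x n \<in> formal_sums D"
  by (simp add: l2_cauchy_def)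

lemma equiv_l2_rel: "equiv (l2_cauchy D \<alpha>) (l2_rel D \<alpha>)"
proof (rule equivI)
  show "refl_on (l2_cauchy D \<alpha>) (l2_rel D \<alpha>)" by (auto simp: refl_on_def l2_rel_def)
  show "sym (l2_rel D \<alpha>)"
    by (auto simp: sym_def l2_rel_def fs_norm_diff_commute l2_cauchy_in)
  show "trans (l2_rel D \<alpha>)"
  proof (rule transI)
    fix x y z assume xy: "(x, y) \<in> l2_rel D \<alpha>" and yz: "(y, z) \<in> l2_rel D \<alpha>"
    hence in_cauchy: "x \<in> l2_cauchy D \<alpha>" "y \<in> l2_cauchy D \<alpha>" "z \<in> l2_cauchy D \<alpha>" by (auto simp: l2_rel_def)
    have "(\<lambda>n. fs_norm \<alpha> (x n - z n)) \<longlonglongrightarrow> 0"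
    proof (rule tendsto_sandwich[of "\<lambda>_. 0"])
      show "\<forall>\<^sub>F n in sequentially. fs_norm \<alpha> (x n - z n) \<le> fs_norm \<alpha> (x n - y n) + fs_norm \<alpha> (y n - z n)"
        using in_cauchy by (intro always_eventually allI fs_norm_diff_triangle l2_cauchy_in)
      show "(\<lambda>n. fs_norm \<alpha> (x n - y n) + fs_norm \<alpha> (y n - z n)) \<longlonglongrightarrow> 0"
        using xy yz by (intro tendsto_add_zero) (auto simp: l2_rel_def)
    qed auto
    thus "(x, z) \<in> l2_rel D \<alpha>" using in_cauchy by (simp add: l2_rel_def)
  qed
  show "l2_rel D \<alpha> \<subseteq> l2_cauchy D \<alpha> \<times> l2_cauchy D \<alpha>" by (auto simp: l2_rel_def)
qed

lemma fs_inner_diff_le: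
  assumes "x \<in> formal_sums D" "y \<in> formal_sums D" "x' \<in> formal_sums D" "y' \<in> formal_sums D"
  shows "norm (fs_inner \<alpha> x y - fs_inner \<alpha> x' y')
    \<le> fs_norm \<alpha> (x - x') * fs_norm \<alpha> y + fs_norm \<alpha> x' * fs_norm \<alpha> (y - y')"
proof -
  have "fs_inner \<alpha> x y = fs_inner \<alpha> (x - x') y + fs_inner \<alpha> x' y"
    using fs_inner_add_left[OF formal_sums_diff[OF assms(1,3)] assms(3,2)] by simp
  moreover have "fs_inner \<alpha> x' y = fs_inner \<alpha> x' (y - y') + fs_inner \<alpha> x' y'"
    using fs_inner_add_right[OF assms(3) formal_sums_diff[OF assms(2,4)] assms(4)] by simp
  ultimately have "fs_inner \<alpha> x y - fs_inner \<alpha> x' y' = fs_inner \<alpha> (x - x') y + fs_inner \<alpha> x' (y - y')"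
    by simp
  also have "norm \<dots> \<le> fs_norm \<alpha> (x - x') * fs_norm \<alpha> y + fs_norm \<alpha> x' * fs_norm \<alpha> (y - y')"
    by (intro norm_triangle_le add_mono fs_inner_cauchy_schwarz assms formal_sums_diff)
  finally show ?thesis .
qed

lemma l2_cauchy_bounded:
  assumes x: "x \<in> l2_cauchy D \<alpha>"
  obtains B where "0 < B" "\<And>n. fs_norm \<alpha> (x n) \<le> B"
proof -
  obtain N where N: "\<And>m n. m \<ge> N \<Longrightarrow> n \<ge> N \<Longrightarrow> fs_norm \<alpha> (x m - x n) < 1"
    using x unfolding l2_cauchy_def by force
  define B where "B = 1 + (\<Sum>n\<le>N. fs_norm \<alpha> (x n))"
  have le: "fs_norm \<alpha> (x n) \<le> (\<Sum>n\<le>N. fs_norm \<alpha> (x n))" if "n \<le> N" for n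
    using that by (intro member_le_sum) auto
  have "fs_norm \<alpha> (x n) \<le> B" for n
  proof (cases "n \<le> N")
    case False
    have "fs_norm \<alpha> ((x n - x N) + x N) \<le> fs_norm \<alpha> (x n - x N) + fs_norm \<alpha> (x N)"
      by (intro fs_norm_triangle formal_sums_diff l2_cauchy_in[OF x])
    thus ?thesis using N[of n N] le[of N] False by (simp add: B_def)
  qed (use le in \<open>fastforce simp: B_def\<close>)
  moreover have "0 < B" by (simp add: B_def add_pos_nonneg sum_nonneg)
  ultimately show thesis using that by blast
qed

lemma fs_inner_convergent:
  assumes x: "x \<in> l2_cauchy D \<alpha>"
  obtains a where "(\<lambda>n. fs_inner \<alpha> (x n) (x n)) \<longlonglongrightarrow> a"
proof -
  obtain B where B: "0 < B" "\<And>n. fs_norm \<alpha> (x n) \<le> B" using l2_cauchy_bounded[OF x] by blast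
  have "Cauchy (\<lambda>n. fs_inner \<alpha> (x n) (x n))"
  proof (rule metric_CauchyI)
    fix e :: real assume "0 < e"
    then obtain N where N: "\<And>m n. m \<ge> N \<Longrightarrow> n \<ge> N \<Longrightarrow> fs_norm \<alpha> (x m - x n) < e / (2 * B)"
      using x B(1) unfolding l2_cauchy_def by (auto dest!: spec[of _ "e / (2 * B)"])
    have "norm (fs_inner \<alpha> (x m) (x m) - fs_inner \<alpha> (x n) (x n)) < e" if "m \<ge> N" "n \<ge> N" for m n
    proof -
      let ?d = "fs_norm \<alpha> (x m - x n)"
      have "norm (fs_inner \<alpha> (x m) (x m) - fs_inner \<alpha> (x n) (x n)) \<le> ?d * fs_norm \<alpha> (x m) + fs_norm \<alpha> (x n) * ?d"
        by (intro fs_inner_diff_le l2_cauchy_in[OF x])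
      also have "\<dots> \<le> ?d * B + B * ?d"
        by (intro add_mono mult_mono B(2)) (use B(1) in auto)
      also have "\<dots> < e" using N[OF that] B(1) by (simp add: field_simps)
      finally show ?thesis .
    qed
    thus "\<exists>M. \<forall>m\<ge>M. \<forall>n\<ge>M. dist (fs_inner \<alpha> (x m) (x m)) (fs_inner \<alpha> (x n) (x n)) < e"
      unfolding dist_norm by blast
  qed
  thus thesis using that by (auto simp: Cauchy_convergent_iff convergent_def)
qed

text \<open>The inner product of classes is a limit over independent choices of both
  representatives, so \<open>y\<close> and \<open>z\<close> vary separately.\<close>

lemma fs_inner_limit:
  assumes xy: "(x, y) \<in> l2_rel D \<alpha>" and xz: "(x, z) \<in> l2_rel D \<alpha>"
    and a: "(\<lambda>n. fs_inner \<alpha> (x n) (x n)) \<longlonglongrightarrow> a"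
  shows "(\<lambda>n. fs_inner \<alpha> (y n) (z n)) \<longlonglongrightarrow> a"
proof -
  have in_cauchy: "x \<in> l2_cauchy D \<alpha>" "y \<in> l2_cauchy D \<alpha>" "z \<in> l2_cauchy D \<alpha>" using xy xz by (auto simp: l2_rel_def)
  obtain B where B: "0 < B" "\<And>n. fs_norm \<alpha> (x n) \<le> B" using l2_cauchy_bounded[OF in_cauchy(1)] by blast
  obtain C where C: "0 < C" "\<And>n. fs_norm \<alpha> (y n) \<le> C" using l2_cauchy_bounded[OF in_cauchy(2)] by blast
  have "(\<lambda>n. fs_inner \<alpha> (x n) (x n) - fs_inner \<alpha> (y n) (z n)) \<longlonglongrightarrow> 0"
  proof (rule tendsto_norm_zero_cancel, rule tendsto_sandwich[of "\<lambda>_. 0"])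
    show "\<forall>\<^sub>F n in sequentially. norm (fs_inner \<alpha> (x n) (x n) - fs_inner \<alpha> (y n) (z n))
        \<le> fs_norm \<alpha> (x n - y n) * B + C * fs_norm \<alpha> (x n - z n)"
    proof (intro always_eventually allI)
      fix n
      have "norm (fs_inner \<alpha> (x n) (x n) - fs_inner \<alpha> (y n) (z n))
          \<le> fs_norm \<alpha> (x n - y n) * fs_norm \<alpha> (x n) + fs_norm \<alpha> (y n) * fs_norm \<alpha> (x n - z n)"
        by (intro fs_inner_diff_le l2_cauchy_in in_cauchy)
      also have "\<dots> \<le> fs_norm \<alpha> (x n - y n) * B + C * fs_norm \<alpha> (x n - z n)"
        by (intro add_mono mult_mono B(2) C(2)) (use B(1) C(1) in auto)
      finally show "norm (fs_inner \<alpha> (x n) (x n) - fs_inner \<alpha> (y n) (z n))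
          \<le> fs_norm \<alpha> (x n - y n) * B + C * fs_norm \<alpha> (x n - z n)" .
    qed
    have "(\<lambda>n. fs_norm \<alpha> (x n - y n)) \<longlonglongrightarrow> 0" "(\<lambda>n. fs_norm \<alpha> (x n - z n)) \<longlonglongrightarrow> 0"
      using xy xz by (auto simp: l2_rel_def)
    thus "(\<lambda>n. fs_norm \<alpha> (x n - y n) * B + C * fs_norm \<alpha> (x n - z n)) \<longlonglongrightarrow> 0"
      by (intro tendsto_add_zero tendsto_mult_left_zero tendsto_mult_right_zero)
  qed auto
  from tendsto_diff[OF a this] show ?thesis by simp
qed

text \<open>Evaluates the definite description in \<open>l2_inner\<close>, so that estimates in the
  completion become limits of estimates for formal sums.\<close>

lemma l2_norm_class:
  assumes x: "x \<in> l2_cauchy D \<alpha>"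
  shows "(\<lambda>n. fs_norm \<alpha> (x n)) \<longlonglongrightarrow> l2_norm \<alpha> (l2_rel D \<alpha> `` {x})"
proof -
  obtain a where a: "(\<lambda>n. fs_inner \<alpha> (x n) (x n)) \<longlonglongrightarrow> a" using fs_inner_convergent[OF x] by blast
  have xx: "(x, x) \<in> l2_rel D \<alpha>" using equiv_class_self[OF equiv_l2_rel x] by simp
  have "l2_inner \<alpha> (l2_rel D \<alpha> `` {x}) (l2_rel D \<alpha> `` {x}) = a"
    unfolding l2_inner_def
  proof (rule the_equality)
    show "\<forall>y\<in>l2_rel D \<alpha> `` {x}. \<forall>z\<in>l2_rel D \<alpha> `` {x}. (\<lambda>n. fs_inner \<alpha> (y n) (z n)) \<longlonglongrightarrow> a"
      using fs_inner_limit a by blast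
    fix b assume "\<forall>y\<in>l2_rel D \<alpha> `` {x}. \<forall>z\<in>l2_rel D \<alpha> `` {x}. (\<lambda>n. fs_inner \<alpha> (y n) (z n)) \<longlonglongrightarrow> b"
    hence "(\<lambda>n. fs_inner \<alpha> (x n) (x n)) \<longlonglongrightarrow> b" using xx by blast
    thus "b = a" using a by (rule LIMSEQ_unique)
  qed
  thus ?thesis unfolding l2_norm_def fs_norm_def using a by (auto intro!: tendsto_intros)
qed

lemma l2_cauchy_fs_mult_single:
  assumes b: "b \<in> D t" and x: "x \<in> l2_cauchy D \<alpha>"
  shows "(\<lambda>n. fs_mult \<alpha> (Poly_Mapping.single t b) (x n)) \<in> l2_cauchy D \<alpha>"
  unfolding l2_cauchy_def
proof (intro CollectI conjI allI impI)
  fix n show "fs_mult \<alpha> (Poly_Mapping.single t b) (x n) \<in> formal_sums D"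
    by (intro formal_sums_fs_mult_single b l2_cauchy_in x)
next
  fix e :: real assume e: "0 < e"
  let ?z = "Poly_Mapping.single t b"
  have pos: "0 < norm b + 1" by (simp add: add_nonneg_pos)
  hence "0 < e / (norm b + 1)" using e by simp
  then obtain N where N: "\<And>m n. m \<ge> N \<Longrightarrow> n \<ge> N \<Longrightarrow> fs_norm \<alpha> (x m - x n) < e / (norm b + 1)"
    using x unfolding l2_cauchy_def by blast
  have "fs_norm \<alpha> (fs_mult \<alpha> ?z (x m) - fs_mult \<alpha> ?z (x n)) < e" if "m \<ge> N" "n \<ge> N" for m n
  proof -
    have "fs_norm \<alpha> (fs_mult \<alpha> ?z (x m) - fs_mult \<alpha> ?z (x n)) \<le> norm b * fs_norm \<alpha> (x m - x n)"
      unfolding fs_mult_single_diff[OF b, symmetric]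
      by (intro fs_norm_fs_mult_single_le b formal_sums_diff l2_cauchy_in[OF x])
    also have "\<dots> \<le> (norm b + 1) * fs_norm \<alpha> (x m - x n)" by (simp add: mult_right_mono)
    also have "\<dots> < e" using N[OF that] pos by (simp add: field_simps)
    finally show ?thesis .
  qed
  thus "\<exists>N. \<forall>m\<ge>N. \<forall>n\<ge>N. fs_norm \<alpha> (fs_mult \<alpha> ?z (x m) - fs_mult \<alpha> ?z (x n)) < e" by blast
qed

lemma left_mult_class:
  assumes b: "b \<in> D t" and x: "x \<in> l2_cauchy D \<alpha>"
  shows "left_mult D \<alpha> (Poly_Mapping.single t b) (l2_rel D \<alpha> `` {x})
    = l2_rel D \<alpha> `` {\<lambda>n. fs_mult \<alpha> (Poly_Mapping.single t b) (x n)}"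
proof -
  let ?z = "Poly_Mapping.single t b"
  have "l2_rel D \<alpha> `` {\<lambda>n. fs_mult \<alpha> ?z (y n)} = l2_rel D \<alpha> `` {\<lambda>n. fs_mult \<alpha> ?z (x n)}"
    if "y \<in> l2_rel D \<alpha> `` {x}" for y
  proof (rule sym, rule equiv_class_eq[OF equiv_l2_rel])
    have y: "y \<in> l2_cauchy D \<alpha>" and lim: "(\<lambda>n. fs_norm \<alpha> (x n - y n)) \<longlonglongrightarrow> 0"
      using that by (auto simp: l2_rel_def)
    have "(\<lambda>n. fs_norm \<alpha> (fs_mult \<alpha> ?z (x n) - fs_mult \<alpha> ?z (y n))) \<longlonglongrightarrow> 0"
    proof (rule tendsto_sandwich[of "\<lambda>_. 0"])
      show "\<forall>\<^sub>F n in sequentially. fs_norm \<alpha> (fs_mult \<alpha> ?z (x n) - fs_mult \<alpha> ?z (y n)) \<le> norm b * fs_norm \<alpha> (x n - y n)"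
        unfolding fs_mult_single_diff[OF b, symmetric]
        by (intro always_eventually allI fs_norm_fs_mult_single_le b formal_sums_diff l2_cauchy_in x y)
      show "(\<lambda>n. norm b * fs_norm \<alpha> (x n - y n)) \<longlonglongrightarrow> 0" using lim by (rule tendsto_mult_right_zero)
    qed auto
    thus "(\<lambda>n. fs_mult \<alpha> ?z (x n), \<lambda>n. fs_mult \<alpha> ?z (y n)) \<in> l2_rel D \<alpha>"
      using l2_cauchy_fs_mult_single[OF b] x y by (simp add: l2_rel_def)
  qed
  hence "(\<Union>y\<in>l2_rel D \<alpha> `` {x}. l2_rel D \<alpha> `` {\<lambda>n. fs_mult \<alpha> ?z (y n)})
    = (\<Union>y\<in>l2_rel D \<alpha> `` {x}. l2_rel D \<alpha> `` {\<lambda>n. fs_mult \<alpha> ?z (x n)})" by (rule SUP_cong[OF refl])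
  also have "\<dots> = l2_rel D \<alpha> `` {\<lambda>n. fs_mult \<alpha> ?z (x n)}"
    using equiv_class_self[OF equiv_l2_rel x] by (subst UN_constant) auto
  moreover have "l2_rel D \<alpha> `` {x} \<in> l2 D \<alpha>" unfolding l2_def by (rule quotientI[OF x])
  ultimately show ?thesis unfolding left_mult_def by simp
qed

lemma reduced_norm_single:
  assumes b: "b \<in> D t"
  shows "reduced_norm D \<alpha> (Poly_Mapping.single t b) = norm b"
proof -
  let ?z = "Poly_Mapping.single t b" and ?B = "{\<xi> \<in> l2 D \<alpha>. l2_norm \<alpha> \<xi> \<le> 1}"
  have upper: "l2_norm \<alpha> (left_mult D \<alpha> ?z \<xi>) \<le> norm b" if \<xi>: "\<xi> \<in> ?B" for \<xi>
  proof -
    obtain x where x: "x \<in> l2_cauchy D \<alpha>" "\<xi> = l2_rel D \<alpha> `` {x}"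
      using \<xi> by (auto simp: l2_def elim: quotientE)
    have "l2_norm \<alpha> (left_mult D \<alpha> ?z \<xi>) \<le> norm b * l2_norm \<alpha> \<xi>"
      unfolding x(2) left_mult_class[OF b x(1)]
    proof (rule LIMSEQ_le[OF l2_norm_class tendsto_mult_left[OF l2_norm_class]])
      show "\<exists>N. \<forall>n\<ge>N. fs_norm \<alpha> (fs_mult \<alpha> ?z (x n)) \<le> norm b * fs_norm \<alpha> (x n)"
        using fs_norm_fs_mult_single_le[OF b l2_cauchy_in[OF x(1)]] by blast
    qed (use x l2_cauchy_fs_mult_single[OF b] in auto)
    also have "\<dots> \<le> norm b * 1" using \<xi> by (intro mult_left_mono) auto
    finally show ?thesis by simp
  qed
  define d where "d = \<alpha> (- t) b"
  \<comment> \<open>The normalized adjoint of \<open>d\<close>: the vector \<open>c\<close> at the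
    identity attains the norm, since \<open>norm (d * c) = norm b\<close> by the C*-identity. If
    \<open>b = 0\<close>, the convention \<open>inverse 0 = 0\<close> gives
    \<open>c = 0\<close>.\<close>
  define c where "c = inverse (norm b) *\<^sub>R star d"
  define x where "x = (\<lambda>n::nat. Poly_Mapping.single (0::'g) c)"
  have d: "d \<in> D (- t)" "norm d = norm b"
    using b norm_action[of b "- t"] by (simp_all add: d_def action_minus_in)
  have "Poly_Mapping.single (0::'g) c \<in> formal_sums D" by (rule formal_sums_single) (simp add: D_zero)
  hence x: "x \<in> l2_cauchy D \<alpha>" by (auto simp: x_def l2_cauchy_def)
  have "l2_norm \<alpha> (l2_rel D \<alpha> `` {x}) = norm c"
    using l2_norm_class[OF x] by (simp add: x_def fs_norm_single D_zero LIMSEQ_const_iff)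
  also have "\<dots> \<le> 1" using d(2) by (cases "b = 0") (simp_all add: c_def)
  finally have mem: "l2_rel D \<alpha> `` {x} \<in> ?B" using x by (simp add: l2_def quotientI)
  have dc: "d * c \<in> D (- t)" by (rule closed_ideal_mult_right[OF ideal d(1)])
  have zx: "fs_mult \<alpha> ?z (x n) = Poly_Mapping.single t (\<alpha> t (d * c))" for n
    by (simp add: x_def fs_mult_single_single flip: d_def)
  have "l2_norm \<alpha> (left_mult D \<alpha> ?z (l2_rel D \<alpha> `` {x})) = norm (d * c)"
    using l2_norm_class[OF l2_cauchy_fs_mult_single[OF b x], unfolded zx]
    unfolding left_mult_class[OF b x] zx
    by (simp add: fs_norm_single[OF action_in[OF dc]] norm_action[OF dc] LIMSEQ_const_iff)
  also have "\<dots> = norm b"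
    using cstar_identity[of d] d(2)
    by (cases "b = 0") (simp_all add: c_def mult.commute power2_eq_square)
  finally have attained: "l2_norm \<alpha> (left_mult D \<alpha> ?z (l2_rel D \<alpha> `` {x})) = norm b" .
  show ?thesis unfolding reduced_norm_def l2_op_norm_def
  proof (rule antisym)
    show "(SUP \<xi>\<in>?B. l2_norm \<alpha> (left_mult D \<alpha> ?z \<xi>)) \<le> norm b"
      using mem upper by (intro cSUP_least) auto
    show "norm b \<le> (SUP \<xi>\<in>?B. l2_norm \<alpha> (left_mult D \<alpha> ?z \<xi>))"
      unfolding attained[symmetric] using upper mem by (intro cSUP_upper bdd_aboveI2) auto
  qed
qed

end

section \<open>Topological freeness\<close>

lemma positive_element_selfadjoint:
  "positive_element x \<Longrightarrow> star x = (x :: 'a::cstar_algebra)"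
  by (auto simp: positive_element_def star_mult star_star)

lemma norm_square_selfadjoint:
  "star x = x \<Longrightarrow> norm (x * x) = (norm (x :: 'a::cstar_algebra))\<^sup>2"
  using cstar_identity[of x] by simp

text \<open>The element keeps its explicit form because factors of \<open>f\<close> are extracted
  from it later.\<close>

lemma exists_positive_element_unit:
  fixes I :: "'a::{cstar_algebra,comm_ring} set"
  assumes "closed_ideal I" "f \<in> I" "f \<noteq> 0"
  obtains c where "positive_element (star (c *\<^sub>R f) * (c *\<^sub>R f))" "norm (star (c *\<^sub>R f) * (c *\<^sub>R f)) = 1"
    "star (c *\<^sub>R f) * (c *\<^sub>R f) \<in> I"
proof
  let ?y = "(1 / norm f) *\<^sub>R f"
  show "positive_element (star ?y * ?y)" by (rule positive_element_star_mult)
  show "norm (star ?y * ?y) = 1" using assms(3) by (simp only: cstar_identity) simp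
  show "star ?y * ?y \<in> I"
    by (intro closed_ideal_mult_left[OF assms(1)] closed_ideal_scaleR[OF assms(1)] assms(2))
qed

lemma Inf_eq_0I:
  fixes S :: "real set"
  assumes "0 \<in> S" "\<And>r. r \<in> S \<Longrightarrow> 0 \<le> r"
  shows "Inf S = 0"
  using assms by (intro cInf_eq_minimum) auto

lemma Inf_image_eq_1:
  assumes "\<exists>x. P x" "\<And>x. P x \<Longrightarrow> f x = (1::real)"
  shows "Inf {f x | x. P x} = 1"
proof -
  have "{f x | x. P x} = {1}" using assms by (auto, metis)
  thus ?thesis by simp
qed

text \<open>The element is dominated by \<open>(norm z)^2\<close> times \<open>star b * b\<close>.
  This permits localizing inside \<open>B\<close> by an arbitrary \<open>z\<close>.\<close>

lemma hereditary_subalgebra_dominated: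
  fixes b z :: "'a::{cstar_algebra,comm_ring}"
  assumes B: "hereditary_subalgebra B" and b: "b \<in> B"
  shows "star (b * z) * (b * z) \<in> B"
proof -
  define w where "w = (norm z)\<^sup>2 *\<^sub>R (star b * b)"
  have "w \<in> B"
    using B b unfolding hereditary_subalgebra_def cstar_subalgebra_def complex_subspace_def w_def scaleR_scaleC
    by blast
  moreover have "positive_element (w - star (b * z) * (b * z))"
    unfolding positive_element_iff
  proof
    fix \<phi> :: "'a \<Rightarrow> complex" assume \<phi>: "\<phi> \<in> characters"
    have "\<phi> (w - star (b * z) * (b * z)) = of_real ((norm z)\<^sup>2 * (cmod (\<phi> b))\<^sup>2 - (cmod (\<phi> (b * z)))\<^sup>2)"
      unfolding w_def character_diff[OF \<phi>] character_scaleR[OF \<phi>] character_star_self[OF \<phi>] by simp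
    also have "(cmod (\<phi> (b * z)))\<^sup>2 = (cmod (\<phi> z))\<^sup>2 * (cmod (\<phi> b))\<^sup>2"
      by (simp add: character_mult[OF \<phi>] norm_mult power_mult_distrib)
    finally have "\<phi> (w - star (b * z) * (b * z)) = of_real ((norm z)\<^sup>2 * (cmod (\<phi> b))\<^sup>2 - (cmod (\<phi> z))\<^sup>2 * (cmod (\<phi> b))\<^sup>2)" .
    moreover have "(cmod (\<phi> z))\<^sup>2 * (cmod (\<phi> b))\<^sup>2 \<le> (norm z)\<^sup>2 * (cmod (\<phi> b))\<^sup>2"
      by (intro mult_right_mono power_mono character_norm_le[OF \<phi>]) auto
    ultimately show "Im (\<phi> (w - star (b * z) * (b * z))) = 0 \<and> 0 \<le> Re (\<phi> (w - star (b * z) * (b * z)))"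
      by simp
  qed
  ultimately show ?thesis
    using B positive_element_star_mult unfolding hereditary_subalgebra_def by blast
qed

lemma hereditary_subalgebra_vanishing:
  fixes V :: "('a::{cstar_algebra,comm_ring} \<Rightarrow> complex) set"
  assumes V: "V \<subseteq> characters"
  shows "hereditary_subalgebra {f. \<forall>\<phi>\<in>V. \<phi> f = 0}" (is "hereditary_subalgebra ?B")
proof -
  have I: "closed_ideal ?B" by (rule closed_ideal_vanishing[OF V])
  have "a \<in> ?B" if b: "b \<in> ?B" and a: "positive_element a" "positive_element (b - a)" for a b
  proof (intro CollectI ballI)
    fix \<phi> assume \<phi>V: "\<phi> \<in> V"
    hence \<phi>: "\<phi> \<in> characters" using V by blast
    have "\<phi> b = 0" using b \<phi>V by blast
    hence "Re (\<phi> a) \<le> 0"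
      using positive_element_character(2)[OF a(2) \<phi>] by (simp add: character_diff[OF \<phi>])
    thus "\<phi> a = 0"
      using positive_element_character[OF a(1) \<phi>] by (simp add: complex_eq_iff)
  qed
  moreover have "cstar_subalgebra ?B"
    using closed_ideal_star[OF I] closed_ideal_mult_left[OF I] I
    unfolding cstar_subalgebra_def closed_ideal_def by blast
  ultimately show ?thesis unfolding hereditary_subalgebra_def by blast
qed

section \<open>Ideals on which the action is trivial\<close>

context abelian_partial_system
begin

text \<open>Some nonzero \<open>f\<close> is nonzero only at fixed points, and \<open>K\<close>
  consists of the elements of \<open>D (- t)\<close> that vanish wherever \<open>f\<close> does. At
  the fixed points in question \<open>\<alpha> t g\<close> and \<open>g\<close> agree by duality;
  where \<open>f\<close> vanishes, both vanish.\<close>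

lemma not_topologically_freeD:
  assumes "\<not> topologically_free D \<alpha>"
  obtains t K where "t \<noteq> 0" "closed_ideal K" "K \<subseteq> D (- t)" "K \<noteq> {0}" "\<And>g. g \<in> K \<Longrightarrow> \<alpha> t g = g"
proof -
  obtain t f where t: "t \<noteq> 0" and f: "f \<in> D (- t)" "f \<noteq> 0"
    and fixed: "\<And>\<phi>. \<phi> \<in> characters \<Longrightarrow> \<phi> f \<noteq> 0 \<Longrightarrow> dual_map D \<alpha> t \<phi> = \<phi>"
    using assms unfolding topologically_free_iff by blast
  define K where "K = D (- t) \<inter> {g. \<forall>\<phi>\<in>{\<phi> \<in> characters. \<phi> f = 0}. \<phi> g = 0}"
  have "closed_ideal K"
    unfolding K_def by (intro closed_ideal_Int closed_ideal_vanishing ideal) auto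
  moreover have "f \<in> K" using f(1) by (simp add: K_def)
  hence "K \<noteq> {0}" using f(2) by blast
  moreover have "\<alpha> t g = g" if "g \<in> K" for g
  proof (rule eq_by_characters)
    fix \<omega> :: "'a \<Rightarrow> complex" assume \<omega>: "\<omega> \<in> characters"
    have g: "g \<in> D (- t)" and van: "\<And>\<phi>. \<phi> \<in> characters \<Longrightarrow> \<phi> f = 0 \<Longrightarrow> \<phi> g = 0"
      using that by (auto simp: K_def)
    show "\<omega> (\<alpha> t g) = \<omega> g"
    proof (cases "\<omega> f = 0")
      case False
      have "\<omega> \<in> open_support (D (- t))" using \<omega> f(1) False by (rule open_supportI)
      thus ?thesis using dual_map_eval[OF _ g] fixed[OF \<omega> False] by metis
    next
      case True
      have "\<omega> (\<alpha> t g) = 0"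
      proof (rule ccontr)
        \<comment> \<open>A point where \<open>\<alpha> t g\<close> is nonzero is the image of a
          point where \<open>g\<close>, hence \<open>f\<close>, is nonzero. That point is fixed, so
          it is \<open>\<omega>\<close> itself, although \<open>\<omega> f = 0\<close>.\<close>
        assume nz: "\<omega> (\<alpha> t g) \<noteq> 0"
        have supp: "\<omega> \<in> open_support (D t)" using \<omega> action_in[OF g] nz by (rule open_supportI)
        let ?\<psi> = "dual_map D \<alpha> (- t) \<omega>"
        have \<psi>: "?\<psi> \<in> characters"
          using dual_map_in[of \<omega> "- t"] supp by (simp add: open_support_def)
        have "?\<psi> g = \<omega> (\<alpha> t g)"
          using dual_map_eval_inverse[of \<omega> "- t" g] supp g by simp
        hence "?\<psi> f \<noteq> 0" using van[OF \<psi>] nz by auto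
        hence "dual_map D \<alpha> t ?\<psi> = ?\<psi>" by (rule fixed[OF \<psi>])
        hence "?\<psi> = \<omega>" using dual_map_inverse[OF supp] by simp
        thus False using \<open>?\<psi> f \<noteq> 0\<close> True by simp
      qed
      thus ?thesis using van[OF \<omega> True] by simp
    qed
  qed
  moreover have "K \<subseteq> D (- t)" by (auto simp: K_def)
  ultimately show thesis using t that by blast
qed

lemma topologically_freeD:
  assumes "topologically_free D \<alpha>" "t \<noteq> 0" "f \<in> D (- t)" "f \<noteq> 0"
  obtains \<phi> where "\<phi> \<in> characters" "\<phi> f \<noteq> 0" "dual_map D \<alpha> t \<phi> \<noteq> \<phi>"
  using assms unfolding topologically_free_iff by blast

lemma nonzero_ideal:
  assumes "closed_ideal K" "K \<noteq> {0}"
  obtains f where "f \<in> K" "f \<noteq> 0"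
  using closed_ideal_zero[OF assms(1)] assms(2) by blast

subsection \<open>The distance of the action from the identity\<close>

lemma topologically_free_iff_norm:
  "topologically_free D \<alpha> \<longleftrightarrow>
    (\<forall>t. t \<noteq> 0 \<longrightarrow>
      (\<forall>K. closed_ideal K \<and> K \<subseteq> D (- t) \<and> K \<noteq> {0} \<and> \<alpha> t ` K = K \<longrightarrow>
         norm_on K (\<lambda>x. \<alpha> t x - x) = 2))" (is "_ \<longleftrightarrow> ?R")
proof
  assume tf: "topologically_free D \<alpha>"
  show ?R
  proof (intro allI impI, elim conjE)
    fix t K assume t: "t \<noteq> 0" and K: "closed_ideal K" "K \<subseteq> D (- t)" "K \<noteq> {0}" "\<alpha> t ` K = K"
    obtain f where f: "f \<in> K" "f \<noteq> 0" using nonzero_ideal[OF K(1,3)] .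
    obtain \<phi> where \<phi>: "\<phi> \<in> characters" "\<phi> f \<noteq> 0" "dual_map D \<alpha> t \<phi> \<noteq> \<phi>"
      using topologically_freeD[OF tf t _ f(2)] f(1) K(2) by blast
    let ?\<psi> = "dual_map D \<alpha> t \<phi>"
    have supp: "\<phi> \<in> open_support (D (- t))" using \<phi> f K(2) by (blast intro: open_supportI)
    have \<psi>: "?\<psi> \<in> characters" using dual_map_in[OF supp] by (simp add: open_support_def)
    \<comment> \<open>Invariance of \<open>K\<close> puts the image point into the support of
      \<open>K\<close>, so values can be prescribed at both points by an element of
      \<open>K\<close>.\<close>
    have "\<alpha> t f \<in> K" using f(1) K(4) by blast
    moreover have "?\<psi> (\<alpha> t f) \<noteq> 0" using dual_map_eval[OF supp] f(1) K(2) \<phi>(2) by (simp add: subset_iff)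
    ultimately have \<psi>K: "?\<psi> \<in> open_support K" by (rule open_supportI[OF \<psi>])
    have \<phi>K: "\<phi> \<in> open_support K" using \<phi>(1) f(1) \<phi>(2) by (rule open_supportI)
    obtain u where u: "u \<in> K" "positive_element u" "\<phi> u = 1" "?\<psi> u = 0"
      using separating_element[OF K(1) \<phi>K \<psi> \<phi>(3)[symmetric]] .
    obtain v where v: "v \<in> K" "positive_element v" "?\<psi> v = 1" "\<phi> v = 0"
      using separating_element[OF K(1) \<psi>K \<phi>(1) \<phi>(3)] .
    have real: "\<forall>\<omega>\<in>characters. Im (\<omega> (u - v)) = 0"
      using u(2) v(2) by (simp add: positive_element_iff character_diff)
    \<comment> \<open>Truncation to \<open>[-1, 1]\<close> secures norm at most 1 and keeps the
      values 1 and -1 of \<open>u - v\<close> at the two points.\<close>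
    obtain y where y: "y \<in> K"
      "\<And>\<omega>. \<omega> \<in> characters \<Longrightarrow> \<omega> y = of_real (max (-1) (min 1 (Re (\<omega> (u - v)))))"
      by (rule continuous_calculus[OF K(1) closed_ideal_diff[OF K(1) u(1) v(1)] real,
            where g = "\<lambda>r. max (-1) (min 1 r)"])
         (auto intro!: continuous_intros)
    have ny: "norm y \<le> 1"
    proof (rule norm_le_by_characters)
      fix \<omega> :: "'a \<Rightarrow> complex" assume "\<omega> \<in> characters"
      thus "cmod (\<omega> y) \<le> 1" by (simp only: y(2) norm_of_real)
    qed simp
    have "\<phi> y = 1" "?\<psi> y = -1"
      using u v by (simp_all add: y(2)[OF \<phi>(1)] y(2)[OF \<psi>] character_diff[OF \<phi>(1)] character_diff[OF \<psi>])
    \<comment> \<open>Duality turns the value of \<open>\<alpha> t y\<close> at the image point into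
      \<open>\<phi> y = 1\<close>.\<close>
    hence "?\<psi> (\<alpha> t y - y) = 2"
      using dual_map_eval[OF supp, of y] y(1) K(2) by (simp add: character_diff[OF \<psi>] subset_iff)
    hence ge: "2 \<le> norm (\<alpha> t y - y)" using character_norm_le[OF \<psi>, of "\<alpha> t y - y"] by simp
    have le: "norm (\<alpha> t x - x) \<le> 2" if "x \<in> {x \<in> K. norm x \<le> 1}" for x
    proof -
      have "norm (\<alpha> t x) \<le> norm x" using norm_action_le[of x t] that K(2) by blast
      thus ?thesis using norm_triangle_ineq4[of "\<alpha> t x" x] that by simp
    qed
    show "norm_on K (\<lambda>x. \<alpha> t x - x) = 2"
      unfolding norm_on_def
    proof (rule antisym)
      show "(SUP x\<in>{x \<in> K. norm x \<le> 1}. norm (\<alpha> t x - x)) \<le> 2"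
        using le y(1) ny by (intro cSUP_least) auto
      show "2 \<le> (SUP x\<in>{x \<in> K. norm x \<le> 1}. norm (\<alpha> t x - x))"
      proof (rule order_trans[OF ge])
        have bdd: "bdd_above ((\<lambda>x. norm (\<alpha> t x - x)) ` {x \<in> K. norm x \<le> 1})"
          using le by (rule bdd_aboveI2)
        show "norm (\<alpha> t y - y) \<le> (SUP x\<in>{x \<in> K. norm x \<le> 1}. norm (\<alpha> t x - x))"
          using y(1) ny by (intro cSUP_upper[OF _ bdd]) simp
      qed
    qed
  qed
next
  assume R: ?R
  show "topologically_free D \<alpha>"
  proof (rule ccontr)
    assume "\<not> topologically_free D \<alpha>"
    then obtain t K where tK: "t \<noteq> 0" "closed_ideal K" "K \<subseteq> D (- t)" "K \<noteq> {0}"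
      "\<And>g. g \<in> K \<Longrightarrow> \<alpha> t g = g"
      by (rule not_topologically_freeD) blast
    have "\<alpha> t ` K = K" using tK(5) by force
    hence "norm_on K (\<lambda>x. \<alpha> t x - x) = 2" using R tK(1-4) by blast
    moreover have "norm_on K (\<lambda>x. \<alpha> t x - x) = (SUP x\<in>{x \<in> K. norm x \<le> 1}. 0)"
      unfolding norm_on_def using tK(5) by (intro SUP_cong) auto
    moreover have "0 \<in> {x \<in> K. norm x \<le> 1}" using closed_ideal_zero[OF tK(2)] by simp
    hence "(SUP x\<in>{x \<in> K. norm x \<le> 1}. 0) = (0::real)" by (subst cSUP_const) auto
    ultimately show False by simp
  qed
qed

subsection \<open>Elements almost orthogonal to their images\<close>

lemma topologically_free_iff_Inf_ideal:
  "topologically_free D \<alpha> \<longleftrightarrow>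
    (\<forall>t. t \<noteq> 0 \<longrightarrow>
      (\<forall>K. closed_ideal K \<and> K \<subseteq> D (- t) \<and> K \<noteq> {0} \<longrightarrow>
         Inf {norm (x * \<alpha> t x) | x. x \<in> K \<and> positive_element x \<and> norm x = 1} = 0))" (is "_ \<longleftrightarrow> ?R")
proof
  assume tf: "topologically_free D \<alpha>"
  show ?R
  proof (intro allI impI, elim conjE)
    fix t K assume t: "t \<noteq> 0" and K: "closed_ideal K" "K \<subseteq> D (- t)" "K \<noteq> {0}"
    obtain f where f: "f \<in> K" "f \<noteq> 0" using nonzero_ideal[OF K(1,3)] .
    obtain \<phi> where \<phi>: "\<phi> \<in> characters" "\<phi> f \<noteq> 0" "dual_map D \<alpha> t \<phi> \<noteq> \<phi>"
      using topologically_freeD[OF tf t _ f(2)] f(1) K(2) by blast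
    have supp: "\<phi> \<in> open_support (D (- t))" using \<phi> f K(2) by (blast intro: open_supportI)
    obtain p r where pr: "r \<in> D (- t)" "\<phi> p \<noteq> 0" "\<phi> r \<noteq> 0" "p * \<alpha> t r = 0"
      using moved_point[OF supp \<phi>(3)] .
    define y where "y = f * p * r"
    have yK: "y \<in> K" unfolding y_def by (intro closed_ideal_mult_right[OF K(1)] f(1))
    have "\<phi> y \<noteq> 0" using \<phi> pr by (simp add: y_def character_mult[OF \<phi>(1)])
    hence "y \<noteq> 0" using character_zero[OF \<phi>(1)] by auto
    then obtain c where unit: "positive_element (star (c *\<^sub>R y) * (c *\<^sub>R y))"
      "norm (star (c *\<^sub>R y) * (c *\<^sub>R y)) = 1" "star (c *\<^sub>R y) * (c *\<^sub>R y) \<in> K"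
      by (rule exists_positive_element_unit[OF K(1) yK])
    \<comment> \<open>\<open>\<alpha> t\<close> is multiplicative only on \<open>D (- t)\<close>, so
      the cofactor \<open>z\<close> of \<open>r\<close> in \<open>x\<close> must lie there too; its
      factor \<open>f\<close> ensures this.\<close>
    define x z where "x = star (c *\<^sub>R y) * (c *\<^sub>R y)" and "z = star (c *\<^sub>R y) * (c *\<^sub>R (f * p))"
    have z: "z \<in> D (- t)"
      unfolding z_def using f(1) K(2)
      by (intro closed_ideal_mult_left[OF ideal] closed_ideal_scaleR[OF ideal] closed_ideal_mult_right[OF ideal]) auto
    have xz: "x = z * r" by (simp add: x_def z_def y_def algebra_simps)
    have "x = star (c *\<^sub>R y) * (c *\<^sub>R (f * r)) * p" by (simp add: x_def y_def algebra_simps)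
    moreover have "\<alpha> t x = \<alpha> t z * \<alpha> t r" unfolding xz by (rule action_mult[OF z pr(1)])
    ultimately have "x * \<alpha> t x = star (c *\<^sub>R y) * (c *\<^sub>R (f * r)) * \<alpha> t z * (p * \<alpha> t r)"
      by (simp add: algebra_simps)
    hence "0 = norm (x * \<alpha> t x)" using pr(4) by simp
    thus "Inf {norm (x * \<alpha> t x) | x. x \<in> K \<and> positive_element x \<and> norm x = 1} = 0"
      using unit[folded x_def] by (intro Inf_eq_0I) auto
  qed
next
  assume R: ?R
  show "topologically_free D \<alpha>"
  proof (rule ccontr)
    assume "\<not> topologically_free D \<alpha>"
    then obtain t K where tK: "t \<noteq> 0" "closed_ideal K" "K \<subseteq> D (- t)" "K \<noteq> {0}"
      "\<And>g. g \<in> K \<Longrightarrow> \<alpha> t g = g"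
      by (rule not_topologically_freeD) blast
    obtain f where f: "f \<in> K" "f \<noteq> 0" using nonzero_ideal[OF tK(2,4)] .
    have "Inf {norm (x * \<alpha> t x) | x. x \<in> K \<and> positive_element x \<and> norm x = 1} = 1"
    proof (rule Inf_image_eq_1)
      show "\<exists>x. x \<in> K \<and> positive_element x \<and> norm x = 1"
        using exists_positive_element_unit[OF tK(2) f] by metis
      fix x assume "x \<in> K \<and> positive_element x \<and> norm x = 1"
      thus "norm (x * \<alpha> t x) = 1"
        using tK(5) by (simp add: norm_square_selfadjoint positive_element_selfadjoint)
    qed
    thus False using R tK(1-4) by fastforce
  qed
qed

subsection \<open>Compressions in the crossed product\<close>

lemma norm_compression:
  assumes a: "a \<in> D t"
  shows "reduced_norm D \<alpha> (fs_mult \<alpha> (fs_mult \<alpha> (Poly_Mapping.single 0 x) (Poly_Mapping.single t a))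
      (Poly_Mapping.single 0 x)) = norm (\<alpha> t (\<alpha> (- t) (x * a) * x))"
proof -
  have "\<alpha> (- t) (x * a) * x \<in> D (- t)"
    by (intro closed_ideal_mult_right[OF ideal] action_minus_in closed_ideal_mult_left[OF ideal] a)
  hence "\<alpha> t (\<alpha> (- t) (x * a) * x) \<in> D t" by (rule action_in)
  thus ?thesis by (simp add: fs_mult_single_single reduced_norm_single)
qed

lemma topologically_free_iff_Inf_hereditary:
  "topologically_free D \<alpha> \<longleftrightarrow>
    (\<forall>t. t \<noteq> 0 \<longrightarrow>
      (\<forall>a \<in> D t. \<forall>B. hereditary_subalgebra B \<and> B \<noteq> {0} \<longrightarrow>
         Inf {reduced_norm D \<alpha>
                (fs_mult \<alpha> (fs_mult \<alpha> (Poly_Mapping.single 0 x) (Poly_Mapping.single t a))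
                  (Poly_Mapping.single 0 x)) | x. x \<in> B \<and> positive_element x \<and> norm x = 1} = 0))"
  (is "_ \<longleftrightarrow> ?R")
proof
  assume tf: "topologically_free D \<alpha>"
  show ?R
  proof (intro allI impI ballI, elim conjE)
    fix t a and B :: "'a set" assume t: "t \<noteq> 0" and a: "a \<in> D t" and B: "hereditary_subalgebra B" "B \<noteq> {0}"
    have "0 \<in> B" using B(1) by (simp add: hereditary_subalgebra_def cstar_subalgebra_def complex_subspace_def)
    then obtain b where b: "b \<in> B" "b \<noteq> 0" using B(2) by blast
    \<comment> \<open>Vanishing is asked for every scalar \<open>c\<close> because the normalizing
      constant is chosen only after \<open>z\<close>.\<close>
    have "\<exists>z. b * z \<noteq> 0 \<and> (\<forall>c. \<alpha> (- t) (star (c *\<^sub>R (b * z)) * (c *\<^sub>R (b * z)) * a) * (star (c *\<^sub>R (b * z)) * (c *\<^sub>R (b * z))) = 0)"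
    \<comment> \<open>\<open>B\<close> may be unrelated to \<open>D t\<close>. If \<open>b\<close>
      annihilates \<open>D t\<close>, then \<open>b a = 0\<close> and the compression is already
      zero.\<close>
    proof (cases "\<forall>d\<in>D t. b * d = 0")
      case True
      have ba: "b * a = 0" using True a by blast
      have "\<alpha> (- t) (star (c *\<^sub>R (b * star b)) * (c *\<^sub>R (b * star b)) * a) = 0" for c
      proof -
        have eq: "star (c *\<^sub>R (b * star b)) * (c *\<^sub>R (b * star b)) * a = star (c *\<^sub>R (b * star b)) * (c *\<^sub>R (star b * (b * a)))"
          by (simp add: algebra_simps)
        show ?thesis unfolding eq by (simp add: ba)
      qed
      moreover have "b * star b \<noteq> 0"
        using b(2) cstar_identity[of b] by (auto simp: mult.commute)
      ultimately show ?thesis by (intro exI[of _ "star b"] conjI allI) simp_all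
    next
      case False
      then obtain d where d: "d \<in> D t" "b * d \<noteq> 0" by blast
      \<comment> \<open>The compression applies \<open>\<alpha> (- t)\<close> to \<open>x a\<close>,
        so the moved point is taken for \<open>- t\<close>.\<close>
      have "b * d \<in> D (- (- t))" using closed_ideal_mult_left[OF ideal d(1)] by simp
      then obtain \<phi> where \<phi>: "\<phi> \<in> characters" "\<phi> (b * d) \<noteq> 0" "dual_map D \<alpha> (- t) \<phi> \<noteq> \<phi>"
        using topologically_freeD[OF tf _ _ d(2), of "- t"] t by auto
      hence nz: "\<phi> b \<noteq> 0" "\<phi> d \<noteq> 0" by (auto simp: character_mult[OF \<phi>(1)])
      have supp: "\<phi> \<in> open_support (D (- (- t)))" using open_supportI[OF \<phi>(1) d(1) nz(2)] by simp
      obtain p r where pr: "r \<in> D (- (- t))" "\<phi> p \<noteq> 0" "\<phi> r \<noteq> 0" "p * \<alpha> (- t) r = 0"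
        using moved_point[OF supp \<phi>(3)] .
      define y where "y = b * (p * r)"
      have "\<phi> y \<noteq> 0" using nz pr by (simp add: y_def character_mult[OF \<phi>(1)])
      hence "y \<noteq> 0" using character_zero[OF \<phi>(1)] by auto
      moreover have "\<alpha> (- t) (star (c *\<^sub>R y) * (c *\<^sub>R y) * a) * (star (c *\<^sub>R y) * (c *\<^sub>R y)) = 0" for c
      proof -
        \<comment> \<open>The factor \<open>a\<close> places \<open>w\<close> in \<open>D t\<close>,
          where \<open>\<alpha> (- t)\<close> is multiplicative. Then
          \<open>\<alpha> (- t) r\<close> from one copy of \<open>x\<close> meets \<open>p\<close>
          from the other.\<close>
        define w where "w = star (c *\<^sub>R y) * (c *\<^sub>R (b * p)) * a"
        have w: "w \<in> D t" unfolding w_def by (rule closed_ideal_mult_left[OF ideal a])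
        have "star (c *\<^sub>R y) * (c *\<^sub>R y) * a = w * r" by (simp add: w_def y_def algebra_simps)
        hence e1: "\<alpha> (- t) (star (c *\<^sub>R y) * (c *\<^sub>R y) * a) = \<alpha> (- t) w * \<alpha> (- t) r"
          using action_mult[of w "- t" r] w pr(1) by simp
        have e2: "star (c *\<^sub>R y) * (c *\<^sub>R y) = p * (star (c *\<^sub>R y) * (c *\<^sub>R (b * r)))"
          by (simp add: y_def algebra_simps)
        have "\<alpha> (- t) (star (c *\<^sub>R y) * (c *\<^sub>R y) * a) * (star (c *\<^sub>R y) * (c *\<^sub>R y))
            = \<alpha> (- t) w * \<alpha> (- t) r * (star (c *\<^sub>R y) * (c *\<^sub>R y))"
          by (simp only: e1)
        also have "\<dots> = \<alpha> (- t) w * \<alpha> (- t) r * (p * (star (c *\<^sub>R y) * (c *\<^sub>R (b * r))))"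
          by (simp only: e2)
        also have "\<dots> = (p * \<alpha> (- t) r) * (\<alpha> (- t) w * (star (c *\<^sub>R y) * (c *\<^sub>R (b * r))))"
          by (simp only: mult_ac)
        finally have "\<alpha> (- t) (star (c *\<^sub>R y) * (c *\<^sub>R y) * a) * (star (c *\<^sub>R y) * (c *\<^sub>R y))
            = (p * \<alpha> (- t) r) * (\<alpha> (- t) w * (star (c *\<^sub>R y) * (c *\<^sub>R (b * r))))" .
        thus ?thesis using pr(4) by simp
      qed
      ultimately show ?thesis unfolding y_def by blast
    qed
    then obtain z where z: "b * z \<noteq> 0"
      "\<And>c. \<alpha> (- t) (star (c *\<^sub>R (b * z)) * (c *\<^sub>R (b * z)) * a) * (star (c *\<^sub>R (b * z)) * (c *\<^sub>R (b * z))) = 0"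
      by blast
    obtain c where unit: "positive_element (star (c *\<^sub>R (b * z)) * (c *\<^sub>R (b * z)))"
      "norm (star (c *\<^sub>R (b * z)) * (c *\<^sub>R (b * z))) = 1"
      using exists_positive_element_unit[OF closed_ideal_UNIV UNIV_I z(1)] by blast
    define x where "x = star (c *\<^sub>R (b * z)) * (c *\<^sub>R (b * z))"
    have "c *\<^sub>R (b * z) = b * (c *\<^sub>R z)" by simp
    hence "x \<in> B" unfolding x_def using hereditary_subalgebra_dominated[OF B(1) b(1)] by metis
    moreover have "\<alpha> (- t) (x * a) * x = 0" using z(2)[of c] by (simp add: x_def)
    ultimately show "Inf {reduced_norm D \<alpha>
                (fs_mult \<alpha> (fs_mult \<alpha> (Poly_Mapping.single 0 x) (Poly_Mapping.single t a))
                  (Poly_Mapping.single 0 x)) | x. x \<in> B \<and> positive_element x \<and> norm x = 1} = 0"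
      unfolding norm_compression[OF a] using unit[folded x_def]
      by (intro Inf_eq_0I CollectI exI[of _ x]) auto
  qed
next
  assume R: ?R
  show "topologically_free D \<alpha>"
  proof (rule ccontr)
    assume "\<not> topologically_free D \<alpha>"
    then obtain t K where tK: "t \<noteq> 0" "closed_ideal K" "K \<subseteq> D (- t)" "K \<noteq> {0}"
      and fixed: "\<And>g. g \<in> K \<Longrightarrow> \<alpha> t g = g"
      by (rule not_topologically_freeD) blast
    obtain f where f: "f \<in> K" "f \<noteq> 0" using nonzero_ideal[OF tK(2,4)] .
    obtain w where w: "w \<in> K" "positive_element w" "norm w = 1"
      using exists_positive_element_unit[OF tK(2) f] by metis
    then obtain \<phi> where \<phi>: "\<phi> \<in> characters" "cmod (\<phi> w) = 1"
      using exists_norming_character[of w] by fastforce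
    have real: "\<forall>\<omega>\<in>characters. Im (\<omega> w) = 0" using w(2) by (simp add: positive_element_iff)
    \<comment> \<open>\<open>a\<close> equals 1 where \<open>|w| \<ge> 1/2\<close>, and
      \<open>b\<close> is nonzero only where \<open>|w| > 1/2\<close>. Thus \<open>a\<close> acts as
      a unit on the hereditary subalgebra of functions vanishing where \<open>|w| \<le> 1/2\<close>,
      which contains \<open>b\<close>.\<close>
    obtain a where a: "a \<in> K" "\<And>\<omega>. \<omega> \<in> characters \<Longrightarrow> \<omega> a = of_real (min 1 (2 * \<bar>Re (\<omega> w)\<bar>))"
      by (rule continuous_calculus[OF tK(2) w(1) real, where g = "\<lambda>r. min 1 (2 * \<bar>r\<bar>)"])
         (auto intro!: continuous_intros)
    obtain b where b: "\<And>\<omega>. \<omega> \<in> characters \<Longrightarrow> \<omega> b = of_real (max 0 (\<bar>Re (\<omega> w)\<bar> - 1/2))"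
      by (rule continuous_calculus[OF tK(2) w(1) real, where g = "\<lambda>r. max 0 (\<bar>r\<bar> - 1/2)"])
         (auto intro!: continuous_intros)
    define V where "V = {\<omega> \<in> characters. \<bar>Re (\<omega> w)\<bar> \<le> 1/2}"
    define B where "B = {g. \<forall>\<omega>\<in>V. \<omega> g = 0}"
    have V: "V \<subseteq> characters" by (auto simp: V_def)
    have B: "hereditary_subalgebra B" "closed_ideal B"
      unfolding B_def using V by (rule hereditary_subalgebra_vanishing closed_ideal_vanishing)+
    have "b \<in> B" by (auto simp: B_def V_def b)
    have "\<bar>Re (\<phi> w)\<bar> = 1" using \<phi>(2) positive_element_character[OF w(2) \<phi>(1)] by (metis norm_of_real)
    hence "\<phi> b \<noteq> 0" by (simp add: b[OF \<phi>(1)])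
    hence b0: "b \<noteq> 0" using character_zero[OF \<phi>(1)] by auto
    have absorb: "x * a = x" if x: "x \<in> B" for x
    proof (rule eq_by_characters)
      fix \<omega> :: "'a \<Rightarrow> complex" assume \<omega>: "\<omega> \<in> characters"
      show "\<omega> (x * a) = \<omega> x"
      proof (cases "\<omega> \<in> V")
        case True
        hence "\<omega> x = 0" using x by (simp add: B_def)
        thus ?thesis by (simp add: character_mult[OF \<omega>])
      next
        case False
        hence "\<bar>Re (\<omega> w)\<bar> > 1/2" using \<omega> by (simp add: V_def)
        thus ?thesis by (simp add: character_mult[OF \<omega>] a(2)[OF \<omega>] min_def)
      qed
    qed
    have "a \<in> D t" using action_in[of a t] fixed[OF a(1)] a(1) tK(3) by auto
    have "Inf {reduced_norm D \<alpha>
                (fs_mult \<alpha> (fs_mult \<alpha> (Poly_Mapping.single 0 x) (Poly_Mapping.single t a))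
                  (Poly_Mapping.single 0 x)) | x. x \<in> B \<and> positive_element x \<and> norm x = 1} = 1"
      unfolding norm_compression[OF \<open>a \<in> D t\<close>]
    proof (rule Inf_image_eq_1)
      show "\<exists>x. x \<in> B \<and> positive_element x \<and> norm x = 1"
        using exists_positive_element_unit[OF B(2) \<open>b \<in> B\<close> b0] by metis
      fix x assume x: "x \<in> B \<and> positive_element x \<and> norm x = 1"
      \<comment> \<open>Since \<open>x = x a\<close> lies in \<open>K\<close>, the action is trivial
        on it and the compression reduces to \<open>x^2\<close>.\<close>
      hence xa: "x * a = x" by (simp add: absorb)
      hence xK: "x \<in> K" using closed_ideal_mult_left[OF tK(2) a(1), of x] by simp
      have "\<alpha> (- t) x = x" using action_left_inverse[of x t] fixed[OF xK] xK tK(3) by auto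
      moreover have "\<alpha> t (x * x) = x * x" by (intro fixed closed_ideal_mult_left[OF tK(2)] xK)
      ultimately show "norm (\<alpha> t (\<alpha> (- t) (x * a) * x)) = 1"
        using x by (simp add: xa norm_square_selfadjoint positive_element_selfadjoint)
    qed
    moreover have "B \<noteq> {0}" using \<open>b \<in> B\<close> b0 by blast
    ultimately show False using R tK(1) \<open>a \<in> D t\<close> B(1) by fastforce
  qed
qed

end

theorem proposition3p10:
  fixes D :: "'g::group_add \<Rightarrow> 'a::{cstar_algebra,comm_ring} set"
    and \<alpha> :: "'g \<Rightarrow> 'a \<Rightarrow> 'a"
  assumes "partial_action D \<alpha>"
  shows
    "(topologically_free D \<alpha> \<longleftrightarrow>
        (\<forall>t. t \<noteq> 0 \<longrightarrow>
          (\<forall>K. closed_ideal K \<and> K \<subseteq> D (- t) \<and> K \<noteq> {0} \<and> \<alpha> t ` K = K \<longrightarrow>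
             norm_on K (\<lambda>x. \<alpha> t x - x) = 2)))
     \<and> (topologically_free D \<alpha> \<longleftrightarrow>
        (\<forall>t. t \<noteq> 0 \<longrightarrow>
          (\<forall>K. closed_ideal K \<and> K \<subseteq> D (- t) \<and> K \<noteq> {0} \<longrightarrow>
             Inf {norm (x * \<alpha> t x) | x. x \<in> K \<and> positive_element x \<and> norm x = 1} = 0)))
     \<and> (topologically_free D \<alpha> \<longleftrightarrow>
        (\<forall>t. t \<noteq> 0 \<longrightarrow>
          (\<forall>a \<in> D t. \<forall>B. hereditary_subalgebra B \<and> B \<noteq> {0} \<longrightarrow>
             Inf {reduced_norm D \<alpha>
                    (fs_mult \<alpha> (fs_mult \<alpha> (Poly_Mapping.single 0 x) (Poly_Mapping.single t a))
                      (Poly_Mapping.single 0 x)) | x. x \<in> B \<and> positive_element x \<and> norm x = 1} = 0)))"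
proof -
  interpret abelian_partial_system D \<alpha> by unfold_locales (rule assms)
  show ?thesis
    by (intro conjI topologically_free_iff_norm topologically_free_iff_Inf_ideal
        topologically_free_iff_Inf_hereditary)
qed

end
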